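(* There is an absolute constant $\eta_0\in(0,1)$ such that the following holds. Fix $0\le\beta\le\tfrac12$. Then for all $0<\eta\le\eta_0$, $$\|G_{\beta,\eta}-I\|_{\ell^2\to\ell^2}\le\begin{cases}C_\beta\,\eta,&0\le\beta<\tfrac12,\\ C\sqrt\eta,&\beta=\tfrac12,\end{cases}$$ where $C_\beta$ is a positive constant depending only on $\beta$ and $C$ is a positive absolute constant. Here $I$ is the identity and $G_{\beta,\eta}$ is the Gram matrix with entries $$\frac{K_\eta(x,y)}{\sqrt{K_\eta(x,x)K_\eta(y,y)}},\qquad x,y\in\Lambda^\ast(\beta),$$ acting on $\ell^2$, the Hilbert space of square-summable real sequences indexed by the points of $\Lambda^\ast(\beta)$.
   Context: Hermite functions: $\psi_m(x)=\frac{2^{1/4}}{\sqrt{2^m m!}}H_m(\sqrt{2\pi}\,x)e^{-\pi x^2}$, $m\ge0$, where $H_m$ is the physicists' Hermite polynomial; $(\psi_m)_{m\ge0}$ is an orthonormal basis of $L^2(\mathbb R)$. For $\eta>0$ and $j\ge0$ let $$a_j=\int_0^{e^{-2}}\frac{e^{-(j+1)t}}{\sqrt t\,[\log(1/t)]^{1+\eta}}\,dt ,$$ and let $K_\eta(x,y)=\sum_{j\ge0}a_j\psi_{4j}(x)\psi_{4j}(y)$ for $x,y\in\mathbb R$ (the series converges locally uniformly; $K_\eta$ is the reproducing kernel of the real Hilbert space $\mathcal H_\eta$ of all $g=\sum_{j\ge0}c_j\psi_{4j}$, $c_j\in\mathbb R$, with $\|g\|_\eta^2:=\sum_j|c_j|^2/a_j<\infty$).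 The nodes are $\lambda_n(\beta)=\sqrt n/[\log(e+n)]^\beta$, $n\ge0$, and $\Lambda^\ast(\beta)$ is the sequence consisting of the points $\tfrac12,\lambda_0(\beta),\lambda_1(\beta),\lambda_2(\beta),\dots$. *)

theory Defs
  imports "HOL-Analysis.Analysis"
begin

section \<open>Hermite functions\<close>

text \<open>The physicists' Hermite polynomials, given by the Rodrigues formula.\<close>

definition hermite_H :: "nat \<Rightarrow> real \<Rightarrow> real" where
  "hermite_H m x = (-1) ^ m * exp (x\<^sup>2) * (deriv ^^ m) (\<lambda>t. exp (- t\<^sup>2)) x"

definition hermite_fun :: "nat \<Rightarrow> real \<Rightarrow> real" where
  "hermite_fun m x =
     2 powr (1/4) / sqrt (2 ^ m * fact m) * hermite_H m (sqrt (2 * pi) * x) * exp (- pi * x\<^sup>2)"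


section \<open>The kernel\<close>

definition coeff_a :: "real \<Rightarrow> nat \<Rightarrow> real" where
  "coeff_a \<eta> j =
     (LBINT t:{0<..exp (-2)}. exp (- (real j + 1) * t) / (sqrt t * ln (1 / t) powr (1 + \<eta>)))"

definition kernel_K :: "real \<Rightarrow> real \<Rightarrow> real \<Rightarrow> real" where
  "kernel_K \<eta> x y = (\<Sum>j. coeff_a \<eta> j * hermite_fun (4 * j) x * hermite_fun (4 * j) y)"


section \<open>Nodes and Gram matrix\<close>

definition node :: "real \<Rightarrow> nat \<Rightarrow> real" where
  "node \<beta> n = sqrt (real n) / ln (exp 1 + real n) powr \<beta>"

text \<open>The augmented sequence \<open>1/2, node \<beta> 0, node \<beta> 1, \<dots>\<close>, indexed by the natural numbers.\<close>

definition node_star :: "real \<Rightarrow> nat \<Rightarrow> real" where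
  "node_star \<beta> i = (case i of 0 \<Rightarrow> 1/2 | Suc n \<Rightarrow> node \<beta> n)"

definition gram :: "real \<Rightarrow> real \<Rightarrow> nat \<Rightarrow> nat \<Rightarrow> real" where
  "gram \<beta> \<eta> i j =
     (let x = node_star \<beta> i; y = node_star \<beta> j
      in kernel_K \<eta> x y / sqrt (kernel_K \<eta> x x * kernel_K \<eta> y y))"


section \<open>The real Hilbert space of square-summable sequences\<close>

lemma summable_mult_of_squares:
  fixes f g :: "nat \<Rightarrow> real"
  assumes "summable (\<lambda>n. (f n)\<^sup>2)" "summable (\<lambda>n. (g n)\<^sup>2)"
  shows "summable (\<lambda>n. f n * g n)"
proof (rule summable_comparison_test')
  show "summable (\<lambda>n. (f n)\<^sup>2 + (g n)\<^sup>2)"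
    using assms by (rule summable_add)
  show "norm (f n * g n) \<le> (f n)\<^sup>2 + (g n)\<^sup>2" if "n \<ge> 0" for n
  proof -
    have "2 * (\<bar>f n\<bar> * \<bar>g n\<bar>) \<le> (f n)\<^sup>2 + (g n)\<^sup>2"
      using sum_squares_bound[of "\<bar>f n\<bar>" "\<bar>g n\<bar>"] by (simp add: mult.assoc)
    moreover have "0 \<le> \<bar>f n\<bar> * \<bar>g n\<bar>" by simp
    ultimately show ?thesis by (simp only: real_norm_def abs_mult)
  qed
qed

typedef ell2 = "{f :: nat \<Rightarrow> real. summable (\<lambda>n. (f n)\<^sup>2)}"
  morphisms ell2_nth Abs_ell2
  by (rule exI[of _ "\<lambda>_. 0"]) simp

setup_lifting type_definition_ell2

lemma ell2_eqI: "(\<And>n. ell2_nth f n = ell2_nth g n) \<Longrightarrow> f = g"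
  by (simp add: ell2_nth_inject[symmetric] fun_eq_iff)

lemma summable_ell2_square: "summable (\<lambda>n. (ell2_nth f n)\<^sup>2)"
  using ell2_nth[of f] by simp

lemma summable_ell2_mult: "summable (\<lambda>n. ell2_nth f n * ell2_nth g n)"
  by (intro summable_mult_of_squares summable_ell2_square)

instantiation ell2 :: real_inner
begin

lift_definition zero_ell2 :: ell2 is "\<lambda>_. 0"
  by simp

lift_definition plus_ell2 :: "ell2 \<Rightarrow> ell2 \<Rightarrow> ell2" is "\<lambda>f g n. f n + g n"
proof -
  fix f g :: "nat \<Rightarrow> real"
  assume f: "summable (\<lambda>n. (f n)\<^sup>2)" and g: "summable (\<lambda>n. (g n)\<^sup>2)"
  have "summable (\<lambda>n. (f n)\<^sup>2 + (g n)\<^sup>2 + 2 * (f n * g n))"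
    by (intro summable_add summable_mult summable_mult_of_squares f g)
  then show "summable (\<lambda>n. (f n + g n)\<^sup>2)"
    by (simp add: power2_sum mult.assoc)
qed

lift_definition uminus_ell2 :: "ell2 \<Rightarrow> ell2" is "\<lambda>f n. - f n"
  by simp

definition minus_ell2 :: "ell2 \<Rightarrow> ell2 \<Rightarrow> ell2" where
  "minus_ell2 f g = f + - g"

lift_definition scaleR_ell2 :: "real \<Rightarrow> ell2 \<Rightarrow> ell2" is "\<lambda>r f n. r * f n"
  by (simp add: power_mult_distrib summable_mult)

definition inner_ell2 :: "ell2 \<Rightarrow> ell2 \<Rightarrow> real" where
  "inner_ell2 f g = (\<Sum>n. ell2_nth f n * ell2_nth g n)"

definition norm_ell2 :: "ell2 \<Rightarrow> real" where
  "norm_ell2 f = sqrt (inner f f)"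

definition dist_ell2 :: "ell2 \<Rightarrow> ell2 \<Rightarrow> real" where
  "dist_ell2 f g = norm (f - g)"

definition sgn_ell2 :: "ell2 \<Rightarrow> ell2" where
  "sgn_ell2 f = inverse (norm f) *\<^sub>R f"

definition uniformity_ell2 :: "(ell2 \<times> ell2) filter" where
  "uniformity_ell2 = (INF e\<in>{0<..}. principal {(x, y). dist x y < e})"

definition open_ell2 :: "ell2 set \<Rightarrow> bool" where
  "open_ell2 U = (\<forall>x\<in>U. \<forall>\<^sub>F (x', y) in uniformity. x' = x \<longrightarrow> y \<in> U)"

instance
proof
  fix f g h :: ell2 and r s :: real and U :: "ell2 set"
  show "f + g + h = f + (g + h)" by transfer (simp add: add.assoc)
  show "f + g = g + f" by transfer (simp add: add.commute)
  show "0 + f = f" by transfer simp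
  show "- f + f = 0" by transfer simp
  show "f - g = f + - g" by (rule minus_ell2_def)
  show "r *\<^sub>R (f + g) = r *\<^sub>R f + r *\<^sub>R g" by transfer (simp add: distrib_left)
  show "(r + s) *\<^sub>R f = r *\<^sub>R f + s *\<^sub>R f" by transfer (simp add: distrib_right)
  show "r *\<^sub>R s *\<^sub>R f = (r * s) *\<^sub>R f" by transfer (simp add: mult.assoc)
  show "1 *\<^sub>R f = f" by transfer simp
  show "dist f g = norm (f - g)" by (rule dist_ell2_def)
  show "sgn f = inverse (norm f) *\<^sub>R f" by (rule sgn_ell2_def)
  show "uniformity = (INF e\<in>{0<..}. principal {(x :: ell2, y). dist x y < e})"
    by (rule uniformity_ell2_def)
  show "open U = (\<forall>x\<in>U. \<forall>\<^sub>F (x', y) in uniformity. x' = x \<longrightarrow> y \<in> U)"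
    by (rule open_ell2_def)
  show "inner f g = inner g f"
    by (simp add: inner_ell2_def mult.commute)
  show "inner (f + g) h = inner f h + inner g h"
    by (simp add: inner_ell2_def plus_ell2.rep_eq distrib_right suminf_add summable_ell2_mult)
  show "inner (r *\<^sub>R f) g = r * inner f g"
    by (simp add: inner_ell2_def scaleR_ell2.rep_eq mult.assoc suminf_mult summable_ell2_mult)
  show "0 \<le> inner f f"
    by (simp add: inner_ell2_def suminf_nonneg summable_ell2_mult)
  show "inner f f = 0 \<longleftrightarrow> f = 0"
  proof
    assume "inner f f = 0"
    then have "\<forall>n. ell2_nth f n * ell2_nth f n = 0"
      by (subst (asm) inner_ell2_def, subst (asm) suminf_eq_zero_iff)
         (auto simp: summable_ell2_mult)
    then show "f = 0"
      by (intro ell2_eqI) (simp add: zero_ell2.rep_eq)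
  qed (simp add: inner_ell2_def zero_ell2.rep_eq)
  show "norm f = sqrt (inner f f)" by (rule norm_ell2_def)
qed

end

text \<open>The bounded operator \<open>T\<close> is matrix-vector multiplication by the infinite matrix \<open>M\<close>. In
  particular every row series converges; \<open>T\<close> is unique if it exists.\<close>

definition has_matrix :: "(ell2 \<Rightarrow>\<^sub>L ell2) \<Rightarrow> (nat \<Rightarrow> nat \<Rightarrow> real) \<Rightarrow> bool" where
  "has_matrix T M \<longleftrightarrow>
     (\<forall>c i. (\<lambda>j. M i j * ell2_nth c j) sums ell2_nth (blinfun_apply T c) i)"

end

theory Submission
  imports
    Defs
    "HOL-Complex_Analysis.Complex_Analysis"
    "HOL-Real_Asymp.Real_Asymp"
    "HOL-Library.Discrete_Functions"
begin

text \<open>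
  Why the Gram matrix is close to the identity. The coefficients \<open>coeff_a \<eta> j\<close> are Laplace integrals, so
  the kernel is an average over \<open>0 < t \<le> exp (-2)\<close>, against the weight
  \<open>t powr (- 1/2) ln (1/t) powr (- (1 + \<eta>))\<close>, of the series over every fourth Hermite function with geometric
  factor \<open>exp (- j t)\<close>. Mehler's formula, taken at the four points \<open>r, - r, \<i> r, - \<i> r\<close> with
  \<open>r = exp (- t / 4)\<close>, evaluates that series: it is a sum of two Gaussians, of height
  \<open>t powr (- 1/2)\<close>, and a cosine kernel, which up to a bounded factor is
  \<open>exp (- pi a (x\<^sup>2 + y\<^sup>2)) cos (2 pi s x y)\<close> with \<open>a = tanh (t / 4)\<close> and \<open>s = 1 / cosh (t / 4)\<close>.
  Accordingly \<open>kernel_K = kernel_P + kernel_Q\<close> (\<open>kernel_K_split\<close>).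

  On the diagonal only the range \<open>t \<le> 1 / x\<^sup>2\<close> counts, and there the Gaussians contribute
  \<open>\<integral> dt / (t ln (1/t) powr (1 + \<eta>))\<close>, which is of order \<open>1 / (\<eta> (ln x) powr \<eta>)\<close> (\<open>kernel_K_diag_ge\<close>).
  The large factor \<open>1 / \<eta>\<close> comes from the divergence of the integral of \<open>1 / (t ln (1/t))\<close> at 0 and is
  absent as soon as something keeps \<open>t\<close> away from 0 or removes the factor \<open>t powr (- 1/2)\<close>. Hence
  normalisation by the diagonal gives every other contribution a factor \<open>\<eta>\<close>, and what remains is to
  bound the off-diagonal Gaussian part and the whole cosine part, as quadratic forms, by
  the sum of \<open>(ln i) powr (- \<eta>) c\<^sub>i\<^sup>2\<close>.

  For the Gaussian part Schur's test suffices (\<open>kernel_P_form_le\<close>): the entry at \<open>x, y\<close> decays in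
  \<open>\<bar>x\<^sup>2 - y\<^sup>2\<bar>\<close>, and the squares of the nodes are separated by about \<open>1 / (ln i) powr (2 \<beta>)\<close>.

  The cosine part has entries of size about \<open>1 / (x + y)\<close> up to logarithms, and its rows are not absolutely summable;
  its oscillation is needed. The cosine kernel is the even part of the Fourier transform composed
  with a Gaussian smoothing: in the Hermite expansion it differs from the Gaussian kernel only by the
  factors \<open>Re (\<i> ^ m)\<close>, of modulus at most 1. So its bilinear form is dominated by the Gaussian forms of the two vectors,
  whose entries are positive (\<open>cos_kernel_form_le\<close>). A scaling of the nodes turns the
  parameter \<open>a\<close> into any other one (\<open>cos_kernel_rescale\<close>), at the price of harmless Gaussian
  weights, so that for nodes up to \<open>sqrt T\<close> the form can be compared with Gaussians of width \<open>1 / sqrt T\<close>,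
  for all \<open>t\<close> at once. The indices are cut into dyadic shells, and each shell is paired with itself and all shells below it,
  taken as one block. For the \<open>k\<close>-th shell this gives \<open>(k + 1) powr (- 1 - \<eta>)\<close> times Gaussian
  row sums, which are of order \<open>(k + 1) powr (2 \<beta>)\<close> in the shell and of order 1 far below it. With weights
  balanced between the two sides, the sum over the shells above a given one produces the tail of
  \<open>(k + 1) powr (- 1 - p)\<close>, \<open>p = 1 - 2 \<beta> + \<eta>\<close>, hence a factor \<open>1 + 1 / p\<close>, of which the
  balancing leaves the square root (\<open>kernel_Q_form_le\<close>).

  Altogether the distance to the identity is at most a constant times \<open>\<eta> sqrt (1 + 1 / p)\<close>. For \<open>\<beta> < 1/2\<close>
  the root is bounded, and for \<open>\<beta> = 1/2\<close> one has \<open>p = \<eta>\<close>, which turns \<open>\<eta>\<close> into \<open>sqrt \<eta>\<close>.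
\<close>

section \<open>Mehler's formula\<close>

fun herm :: "nat \<Rightarrow> 'a::comm_ring_1 \<Rightarrow> 'a" where
  "herm 0 x = 1"
| "herm (Suc 0) x = 2 * x"
| "herm (Suc (Suc n)) x = 2 * x * herm (Suc n) x - 2 * of_nat (Suc n) * herm n x"

lemma has_field_derivative_herm:
  "(herm n has_field_derivative 2 * real n * herm (n - 1) x) (at x)"
proof (induction n "x::real" rule: herm.induct)
  case (1 x)
  have "herm 0 = (\<lambda>x::real. 1)" by auto
  then show ?case by simp
next
  case (2 x)
  have "herm (Suc 0) = (\<lambda>x::real. 2 * x)" by auto
  then show ?case by (auto intro!: derivative_eq_intros)
next
  case (3 n x)
  have eq: "herm (Suc (Suc n)) = (\<lambda>x::real. 2 * x * herm (Suc n) x - 2 * of_nat (Suc n) * herm n x)"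
    by auto
  have "herm (Suc n) x = 2 * x * herm n x - 2 * real n * herm (n - 1) x"
    by (cases n) auto
  then show ?case unfolding eq
    by (auto intro!: derivative_eq_intros 3 simp del: of_nat_Suc) (simp add: algebra_simps)
qed

text \<open>Rodrigues' formula agrees with the three-term recurrence because \<open>exp (- t\<^sup>2)\<close> times a Hermite polynomial
  has derivative \<open>(H' - 2 t H) exp (- t\<^sup>2)\<close>, and \<open>H' - 2 t H\<close> is minus the next polynomial.\<close>

lemma higher_deriv_gauss:
  "(deriv ^^ n) (\<lambda>t::real. exp (- t\<^sup>2)) = (\<lambda>t. (-1) ^ n * herm n t * exp (- t\<^sup>2))"
proof (induction n)
  case (Suc n)
  have "deriv (\<lambda>t. (-1) ^ n * herm n t * exp (- t\<^sup>2)) t = (-1) ^ Suc n * herm (Suc n) t * exp (- t\<^sup>2)" for t :: real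
  proof (rule DERIV_imp_deriv)
    have "herm (Suc n) t = 2 * t * herm n t - 2 * real n * herm (n - 1) t"
      by (cases n) auto
    then show "((\<lambda>t. (-1) ^ n * herm n t * exp (- t\<^sup>2)) has_real_derivative
        (-1) ^ Suc n * herm (Suc n) t * exp (- t\<^sup>2)) (at t)"
      by (auto intro!: derivative_eq_intros has_field_derivative_herm) (simp add: algebra_simps)
  qed
  then show ?case using Suc by simp
qed simp

lemma hermite_H_eq_herm: "hermite_H n x = herm n x"
proof -
  have "hermite_H n x = ((-1) ^ n * (-1) ^ n) * (exp (x\<^sup>2) * exp (- x\<^sup>2)) * herm n x"
    unfolding hermite_H_def higher_deriv_gauss by (simp add: algebra_simps)
  also have "\<dots> = herm n x"
    by (simp flip: exp_add power_mult_distrib)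
  finally show ?thesis .
qed

lemma of_real_herm: "of_real (herm n x) = herm n (complex_of_real x)"
  by (induction n x rule: herm.induct) auto

text \<open>The Taylor coefficients in \<open>z\<close> of Mehler's function.\<close>

definition mehler_coeff :: "complex \<Rightarrow> complex \<Rightarrow> nat \<Rightarrow> complex" where
  "mehler_coeff x y n = herm n x * herm n y / (2 ^ n * fact n)"

lemma clear_mehler_denominators:
  fixes p q r s F :: complex
  assumes "p \<noteq> 0" "q \<noteq> 0" "r \<noteq> 0" "s \<noteq> 0" "F \<noteq> 0"
  shows "a / F = (16 * p * q * r * a) / (16 * p * q * r * F)"
    "a / (2 * p * F) = (8 * q * r * a) / (16 * p * q * r * F)"
    "a / (4 * p * q * F) = 4 * r * a / (16 * p * q * r * F)"
    "a / (8 * p * q * r * F) = 2 * a / (16 * p * q * r * F)"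
    "s * (a / (16 * p * q * r * s * F)) = a / (16 * p * q * r * F)"
  using assms by (simp_all add: field_simps)

text \<open>The logarithmic derivative of Mehler's function \<open>exp ((2 z x y - z\<^sup>2 (x\<^sup>2 + y\<^sup>2)) / (1 - z\<^sup>2)) / sqrt (1 - z\<^sup>2)\<close>
  is rational in \<open>z\<close> with denominator \<open>(1 - z\<^sup>2)\<^sup>2\<close>; comparing coefficients in the resulting
  differential equation gives this recurrence. It holds for products of Hermite polynomials by the
  three-term recurrence alone.\<close>

lemma mehler_coeff_rec:
  "of_nat (n + 4) * mehler_coeff x y (n + 4) =
     2 * x * y * mehler_coeff x y (n + 3) + (2 * of_nat n + 5 - 2 * (x\<^sup>2 + y\<^sup>2)) * mehler_coeff x y (n + 2)
     + 2 * x * y * mehler_coeff x y (n + 1) - of_nat (n + 1) * mehler_coeff x y n"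
proof -
  define N :: complex where "N = of_nat n"
  define a b c d where "a = herm n x" and "b = herm (Suc n) x" and "c = herm n y" and "d = herm (Suc n) y"
  define F :: complex where "F = 2 ^ n * fact n"
  have F0: "F \<noteq> 0" by (simp add: F_def)
  have N0: "N + 1 \<noteq> 0" "N + 2 \<noteq> 0" "N + 3 \<noteq> 0" "N + 4 \<noteq> 0"
    unfolding N_def by (metis of_nat_Suc of_nat_neq_0 add.commute, (metis of_nat_numeral of_nat_add of_nat_eq_0_iff add_is_0 zero_neq_numeral)+)
  have x2: "herm (n + 2) x = 2 * x * b - 2 * (N + 1) * a" and y2: "herm (n + 2) y = 2 * y * d - 2 * (N + 1) * c"
    by (auto simp: a_def b_def c_def d_def N_def numeral_2_eq_2 algebra_simps)
  have x3: "herm (n + 3) x = 2 * x * herm (n + 2) x - 2 * (N + 2) * b" and y3: "herm (n + 3) y = 2 * y * herm (n + 2) y - 2 * (N + 2) * d"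
    by (auto simp: a_def b_def c_def d_def N_def numeral_3_eq_3 numeral_2_eq_2 algebra_simps)
  have x4: "herm (n + 4) x = 2 * x * herm (n + 3) x - 2 * (N + 3) * herm (n + 2) x" and y4: "herm (n + 4) y = 2 * y * herm (n + 3) y - 2 * (N + 3) * herm (n + 2) y"
    by (auto simp: N_def eval_nat_numeral algebra_simps)
  have m0: "mehler_coeff x y n = a * c / F" by (simp add: mehler_coeff_def a_def c_def F_def)
  have m1: "mehler_coeff x y (n + 1) = b * d / (2 * (N + 1) * F)"
    by (simp add: mehler_coeff_def b_def d_def F_def N_def algebra_simps)
  have m2: "mehler_coeff x y (n + 2) = herm (n + 2) x * herm (n + 2) y / (4 * (N + 1) * (N + 2) * F)"
    by (simp add: mehler_coeff_def F_def N_def algebra_simps eval_nat_numeral)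
  have m3: "mehler_coeff x y (n + 3) = herm (n + 3) x * herm (n + 3) y / (8 * (N + 1) * (N + 2) * (N + 3) * F)"
    by (simp add: mehler_coeff_def F_def N_def algebra_simps eval_nat_numeral del: herm.simps)
  have m4: "mehler_coeff x y (n + 4) = herm (n + 4) x * herm (n + 4) y / (16 * (N + 1) * (N + 2) * (N + 3) * (N + 4) * F)"
    by (simp add: mehler_coeff_def F_def N_def algebra_simps eval_nat_numeral del: herm.simps)
  have of: "of_nat (n + 4) = N + 4" "of_nat (n + 1) = N + 1" "of_nat n = N"
    by (simp_all add: N_def)
  define X2 X3 Y2 Y3 where "X2 = herm (n + 2) x" and "X3 = herm (n + 3) x" and "Y2 = herm (n + 2) y" and "Y3 = herm (n + 3) y"
  \<comment> \<open>Expressing the two lower polynomials through the two upper ones keeps the identity to be checked small.\<close>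
  have b: "2 * (N + 2) * b = 2 * x * X2 - X3" and d: "2 * (N + 2) * d = 2 * y * Y2 - Y3"
    using x3 y3 by (simp_all add: X2_def X3_def Y2_def Y3_def)
  have a: "2 * (N + 1) * a = 2 * x * b - X2" and c: "2 * (N + 1) * c = 2 * y * d - Y2"
    using x2 y2 by (simp_all add: X2_def Y2_def)
  have ac: "4 * (N + 1)\<^sup>2 * (a * c) = (2 * x * b - X2) * (2 * y * d - Y2)"
    unfolding a[symmetric] c[symmetric] by (simp add: power2_eq_square algebra_simps)
  have bd: "4 * (N + 2) * (x * y * (4 * (b * d))) - 4 * (N + 2) * (4 * (N + 1)\<^sup>2 * (a * c))
    = 4 * (x * Y2 * (2 * (N + 2) * b) + y * X2 * (2 * (N + 2) * d) - (N + 2) * X2 * Y2)"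
    unfolding ac by (simp add: algebra_simps)
  have key: "(2 * x * X3 - 2 * (N + 3) * X2) * (2 * y * Y3 - 2 * (N + 3) * Y2)
    = 4 * x * y * (X3 * Y3) + (2 * N + 5 - 2 * (x\<^sup>2 + y\<^sup>2)) * (4 * (N + 3) * (X2 * Y2))
      + (N + 3) * (4 * (N + 2) * (x * y * (4 * (b * d))) - 4 * (N + 2) * (4 * (N + 1)\<^sup>2 * (a * c)))"
    unfolding bd unfolding b d by (simp add: algebra_simps power2_eq_square)
  define D where "D = 16 * (N + 1) * (N + 2) * (N + 3) * F"
  have D0: "D \<noteq> 0" using N0 F0 by (simp only: D_def mult_eq_0_iff) simp
  note frac = clear_mehler_denominators[OF N0(1) N0(2) N0(3) N0(4) F0, folded D_def]
  have "(N + 4) * mehler_coeff x y (n + 4) = (2 * x * X3 - 2 * (N + 3) * X2) * (2 * y * Y3 - 2 * (N + 3) * Y2) / D"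
    unfolding m4 frac x4 y4 by (simp add: X2_def X3_def Y2_def Y3_def)
  also have "\<dots> = 2 * x * y * (2 * (X3 * Y3) / D) + (2 * N + 5 - 2 * (x\<^sup>2 + y\<^sup>2)) * (4 * (N + 3) * (X2 * Y2) / D)
     + 2 * x * y * ((8 * (N + 2) * (N + 3) * (b * d)) / D) - (N + 1) * ((16 * (N + 1) * (N + 2) * (N + 3) * (a * c)) / D)"
    unfolding key times_divide_eq_right add_divide_distrib[symmetric] diff_divide_distrib[symmetric]
    by (rule arg_cong[of _ _ "\<lambda>u. u / D"]) (simp add: algebra_simps power2_eq_square)
  finally show ?thesis
    unfolding of m0 m1 m2 m3 X2_def[symmetric] X3_def[symmetric] Y2_def[symmetric] Y3_def[symmetric] frac(1-4) .
qed

lemma mehler_coeff_small: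
  "mehler_coeff x y 0 = 1" "mehler_coeff x y 1 = 2 * x * y"
  "mehler_coeff x y 2 = (2 * x\<^sup>2 - 1) * (2 * y\<^sup>2 - 1) / 2"
  "mehler_coeff x y 3 = (2 * x ^ 3 - 3 * x) * (2 * y ^ 3 - 3 * y) / 3"
  by (simp_all add: mehler_coeff_def eval_nat_numeral field_simps)

definition mehler_ode_poly :: "complex \<Rightarrow> complex \<Rightarrow> complex fps" where
  "mehler_ode_poly x y = fps_X - fps_X ^ 3 + fps_const (2 * x * y) * (1 + fps_X\<^sup>2) - fps_const (2 * (x\<^sup>2 + y\<^sup>2)) * fps_X"

lemma mehler_coeff_ode:
  "(1 - fps_X\<^sup>2)\<^sup>2 * fps_deriv (Abs_fps (mehler_coeff x y)) = mehler_ode_poly x y * Abs_fps (mehler_coeff x y)"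
    (is "_ * fps_deriv ?G = _ * ?G")
proof (rule fps_ext)
  fix n :: nat
  have L: "(1 - fps_X\<^sup>2)\<^sup>2 * fps_deriv ?G = fps_deriv ?G - 2 * (fps_X ^ 2 * fps_deriv ?G) + fps_X ^ 4 * fps_deriv ?G"
    by algebra
  have R: "mehler_ode_poly x y * ?G = fps_X ^ 1 * ?G - fps_X ^ 3 * ?G + fps_const (2 * x * y) * ?G
      + fps_const (2 * x * y) * (fps_X ^ 2 * ?G) - fps_const (2 * (x\<^sup>2 + y\<^sup>2)) * (fps_X ^ 1 * ?G)"
    unfolding mehler_ode_poly_def by (simp add: algebra_simps)
  have Xp: "fps_nth (fps_X ^ k * H) n = (if n < k then 0 else fps_nth H (n - k))" for k n and H :: "complex fps"
    by (rule fps_X_power_mult_nth)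
  have c2: "fps_nth (2 * H) n = 2 * fps_nth H n" for n and H :: "complex fps"
    by (simp add: numeral_fps_const)
  have "n = 0 \<or> n = 1 \<or> n = 2 \<or> (\<exists>k. n = k + 3)" for n :: nat
    by presburger
  from this[of n] consider "n = 0" | "n = 1" | "n = 2" | k where "n = k + 3" by blast
  then show "fps_nth ((1 - fps_X\<^sup>2)\<^sup>2 * fps_deriv ?G) n = fps_nth (mehler_ode_poly x y * ?G) n"
  proof cases
    case 1
    show ?thesis unfolding L R fps_add_nth fps_sub_nth fps_mult_left_const_nth Xp c2 fps_deriv_nth 1
      using mehler_coeff_small[of x y] by simp
  next
    case 2
    have "2 * mehler_coeff x y 2 = mehler_coeff x y 0 + 2 * x * y * mehler_coeff x y 1 - 2 * (x\<^sup>2 + y\<^sup>2) * mehler_coeff x y 0"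
      by (simp only: mehler_coeff_small) (simp add: field_simps power2_eq_square)
    then show ?thesis unfolding L R fps_add_nth fps_sub_nth fps_mult_left_const_nth Xp c2 fps_deriv_nth 2
      by (simp add: numeral_2_eq_2)
  next
    case 3
    have "3 * mehler_coeff x y 3 - 2 * mehler_coeff x y 1 = mehler_coeff x y 1 + 2 * x * y * mehler_coeff x y 2
       + 2 * x * y * mehler_coeff x y 0 - 2 * (x\<^sup>2 + y\<^sup>2) * mehler_coeff x y 1"
      by (simp only: mehler_coeff_small) (simp add: field_simps power2_eq_square power3_eq_cube)
    then show ?thesis unfolding L R fps_add_nth fps_sub_nth fps_mult_left_const_nth Xp c2 fps_deriv_nth 3
      by (simp add: numeral_2_eq_2 numeral_3_eq_3)
  next
    case (4 k)
    have "(if k + 3 < 4 then 0 else fps_nth (fps_deriv ?G) (k + 3 - 4)) = of_nat k * mehler_coeff x y k"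
      by (cases k) auto
    moreover have "(of_nat k + 4) * mehler_coeff x y (k + 4) - 2 * ((of_nat k + 2) * mehler_coeff x y (k + 2)) + of_nat k * mehler_coeff x y k
      = mehler_coeff x y (k + 2) - mehler_coeff x y k + 2 * x * y * mehler_coeff x y (k + 3)
        + 2 * x * y * mehler_coeff x y (k + 1) - 2 * (x\<^sup>2 + y\<^sup>2) * mehler_coeff x y (k + 2)"
      using mehler_coeff_rec[of k x y] by (simp add: algebra_simps)
    moreover have "fps_nth (fps_deriv ?G) (k + 3) = (of_nat k + 4) * mehler_coeff x y (k + 4)"
      "fps_nth (fps_deriv ?G) (k + 3 - 2) = (of_nat k + 2) * mehler_coeff x y (k + 2)"
      by (simp_all add: eval_nat_numeral algebra_simps)
    moreover have k4: "k + 4 = Suc (Suc (Suc (Suc k)))" by simp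
    ultimately show ?thesis unfolding L R fps_add_nth fps_sub_nth fps_mult_left_const_nth Xp c2 4
      by (simp add: numeral_2_eq_2 numeral_3_eq_3 k4 add.commute[of 4] add.commute[of 2])
  qed
qed

text \<open>The coefficients of a solution are determined successively by the constant one, since the leading
  factor \<open>U\<close> is invertible as a power series.\<close>

lemma fps_linear_ode_unique:
  fixes F G U P :: "complex fps"
  assumes "fps_nth U 0 \<noteq> 0" "U * fps_deriv F = P * F" "U * fps_deriv G = P * G" "fps_nth F 0 = fps_nth G 0"
  shows "F = G"
proof -
  define D where "D = F - G"
  have "U * fps_deriv D = P * D"
    using assms by (simp add: D_def algebra_simps)
  moreover have "inverse U * U = 1" using assms(1) by (rule inverse_mult_eq_1)
  ultimately have D: "fps_deriv D = (inverse U * P) * D"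
    by (metis mult.assoc mult_1)
  have "fps_nth D n = 0" for n
  proof (induction n rule: less_induct)
    case (less n)
    show ?case
    proof (cases n)
      case 0
      then show ?thesis using assms by (simp add: D_def)
    next
      case (Suc m)
      have "of_nat (Suc m) * fps_nth D (Suc m) = fps_nth (fps_deriv D) m" by simp
      also have "\<dots> = 0" unfolding D fps_mult_nth
        by (rule sum.neutral) (use less Suc in auto)
      finally show ?thesis using Suc by (simp del: of_nat_Suc)
    qed
  qed
  then show ?thesis by (simp add: D_def fps_eq_iff)
qed

text \<open>The right-hand side is holomorphic in the unit disc, where \<open>Re (1 - z\<^sup>2) > 0\<close> makes the
  principal root holomorphic. Its Taylor series solves the differential equation of the series on the left, so both agree.\<close>

lemma sums_mehler_complex:
  fixes x y z :: complex
  assumes z: "norm z < 1"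
  shows "(\<lambda>n. mehler_coeff x y n * z ^ n) sums
    (exp ((2 * z * x * y - z\<^sup>2 * (x\<^sup>2 + y\<^sup>2)) / (1 - z\<^sup>2)) / csqrt (1 - z\<^sup>2))"
proof -
  define f where "f = (\<lambda>z. exp ((2 * z * x * y - z\<^sup>2 * (x\<^sup>2 + y\<^sup>2)) / (1 - z\<^sup>2)) / csqrt (1 - z\<^sup>2))"
  have re: "Re (1 - z\<^sup>2) > 0" if "norm z < 1" for z :: complex
  proof -
    have "Re (z\<^sup>2) \<le> norm (z\<^sup>2)" by (rule complex_Re_le_cmod)
    also have "\<dots> < 1" using that by (simp add: norm_power power_less_one_iff abs_square_less_1)
    finally show ?thesis by simp
  qed
  have nz: "1 - z\<^sup>2 \<noteq> 0" "1 - z\<^sup>2 \<notin> \<real>\<^sub>\<le>\<^sub>0" if "norm z < 1" for z :: complex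
    using re[OF that] by (auto simp: complex_nonpos_Reals_iff)
  have der: "(f has_field_derivative
     ((z - z ^ 3 + 2 * x * y * (1 + z\<^sup>2) - 2 * (x\<^sup>2 + y\<^sup>2) * z) / (1 - z\<^sup>2)\<^sup>2) * f z) (at z)"
    if "norm z < 1" for z
  proof -
    define s where "s = csqrt (1 - z\<^sup>2)"
    define w where "w = 1 - z\<^sup>2"
    have w: "w \<noteq> 0" using nz[OF that] by (simp add: w_def)
    have s: "s \<noteq> 0" "s * s = w" using nz[OF that] unfolding s_def w_def
      by (auto simp flip: power2_eq_square)
    define E where "E = (2 * z * x * y - z\<^sup>2 * (x\<^sup>2 + y\<^sup>2)) / w"
    define E' where "E' = ((2 * x * y - 2 * z * (x\<^sup>2 + y\<^sup>2)) * w + 2 * z * (2 * z * x * y - z\<^sup>2 * (x\<^sup>2 + y\<^sup>2))) / (w * w)"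
    have 1: "((\<lambda>z. (2 * z * x * y - z\<^sup>2 * (x\<^sup>2 + y\<^sup>2)) / (1 - z\<^sup>2)) has_field_derivative E') (at z)"
      by (rule derivative_eq_intros refl nz[OF that])+ (simp add: E'_def w_def algebra_simps)
    have 2: "((\<lambda>z. csqrt (1 - z\<^sup>2)) has_field_derivative (- z / s)) (at z)"
      by (rule derivative_eq_intros has_field_derivative_csqrt' refl nz[OF that])+ (simp add: s_def field_simps)
    have "(f has_field_derivative (exp E * E' * s - exp E * (- z / s)) / (s * s)) (at z)"
      unfolding f_def using DERIV_divide[OF DERIV_exp[THEN DERIV_chain2, OF 1] 2] s(1)
      by (simp add: s_def E_def w_def)
    moreover have "(exp E * E' * s - exp E * (- z / s)) / (s * s) = (E' + z / w) * (exp E / s)"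
      unfolding s(2)[symmetric] using s(1) by (simp add: field_simps)
    moreover have "E' + z / w = (z - z ^ 3 + 2 * x * y * (1 + z\<^sup>2) - 2 * (x\<^sup>2 + y\<^sup>2) * z) / (w * w)"
    proof -
      have "E' + z / w = ((2 * x * y - 2 * z * (x\<^sup>2 + y\<^sup>2)) * w + 2 * z * (2 * z * x * y - z\<^sup>2 * (x\<^sup>2 + y\<^sup>2)) + z * w) / (w * w)"
        using w by (simp add: E'_def add_divide_distrib)
      also have "(2 * x * y - 2 * z * (x\<^sup>2 + y\<^sup>2)) * w + 2 * z * (2 * z * x * y - z\<^sup>2 * (x\<^sup>2 + y\<^sup>2)) + z * w
         = z - z ^ 3 + 2 * x * y * (1 + z\<^sup>2) - 2 * (x\<^sup>2 + y\<^sup>2) * z"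
        unfolding w_def by (simp add: algebra_simps power2_eq_square power3_eq_cube)
      finally show ?thesis .
    qed
    ultimately show ?thesis
      by (simp add: f_def E_def w_def s_def power2_eq_square)
  qed
  have hol: "f holomorphic_on ball 0 1"
    using der by (auto simp: holomorphic_on_open intro!: exI)
  define F where "F = fps_expansion f 0"
  have F: "f has_fps_expansion F"
    unfolding F_def using hol by (intro has_fps_expansion_fps_expansion[of "ball 0 1"]) auto
  have lhs: "(\<lambda>z. (1 - z\<^sup>2)\<^sup>2 * deriv f z) has_fps_expansion (1 - fps_X\<^sup>2)\<^sup>2 * fps_deriv F"
    by (intro fps_expansion_intros F)
  have rhs: "(\<lambda>z. (z - z ^ 3 + 2 * x * y * (1 + z\<^sup>2) - 2 * (x\<^sup>2 + y\<^sup>2) * z) * f z) has_fps_expansion mehler_ode_poly x y * F"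
    unfolding mehler_ode_poly_def by (intro fps_expansion_intros F)
  have "eventually (\<lambda>z. z \<in> ball 0 1) (nhds (0::complex))"
    by (intro eventually_nhds_in_open) auto
  hence "eventually (\<lambda>z. (1 - z\<^sup>2)\<^sup>2 * deriv f z = (z - z ^ 3 + 2 * x * y * (1 + z\<^sup>2) - 2 * (x\<^sup>2 + y\<^sup>2) * z) * f z) (nhds 0)"
    by eventually_elim (use nz in \<open>auto simp: DERIV_imp_deriv[OF der] field_simps\<close>)
  from lhs[unfolded has_fps_expansion_cong[OF this refl]] rhs
  have ode: "(1 - fps_X\<^sup>2)\<^sup>2 * fps_deriv F = mehler_ode_poly x y * F"
    by (rule fps_expansion_unique_complex)
  have F0: "fps_nth F 0 = 1"
    using has_fps_expansion_imp_0_eq_fps_nth_0[OF F] by (simp add: f_def)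
  have FG: "F = Abs_fps (mehler_coeff x y)"
  proof (rule fps_linear_ode_unique[OF _ ode mehler_coeff_ode])
    show "fps_nth ((1 - fps_X\<^sup>2)\<^sup>2) 0 \<noteq> (0::complex)" by (simp add: fps_nth_power_0)
    show "fps_nth F 0 = fps_nth (Abs_fps (mehler_coeff x y)) 0" by (simp add: F0 mehler_coeff_small)
  qed
  have "(\<lambda>n. fps_nth F n * z ^ n) sums f z"
    using holomorphic_power_series[OF hol, of z] z by (simp add: F_def fps_expansion_def)
  then show ?thesis by (simp add: FG f_def)
qed

section \<open>Every fourth Hermite function\<close>

text \<open>Mehler's kernel for the factor \<open>r ^ m\<close>, written with \<open>a = (1 - r\<^sup>2) / (1 + r\<^sup>2)\<close> and
  \<open>s = 2 r / (1 + r\<^sup>2)\<close>. These satisfy \<open>a\<^sup>2 + s\<^sup>2 = 1\<close>.\<close>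

definition gauss_kernel :: "real \<Rightarrow> real \<Rightarrow> real \<Rightarrow> real \<Rightarrow> real" where
  "gauss_kernel a s x y = sqrt ((1 + a) / a) * exp (- pi * (x\<^sup>2 + y\<^sup>2 - 2 * s * x * y) / a)"

text \<open>The real part of Mehler's kernel for the factor \<open>(\<i> r) ^ m\<close>, in the same parameters.\<close>

definition cos_kernel :: "real \<Rightarrow> real \<Rightarrow> real \<Rightarrow> real \<Rightarrow> real" where
  "cos_kernel a s x y = sqrt (1 + a) * exp (- pi * a * (x\<^sup>2 + y\<^sup>2)) * cos (2 * pi * s * x * y)"

text \<open>Only the product of two Hermite functions is needed, and in it the square roots in the normalisation disappear.\<close>

lemma hermite_fun_mult:
  "complex_of_real (hermite_fun m x * hermite_fun m y) =
     of_real (sqrt 2 * exp (- pi * (x\<^sup>2 + y\<^sup>2))) *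
     mehler_coeff (of_real (sqrt (2 * pi) * x)) (of_real (sqrt (2 * pi) * y)) m"
proof -
  have p: "(2::real) powr (1/4) * 2 powr (1/4) = sqrt 2"
    by (simp flip: powr_add add: powr_half_sqrt)
  have s: "sqrt (2 ^ m * fact m) * sqrt (2 ^ m * fact m) = (2 ^ m * fact m :: real)"
    by simp
  have e: "exp (- pi * (x\<^sup>2 + y\<^sup>2)) = exp (- pi * x\<^sup>2) * exp (- pi * y\<^sup>2)"
    by (simp flip: exp_add add: algebra_simps)
  have "hermite_fun m x * hermite_fun m y =
     ((2 powr (1/4) * 2 powr (1/4)) / (sqrt (2 ^ m * fact m) * sqrt (2 ^ m * fact m)))
       * (herm m (sqrt (2 * pi) * x) * herm m (sqrt (2 * pi) * y)) * (exp (- pi * x\<^sup>2) * exp (- pi * y\<^sup>2))"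
    by (simp add: hermite_fun_def hermite_H_eq_herm)
  also have "\<dots> = (sqrt 2 * exp (- pi * (x\<^sup>2 + y\<^sup>2))) * (herm m (sqrt (2 * pi) * x) * herm m (sqrt (2 * pi) * y) / (2 ^ m * fact m))"
    unfolding p s e by simp
  also have "complex_of_real \<dots> = of_real (sqrt 2 * exp (- pi * (x\<^sup>2 + y\<^sup>2))) *
     mehler_coeff (of_real (sqrt (2 * pi) * x)) (of_real (sqrt (2 * pi) * y)) m"
    unfolding mehler_coeff_def of_real_mult[of "sqrt 2 * _"] of_real_divide of_real_mult[of "herm m _"] of_real_herm
    by simp
  finally show ?thesis .
qed

lemma sums_mehler:
  fixes x y :: real and z :: complex
  assumes "norm z < 1"
  shows "(\<lambda>m. complex_of_real (hermite_fun m x * hermite_fun m y) * z ^ m) sums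
    (of_real (sqrt 2) * exp (of_real (- pi * (x\<^sup>2 + y\<^sup>2)) +
       of_real (2 * pi) * (2 * z * of_real (x * y) - z\<^sup>2 * of_real (x\<^sup>2 + y\<^sup>2)) / (1 - z\<^sup>2)) / csqrt (1 - z\<^sup>2))"
proof -
  define X Y where "X = complex_of_real (sqrt (2 * pi) * x)" and "Y = complex_of_real (sqrt (2 * pi) * y)"
  have XY: "X * Y = of_real (2 * pi) * of_real (x * y)"
    unfolding X_def Y_def of_real_mult[symmetric] by (rule arg_cong[of _ _ of_real]) (simp add: algebra_simps)
  have XX: "X\<^sup>2 + Y\<^sup>2 = of_real (2 * pi) * of_real (x\<^sup>2 + y\<^sup>2)"
    unfolding X_def Y_def of_real_mult[symmetric] of_real_add[symmetric] of_real_power[symmetric]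
    by (rule arg_cong[of _ _ of_real]) (simp add: algebra_simps power_mult_distrib)
  have "2 * z * X * Y - z\<^sup>2 * (X\<^sup>2 + Y\<^sup>2) = 2 * z * (X * Y) - z\<^sup>2 * (X\<^sup>2 + Y\<^sup>2)"
    by simp
  also have "\<dots> = of_real (2 * pi) * (2 * z * of_real (x * y) - z\<^sup>2 * of_real (x\<^sup>2 + y\<^sup>2))"
    unfolding XY XX by (simp add: algebra_simps)
  finally have E: "2 * z * X * Y - z\<^sup>2 * (X\<^sup>2 + Y\<^sup>2) = of_real (2 * pi) * (2 * z * of_real (x * y) - z\<^sup>2 * of_real (x\<^sup>2 + y\<^sup>2))" .
  have "(\<lambda>m. of_real (sqrt 2 * exp (- pi * (x\<^sup>2 + y\<^sup>2))) * (mehler_coeff X Y m * z ^ m)) sums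
     (of_real (sqrt 2 * exp (- pi * (x\<^sup>2 + y\<^sup>2))) * (exp ((2 * z * X * Y - z\<^sup>2 * (X\<^sup>2 + Y\<^sup>2)) / (1 - z\<^sup>2)) / csqrt (1 - z\<^sup>2)))"
    by (intro sums_mult sums_mehler_complex assms)
  then show ?thesis
    unfolding hermite_fun_mult E X_def[symmetric] Y_def[symmetric] of_real_mult[of "sqrt 2"] exp_add exp_of_real[symmetric]
    by (simp add: mult_ac)
qed

locale mehler_parameters =
  fixes a s :: real
  assumes a: "0 < a" "a < 1" and s_pos: "0 < s" and circle: "a\<^sup>2 + s\<^sup>2 = 1"
begin

definition r :: real where "r = s / (1 + a)"

lemma r_sq: "r\<^sup>2 = (1 - a) / (1 + a)"
proof -
  have "s\<^sup>2 = (1 - a) * (1 + a)" using circle by (simp add: algebra_simps power2_eq_square)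
  then show ?thesis using a by (simp add: r_def power_divide) (simp add: power2_eq_square)
qed

lemma r_bounds: "0 < r" "r < 1"
proof -
  show "0 < r" using a s_pos by (simp add: r_def)
  have "r\<^sup>2 < 1" using a by (simp add: r_sq)
  then show "r < 1" by (simp add: abs_square_less_1)
qed

lemma sums_gauss_kernel: "(\<lambda>m. hermite_fun m x * hermite_fun m y * r ^ m) sums gauss_kernel a s x y"
proof -
  define S where "S = x\<^sup>2 + y\<^sup>2"
  have n: "norm (complex_of_real r) < 1" using r_bounds by simp
  have r2: "1 - r\<^sup>2 = 2 * a / (1 + a)" using a by (simp add: r_sq field_simps)
  have E: "- pi * S + 2 * pi * (2 * r * (x * y) - r\<^sup>2 * S) / (1 - r\<^sup>2) = - pi * (S - 2 * s * x * y) / a"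
  proof -
    have "2 * r * (x * y) - r\<^sup>2 * S = (2 * s * x * y - (1 - a) * S) / (1 + a)"
      by (simp add: r_sq) (simp add: r_def diff_divide_distrib)
    then show ?thesis unfolding r2 using a by (simp add: divide_simps) (simp add: algebra_simps)
  qed
  have q: "sqrt 2 / sqrt (1 - r\<^sup>2) = sqrt ((1 + a) / a)"
  proof -
    have "2 / (1 - r\<^sup>2) = (1 + a) / a" unfolding r2 using a by (simp add: field_simps)
    then show ?thesis by (simp add: real_sqrt_divide[symmetric])
  qed
  have c: "csqrt (complex_of_real (1 - r\<^sup>2)) = of_real (sqrt (1 - r\<^sup>2))"
  proof -
    have "0 \<le> 1 - r\<^sup>2" using r2 a by simp
    then show ?thesis using csqrt_of_real_nonneg[of "complex_of_real (1 - r\<^sup>2)"] by simp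
  qed
  have "(\<lambda>m. complex_of_real (hermite_fun m x * hermite_fun m y * r ^ m)) sums
     complex_of_real (sqrt 2 / sqrt (1 - r\<^sup>2) * exp (- pi * S + 2 * pi * (2 * r * (x * y) - r\<^sup>2 * S) / (1 - r\<^sup>2)))"
    using sums_mehler[OF n, of x y, folded S_def] unfolding of_real_1[symmetric, where 'a=complex]
    of_real_power[symmetric] of_real_diff[symmetric] c 
    by (simp add: mult_ac exp_of_real[symmetric])
  then have "(\<lambda>m. hermite_fun m x * hermite_fun m y * r ^ m) sums
      (sqrt ((1 + a) / a) * exp (- pi * (S - 2 * s * x * y) / a))"
    unfolding sums_of_real_iff q E .
  then show ?thesis unfolding gauss_kernel_def S_def .
qed

lemma sums_gauss_kernel_neg: "(\<lambda>m. hermite_fun m x * hermite_fun m y * (- r) ^ m) sums gauss_kernel a s x (- y)"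
proof -
  have h: "herm m (- z) = (- 1) ^ m * herm m z" for m and z :: real
    by (induction m z rule: herm.induct) (auto simp: algebra_simps)
  have eq: "hermite_fun m x * hermite_fun m (- y) * r ^ m = hermite_fun m x * hermite_fun m y * (- r) ^ m" for m
    by (simp add: hermite_fun_def hermite_H_eq_herm h power_minus[of r])
  show ?thesis using sums_gauss_kernel[of x "- y"] unfolding eq .
qed

lemma sums_cos_kernel: "(\<lambda>m. hermite_fun m x * hermite_fun m y * r ^ m * Re (\<i> ^ m)) sums cos_kernel a s x y"
proof -
  define S where "S = x\<^sup>2 + y\<^sup>2"
  define z where "z = \<i> * complex_of_real r"
  have n: "norm z < 1" using r_bounds by (simp add: z_def norm_mult)
  have z2: "z\<^sup>2 = of_real (- r\<^sup>2)" by (simp add: z_def power_mult_distrib)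
  have r2: "1 + r\<^sup>2 = 2 / (1 + a)" using a by (simp add: r_sq field_simps)
  have q: "sqrt 2 / sqrt (1 + r\<^sup>2) = sqrt (1 + a)"
    unfolding r2 using a by (simp add: real_sqrt_divide[symmetric])
  have c: "csqrt (complex_of_real (1 + r\<^sup>2)) = of_real (sqrt (1 + r\<^sup>2))"
    using csqrt_of_real_nonneg[of "complex_of_real (1 + r\<^sup>2)"] by simp
  have one: "1 - z\<^sup>2 = of_real (1 + r\<^sup>2)" by (simp add: z2)
  have e1: "- pi * S + 2 * pi * (r\<^sup>2 * S) / (1 + r\<^sup>2) = - pi * a * S"
    unfolding r2 unfolding r_sq using a by (simp add: field_simps)
  have e2: "2 * pi * (2 * r * (x * y)) / (1 + r\<^sup>2) = 2 * pi * s * x * y"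
    unfolding r2 unfolding r_def using a by (simp add: field_simps)
  have "of_real (- pi * S) + of_real (2 * pi) * (2 * z * of_real (x * y) - z\<^sup>2 * of_real S) / (1 - z\<^sup>2)
    = complex_of_real (- pi * S + 2 * pi * (r\<^sup>2 * S) / (1 + r\<^sup>2)) + \<i> * of_real (2 * pi * (2 * r * (x * y)) / (1 + r\<^sup>2))"
    unfolding one unfolding z2 z_def by (simp add: add_divide_distrib algebra_simps)
  then have E: "of_real (- pi * S) + of_real (2 * pi) * (2 * z * of_real (x * y) - z\<^sup>2 * of_real S) / (1 - z\<^sup>2)
    = complex_of_real (- pi * a * S) + \<i> * of_real (2 * pi * s * x * y)"
    unfolding e1 e2 .
  have "(\<lambda>m. Re (complex_of_real (hermite_fun m x * hermite_fun m y) * z ^ m)) sums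
     Re (of_real (sqrt 2) * exp (complex_of_real (- pi * a * S) + \<i> * of_real (2 * pi * s * x * y)) / of_real (sqrt (1 + r\<^sup>2)))"
    using sums_mehler[OF n, of x y, folded S_def] unfolding one E[unfolded one] c by (rule sums_Re)
  also have "Re (of_real (sqrt 2) * exp (complex_of_real (- pi * a * S) + \<i> * of_real (2 * pi * s * x * y)) / of_real (sqrt (1 + r\<^sup>2)))
     = (sqrt 2 / sqrt (1 + r\<^sup>2)) * exp (- pi * a * S) * cos (2 * pi * s * x * y)"
    by (simp add: Re_divide_of_real Re_exp)
  also have "(\<lambda>m. Re (complex_of_real (hermite_fun m x * hermite_fun m y) * z ^ m))
    = (\<lambda>m. hermite_fun m x * hermite_fun m y * r ^ m * Re (\<i> ^ m))"
  proof
    fix m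
    have Re_of_real_mult: "Re (complex_of_real c * w) = c * Re w" for c w by simp
    have "complex_of_real (hermite_fun m x * hermite_fun m y) * z ^ m = of_real (hermite_fun m x * hermite_fun m y * r ^ m) * \<i> ^ m"
      by (simp add: z_def power_mult_distrib)
    then show "Re (complex_of_real (hermite_fun m x * hermite_fun m y) * z ^ m) = hermite_fun m x * hermite_fun m y * r ^ m * Re (\<i> ^ m)"
      by (simp only: Re_of_real_mult)
  qed
  finally show ?thesis unfolding q cos_kernel_def S_def .
qed

text \<open>Averaging Mehler's formula over \<open>r, \<i> r, - r, - \<i> r\<close> keeps exactly the indices divisible by 4.\<close>

lemma sums_every_fourth:
  "(\<lambda>j. hermite_fun (4 * j) x * hermite_fun (4 * j) y * r ^ (4 * j)) sums
     ((gauss_kernel a s x y + gauss_kernel a s x (- y) + 2 * cos_kernel a s x y) / 4)"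
proof -
  let ?h = "\<lambda>m. hermite_fun m x * hermite_fun m y"
  have *: "(\<lambda>m. (?h m * r ^ m + ?h m * (- r) ^ m + 2 * (?h m * r ^ m * Re (\<i> ^ m))) / 4) sums
     ((gauss_kernel a s x y + gauss_kernel a s x (- y) + 2 * cos_kernel a s x y) / 4)"
    by (intro sums_divide sums_add sums_mult sums_gauss_kernel sums_gauss_kernel_neg sums_cos_kernel)
  have res: "(?h m * r ^ m + ?h m * (- r) ^ m + 2 * (?h m * r ^ m * Re (\<i> ^ m))) / 4 = (if 4 dvd m then ?h m * r ^ m else 0)" for m
  proof -
    define q k where "q = m div 4" and "k = m mod 4"
    have m: "m = 4 * q + k" by (simp add: q_def k_def)
    have "k < 4" by (simp add: k_def)
    then have "k = 0 \<or> k = 1 \<or> k = 2 \<or> k = 3" by auto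
    moreover have "\<i> ^ 4 = 1" by (simp add: eval_nat_numeral)
    then have "\<i> ^ m = \<i> ^ k" unfolding m by (simp add: power_add power_mult)
    moreover have "(- r) ^ m = r ^ m * (- 1) ^ k" 
    proof -
      have "(- 1 :: real) ^ m = (- 1) ^ k" unfolding m by (simp add: power_add power_mult)
      then show ?thesis by (simp add: power_minus[of r m])
    qed
    moreover have "4 dvd m \<longleftrightarrow> k = 0" by (simp add: k_def mod_eq_0_iff_dvd)
    ultimately show ?thesis
      by (elim disjE) (simp_all add: eval_nat_numeral)
  qed
  have "(\<lambda>j. if 4 dvd 4 * j then ?h (4 * j) * r ^ (4 * j) else 0) sums ((gauss_kernel a s x y + gauss_kernel a s x (- y) + 2 * cos_kernel a s x y) / 4)"
  proof (subst sums_mono_reindex[of "\<lambda>j::nat. 4 * j" "\<lambda>m. if 4 dvd m then ?h m * r ^ m else 0"])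
    show "strict_mono (\<lambda>j::nat. 4 * j)" by (simp add: strict_mono_def)
    show "(if 4 dvd m then ?h m * r ^ m else 0) = 0" if "m \<notin> range (\<lambda>j. 4 * j)" for m
      using that by (auto simp: dvd_def)
  qed (use * in \<open>simp only: res\<close>)
  then show ?thesis by simp
qed

text \<open>In the Hermite expansion the cosine form has the coefficients \<open>Re (\<i> ^ m) A m B m r ^ m\<close>, which are at most
  \<open>\<bar>A m B m\<bar> r ^ m\<close>, while the two Gaussian forms have the coefficients \<open>(A m)\<^sup>2 r ^ m\<close> and \<open>(B m)\<^sup>2 r ^ m\<close>. This is
  the boundedness of the Fourier transform, and it replaces a large sieve inequality: the oscillating kernel is traded
  for a positive one. The free parameter \<open>\<theta>\<close> stands for the optimisation in the Cauchy--Schwarz inequality.\<close>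

lemma cos_kernel_form_le:
  fixes \<theta> :: real
  assumes I: "finite I" and th: "\<theta> > 0"
  shows "\<bar>\<Sum>i\<in>I. \<Sum>j\<in>I. d i * b j * cos_kernel a s (x i) (x j)\<bar> \<le>
     (\<theta> * (\<Sum>i\<in>I. \<Sum>j\<in>I. d i * d j * gauss_kernel a s (x i) (x j))
      + (\<Sum>i\<in>I. \<Sum>j\<in>I. b i * b j * gauss_kernel a s (x i) (x j)) / \<theta>) / 2"
proof -
  define A B where "A m = (\<Sum>i\<in>I. d i * hermite_fun m (x i))" and "B m = (\<Sum>i\<in>I. b i * hermite_fun m (x i))" for m
  have form: "(\<Sum>i\<in>I. \<Sum>j\<in>I. p i * q j * (hermite_fun m (x i) * hermite_fun m (x j) * w))
     = (\<Sum>i\<in>I. p i * hermite_fun m (x i)) * (\<Sum>i\<in>I. q i * hermite_fun m (x i)) * w" for p q m w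
    by (simp only: sum_product, simp only: sum_distrib_right) (intro sum.cong refl, simp add: mult_ac)
  have G: "(\<lambda>m. (\<Sum>i\<in>I. p i * hermite_fun m (x i)) * (\<Sum>i\<in>I. p i * hermite_fun m (x i)) * r ^ m) sums
     (\<Sum>i\<in>I. \<Sum>j\<in>I. p i * p j * gauss_kernel a s (x i) (x j))" for p
    unfolding form[symmetric] by (intro sums_sum sums_mult sums_gauss_kernel)
  have C: "(\<lambda>m. A m * B m * (r ^ m * Re (\<i> ^ m))) sums (\<Sum>i\<in>I. \<Sum>j\<in>I. d i * b j * cos_kernel a s (x i) (x j))"
    unfolding form[symmetric] A_def B_def
    by (intro sums_sum sums_mult) (use sums_cos_kernel in \<open>simp add: mult.assoc\<close>)
  have R: "(\<lambda>m. (\<theta> * (A m * A m * r ^ m) + (B m * B m * r ^ m) / \<theta>) / 2) sums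
     ((\<theta> * (\<Sum>i\<in>I. \<Sum>j\<in>I. d i * d j * gauss_kernel a s (x i) (x j))
      + (\<Sum>i\<in>I. \<Sum>j\<in>I. b i * b j * gauss_kernel a s (x i) (x j)) / \<theta>) / 2)"
    unfolding A_def B_def by (intro sums_divide sums_add sums_mult G)
  have le: "\<bar>A m * B m * (r ^ m * Re (\<i> ^ m))\<bar> \<le> (\<theta> * (A m * A m * r ^ m) + (B m * B m * r ^ m) / \<theta>) / 2" for m
  proof -
    have "\<bar>Re (\<i> ^ m)\<bar> \<le> 1" using abs_Re_le_cmod[of "\<i> ^ m"] by (simp add: norm_power)
    then have "\<bar>A m * B m * (r ^ m * Re (\<i> ^ m))\<bar> \<le> \<bar>A m * B m\<bar> * r ^ m"
      using r_bounds by (simp add: abs_mult mult_left_le mult.assoc[symmetric])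
    moreover have "2 * \<bar>A m * B m\<bar> \<le> \<theta> * (A m * A m) + (B m * B m) / \<theta>"
    proof -
      have "0 \<le> (sqrt \<theta> * \<bar>A m\<bar> - \<bar>B m\<bar> / sqrt \<theta>)\<^sup>2" by simp
      also have "\<dots> = \<theta> * (A m * A m) + (B m * B m) / \<theta> - 2 * \<bar>A m * B m\<bar>"
        using th by (simp add: power2_diff power_mult_distrib power_divide abs_mult) (simp add: power2_eq_square)
      finally show ?thesis by simp
    qed
    then have "2 * \<bar>A m * B m\<bar> * r ^ m \<le> (\<theta> * (A m * A m) + (B m * B m) / \<theta>) * r ^ m"
      using r_bounds by (intro mult_right_mono) auto
    ultimately show ?thesis by (simp add: algebra_simps)
  qed
  have "(\<Sum>i\<in>I. \<Sum>j\<in>I. d i * b j * cos_kernel a s (x i) (x j)) \<le>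
     ((\<theta> * (\<Sum>i\<in>I. \<Sum>j\<in>I. d i * d j * gauss_kernel a s (x i) (x j))
      + (\<Sum>i\<in>I. \<Sum>j\<in>I. b i * b j * gauss_kernel a s (x i) (x j)) / \<theta>) / 2)"
    by (rule sums_le[OF _ C R]) (use le abs_le_D1 in blast)
  moreover have "- (\<Sum>i\<in>I. \<Sum>j\<in>I. d i * b j * cos_kernel a s (x i) (x j)) \<le>
     ((\<theta> * (\<Sum>i\<in>I. \<Sum>j\<in>I. d i * d j * gauss_kernel a s (x i) (x j))
      + (\<Sum>i\<in>I. \<Sum>j\<in>I. b i * b j * gauss_kernel a s (x i) (x j)) / \<theta>) / 2)"
    by (rule sums_le[OF _ sums_minus[OF C] R]) (use le abs_le_D2 in blast)
  ultimately show ?thesis by simp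
qed

end

section \<open>Heat kernels at time t\<close>

text \<open>\<open>heat_a t = tanh (t / 4)\<close> and \<open>heat_s t = 1 / cosh (t / 4)\<close>; they belong to the factor \<open>r = exp (- t / 4)\<close>.\<close>

definition heat_a :: "real \<Rightarrow> real" where
  "heat_a t = (1 - exp (- t / 2)) / (1 + exp (- t / 2))"

definition heat_s :: "real \<Rightarrow> real" where
  "heat_s t = 2 * exp (- t / 4) / (1 + exp (- t / 2))"

abbreviation heat_gauss :: "real \<Rightarrow> real \<Rightarrow> real \<Rightarrow> real" where
  "heat_gauss t \<equiv> gauss_kernel (heat_a t) (heat_s t)"

abbreviation heat_cos :: "real \<Rightarrow> real \<Rightarrow> real \<Rightarrow> real" where
  "heat_cos t \<equiv> cos_kernel (heat_a t) (heat_s t)"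

lemma heat_parameters:
  assumes "0 < t"
  shows "mehler_parameters (heat_a t) (heat_s t)"
proof
  define q where "q = exp (- t / 4)"
  have q2: "exp (- t / 2) = q\<^sup>2" by (simp add: q_def power2_eq_square flip: exp_add)
  have q: "0 < q" "q < 1" using assms by (auto simp: q_def)
  then have "q\<^sup>2 < 1" "0 < q\<^sup>2" by (auto simp: power_less_one_iff abs_square_less_1)
  then show "0 < heat_a t" "heat_a t < 1" unfolding heat_a_def q2 by (simp_all add: divide_less_eq add_pos_pos)
  show "0 < heat_s t" unfolding heat_s_def q2 q_def[symmetric] using q by (simp add: add_pos_pos)
  have "(1 - q\<^sup>2)\<^sup>2 + (2 * q)\<^sup>2 = (1 + q\<^sup>2)\<^sup>2" by (simp add: power2_eq_square algebra_simps)
  moreover have "1 + q\<^sup>2 \<noteq> 0" using \<open>0 < q\<^sup>2\<close> by linarith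
  ultimately show "(heat_a t)\<^sup>2 + (heat_s t)\<^sup>2 = 1" unfolding heat_a_def heat_s_def q2 q_def[symmetric]
    by (simp add: power_divide add_divide_distrib[symmetric])
qed

lemma heat_r:
  assumes "0 < t"
  shows "mehler_parameters.r (heat_a t) (heat_s t) = exp (- t / 4)"
proof -
  interpret mehler_parameters "heat_a t" "heat_s t" by (rule heat_parameters[OF assms])
  define q where "q = exp (- t / 2)"
  have "1 + q \<noteq> 0" using exp_gt_zero[of "- t / 2"] unfolding q_def by linarith
  then have "1 + heat_a t = 2 / (1 + q)" unfolding heat_a_def q_def[symmetric] by (simp add: field_simps)
  then show ?thesis using \<open>1 + q \<noteq> 0\<close> unfolding r_def unfolding heat_s_def q_def[symmetric] by simp
qed

lemma heat_bounds:
  assumes "0 < t" "t \<le> 1"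
  shows "t / 8 \<le> heat_a t" "heat_a t \<le> t / 2" "1 / 2 \<le> heat_s t"
proof -
  interpret mehler_parameters "heat_a t" "heat_s t" by (rule heat_parameters[OF assms(1)])
  define q where "q = exp (- t / 2)"
  have q0: "0 < q" "q \<le> 1" using assms by (auto simp: q_def)
  have 1: "1 - t / 2 \<le> q" using exp_ge_add_one_self[of "- t / 2"] by (simp add: q_def)
  have "q * exp (t / 2) = 1" by (simp add: q_def flip: exp_add)
  moreover have "q * (1 + t / 2) \<le> q * exp (t / 2)"
    using q0 exp_ge_add_one_self[of "t / 2"] by (intro mult_left_mono) auto
  ultimately have 2: "q * (1 + t / 2) \<le> 1" by simp
  have "(1 - t / 4) * (1 + t / 2) \<ge> 1" using assms by (simp add: algebra_simps mult_left_le)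
  then have "q * (1 + t / 2) \<le> (1 - t / 4) * (1 + t / 2)" using 2 by linarith
  then have 3: "q \<le> 1 - t / 4" using assms by (simp add: mult_le_cancel_right)
  show "t / 8 \<le> heat_a t" unfolding heat_a_def q_def[symmetric]
  proof -
    have "t / 8 * (1 + q) \<le> t / 8 * 2" using q0 assms by (intro mult_left_mono) auto
    then show "t / 8 \<le> (1 - q) / (1 + q)" using q0 3 by (simp add: le_divide_eq)
  qed
  show up: "heat_a t \<le> t / 2" unfolding heat_a_def q_def[symmetric]
  proof -
    have "t / 2 \<le> t / 2 * (1 + q)" using q0 assms by (simp add: algebra_simps)
    then show "(1 - q) / (1 + q) \<le> t / 2" using q0 1 by (simp add: divide_le_eq)
  qed
  have "(heat_a t)\<^sup>2 \<le> (1/2)\<^sup>2" using up assms a by (intro power_mono) auto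
  then have "(1/2)\<^sup>2 \<le> (heat_s t)\<^sup>2" using circle by (simp add: power2_eq_square)
  then show "1 / 2 \<le> heat_s t" by (rule power2_le_imp_le) (use s_pos in simp)
qed

text \<open>The exponent splits as \<open>x\<^sup>2 + y\<^sup>2 - 2 s x y = s (x - y)\<^sup>2 + (1 - s) (x\<^sup>2 + y\<^sup>2)\<close>, where \<open>s / a\<close> is of order \<open>1 / t\<close> and
  \<open>(1 - s) / a = a / (1 + s)\<close> is of order \<open>t\<close>.\<close>

lemma gauss_kernel_le:
  assumes t: "0 < t" "t \<le> 1" and xy: "0 \<le> x" "0 \<le> y"
  shows "heat_gauss t x y \<le> 4 / sqrt t * exp (- (x - y)\<^sup>2 / t - t * (x + y)\<^sup>2 / 16)"
    and "heat_gauss t x (- y) \<le> heat_gauss t x y"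
proof -
  interpret mehler_parameters "heat_a t" "heat_s t" by (rule heat_parameters[OF t(1)])
  define a' s' where "a' = heat_a t" and "s' = heat_s t"
  note b = heat_bounds[OF t, folded a'_def s'_def]
  note as = a[folded a'_def] s_pos[folded s'_def] circle[folded a'_def s'_def]
  have "s'\<^sup>2 \<le> 1\<^sup>2" using as(4) zero_le_power2[of a'] unfolding one_power2 by linarith
  then have s1: "s' \<le> 1" by (rule power2_le_imp_le) simp
  have "(1 + a') / a' \<le> 2 / a'" using as by (intro divide_right_mono) auto
  also have "\<dots> \<le> 2 / (t / 8)" using b t by (intro divide_left_mono) auto
  finally have "sqrt ((1 + a') / a') \<le> sqrt (16 / t)" by simp
  then have pre: "sqrt ((1 + a') / a') \<le> 4 / sqrt t" by (simp add: real_sqrt_divide)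
  have "(1 - s') * (1 + s') = a' * a'" using as by (simp add: algebra_simps power2_eq_square)
  then have eq: "(1 - s') / a' = a' / (1 + s')" using as by (simp add: field_simps)
  have "a' / 2 \<le> a' / (1 + s')" using as s1 by (intro divide_left_mono) auto
  then have c2: "t / 16 \<le> (1 - s') / a'" unfolding eq using b by linarith
  have "1 / t = (1/2) / (t / 2)" by simp
  also have "\<dots> \<le> s' / (t / 2)" using b t by (intro divide_right_mono) auto
  also have "\<dots> \<le> s' / a'" using b t as by (intro divide_left_mono) auto
  finally have c1: "1 / t \<le> s' / a'" .
  have "(x\<^sup>2 + y\<^sup>2 - 2 * s' * x * y) / a' = s' / a' * (x - y)\<^sup>2 + (1 - s') / a' * (x\<^sup>2 + y\<^sup>2)"
    using as by (simp add: field_simps power2_eq_square)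
  moreover have "1 / t * (x - y)\<^sup>2 \<le> s' / a' * (x - y)\<^sup>2" using c1 by (intro mult_right_mono) auto
  moreover have "t / 16 * (x\<^sup>2 + y\<^sup>2) \<le> (1 - s') / a' * (x\<^sup>2 + y\<^sup>2)" using c2 by (intro mult_right_mono) auto
  moreover have "t / 16 * ((x + y)\<^sup>2 / 2) \<le> t / 16 * (x\<^sup>2 + y\<^sup>2)"
  proof (intro mult_left_mono)
    show "(x + y)\<^sup>2 / 2 \<le> x\<^sup>2 + y\<^sup>2" using sum_squares_bound[of x y] by (simp add: power2_sum)
  qed (use t in auto)
  ultimately have Q: "(x - y)\<^sup>2 / t + t * (x + y)\<^sup>2 / 32 \<le> (x\<^sup>2 + y\<^sup>2 - 2 * s' * x * y) / a'" by simp
  have "2 * ((x - y)\<^sup>2 / t + t * (x + y)\<^sup>2 / 32) \<le> pi * ((x\<^sup>2 + y\<^sup>2 - 2 * s' * x * y) / a')"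
    using Q pi_ge_two t by (intro mult_mono) auto
  moreover have "0 \<le> (x - y)\<^sup>2 / t" using t by simp
  ultimately have "- pi * (x\<^sup>2 + y\<^sup>2 - 2 * s' * x * y) / a' \<le> - (x - y)\<^sup>2 / t - t * (x + y)\<^sup>2 / 16"
    by simp
  then show "heat_gauss t x y \<le> 4 / sqrt t * exp (- (x - y)\<^sup>2 / t - t * (x + y)\<^sup>2 / 16)"
    unfolding gauss_kernel_def a'_def[symmetric] s'_def[symmetric] using pre t by (intro mult_mono) auto
  have "0 \<le> s' * x * y" using as xy by simp
  then have "- pi * (x\<^sup>2 + (- y)\<^sup>2 - 2 * s' * x * (- y)) / a' \<le> - pi * (x\<^sup>2 + y\<^sup>2 - 2 * s' * x * y) / a'"
    using as by (intro divide_right_mono) (auto intro!: mult_left_mono)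
  then show "heat_gauss t x (- y) \<le> heat_gauss t x y"
    unfolding gauss_kernel_def a'_def[symmetric] s'_def[symmetric] using as by (intro mult_mono) auto
qed

lemma gauss_kernel_nonneg: "0 < a \<Longrightarrow> 0 \<le> gauss_kernel a s x y"
  by (simp add: gauss_kernel_def)

lemma gauss_kernel_diag_ge:
  assumes t: "0 < t" "t \<le> 1"
  shows "exp (- pi * t * x\<^sup>2) / sqrt t \<le> heat_gauss t x x"
proof -
  interpret mehler_parameters "heat_a t" "heat_s t" by (rule heat_parameters[OF t(1)])
  define a' s' where "a' = heat_a t" and "s' = heat_s t"
  note b = heat_bounds[OF t, folded a'_def s'_def]
  note as = a[folded a'_def] s_pos[folded s'_def] circle[folded a'_def s'_def]
  have "1 / t \<le> 1 / (t / 2)" using t by (intro divide_left_mono) auto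
  also have "\<dots> \<le> 1 / a'" using b t as by (intro divide_left_mono) auto
  also have "\<dots> \<le> (1 + a') / a'" using as by (intro divide_right_mono) auto
  finally have "sqrt (1 / t) \<le> sqrt ((1 + a') / a')" by simp
  then have pre: "1 / sqrt t \<le> sqrt ((1 + a') / a')" by (simp add: real_sqrt_divide)
  have "(1 - s') * (1 + s') = a' * a'" using as by (simp add: algebra_simps power2_eq_square)
  then have "(1 - s') / a' = a' / (1 + s')" using as by (simp add: field_simps)
  also have "\<dots> \<le> a' / 1" using as by (intro divide_left_mono) auto
  finally have c2: "(1 - s') / a' \<le> t / 2" using b by linarith
  have "(x\<^sup>2 + x\<^sup>2 - 2 * s' * x * x) / a' = 2 * ((1 - s') / a' * x\<^sup>2)"
    using as by (simp add: field_simps power2_eq_square)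
  also have "\<dots> \<le> 2 * (t / 2 * x\<^sup>2)" using c2 by (intro mult_left_mono mult_right_mono) auto
  finally have h: "(x\<^sup>2 + x\<^sup>2 - 2 * s' * x * x) / a' \<le> t * x\<^sup>2" by simp
  from mult_left_mono[OF h, of pi] have "- pi * t * x\<^sup>2 \<le> - pi * (x\<^sup>2 + x\<^sup>2 - 2 * s' * x * x) / a'" by (simp add: mult.assoc)
  then have "(1 / sqrt t) * exp (- pi * t * x\<^sup>2) \<le> heat_gauss t x x"
    unfolding gauss_kernel_def a'_def[symmetric] s'_def[symmetric] using pre t as by (intro mult_mono) auto
  then show ?thesis by simp
qed

lemma abs_cos_kernel_le:
  assumes t: "0 < t" "t \<le> 1"
  shows "\<bar>heat_cos t x y\<bar> \<le> 2 * exp (- t * (x\<^sup>2 + y\<^sup>2) / 4)"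
proof -
  interpret mehler_parameters "heat_a t" "heat_s t" by (rule heat_parameters[OF t(1)])
  define a' s' where "a' = heat_a t" and "s' = heat_s t"
  note b = heat_bounds[OF t, folded a'_def s'_def]
  note as = a[folded a'_def] s_pos[folded s'_def] circle[folded a'_def s'_def]
  have pre: "sqrt (1 + a') \<le> 2" using as by (intro real_le_lsqrt) auto
  have "2 * (t / 8) * (x\<^sup>2 + y\<^sup>2) \<le> pi * a' * (x\<^sup>2 + y\<^sup>2)"
    using b t pi_ge_two by (intro mult_right_mono mult_mono) auto
  then have "exp (- pi * a' * (x\<^sup>2 + y\<^sup>2)) \<le> exp (- t * (x\<^sup>2 + y\<^sup>2) / 4)" by simp
  then have "sqrt (1 + a') * exp (- pi * a' * (x\<^sup>2 + y\<^sup>2)) * \<bar>cos (2 * pi * s' * x * y)\<bar> \<le> 2 * exp (- t * (x\<^sup>2 + y\<^sup>2) / 4) * 1"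
    using pre as by (intro mult_mono) auto
  then show ?thesis unfolding cos_kernel_def a'_def[symmetric] s'_def[symmetric] using as
    by (simp add: abs_mult)
qed

definition heat_sum :: "real \<Rightarrow> real \<Rightarrow> real \<Rightarrow> real" where
  "heat_sum t x y = (heat_gauss t x y + heat_gauss t x (- y)
      + 2 * heat_cos t x y) / 4"

lemma sums_heat_sum:
  assumes "0 < t"
  shows "(\<lambda>j. exp (- real j * t) * (hermite_fun (4 * j) x * hermite_fun (4 * j) y)) sums heat_sum t x y"
proof -
  interpret mehler_parameters "heat_a t" "heat_s t" by (rule heat_parameters[OF assms])
  have "exp (- t / 4) ^ (4 * j) = exp (- real j * t)" for j
    by (simp flip: exp_of_nat_mult)
  then show ?thesis
    using sums_every_fourth[of x y] by (simp add: heat_r[OF assms] heat_sum_def mult.commute)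
qed

lemma heat_sum_diag_le:
  assumes t: "0 < t" "t \<le> 1" and x: "0 \<le> x"
  shows "heat_sum t x x \<le> 3 / sqrt t"
proof -
  have s: "1 \<le> 1 / sqrt t" using t by (simp add: real_sqrt_le_iff)
  have "exp (- (x - x)\<^sup>2 / t - t * (x + x)\<^sup>2 / 16) \<le> 1" using t by simp
  then have "4 / sqrt t * exp (- (x - x)\<^sup>2 / t - t * (x + x)\<^sup>2 / 16) \<le> 4 / sqrt t * 1" using t by (intro mult_left_mono) auto
  then have 1: "heat_gauss t x x \<le> 4 / sqrt t"
    using gauss_kernel_le(1)[OF t x x] by linarith
  have "exp (- t * (x\<^sup>2 + x\<^sup>2) / 4) \<le> 1" using t by simp
  then have "heat_cos t x x \<le> 2 * 1" using abs_cos_kernel_le[OF t, of x x] by linarith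
  then show ?thesis unfolding heat_sum_def using 1 gauss_kernel_le(2)[OF t x x] s by simp
qed

section \<open>The kernel as an average of heat kernels\<close>

text \<open>Integrals over \<open>{0<..d}\<close> of integrands that are singular at 0, from an antiderivative that vanishes there.\<close>

lemma integral_from_zero:
  fixes F f :: "real \<Rightarrow> real"
  assumes der: "\<And>t. 0 < t \<Longrightarrow> t < 1 \<Longrightarrow> (F has_real_derivative f t) (at t)"
    and cont: "\<And>t. 0 < t \<Longrightarrow> t < 1 \<Longrightarrow> isCont f t"
    and nonneg: "\<And>t. 0 < t \<Longrightarrow> t < 1 \<Longrightarrow> 0 \<le> f t"
    and lim: "(F \<longlongrightarrow> 0) (at_right 0)" and d: "0 < d" "d < 1"
  shows "set_integrable lborel {0<..d} f" "(LBINT t:{0<..d}. f t) = F d"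
proof -
  have FTC: "set_integrable lborel (einterval (ereal 0) (ereal b)) f" "(LBINT t=ereal 0..ereal b. f t) = F b - 0"
    if "0 < b" "b < 1" for b
  proof -
    have "(F \<longlongrightarrow> F b) (at_left b)"
      using DERIV_isCont[OF der[OF that]] by (simp add: isCont_def filterlim_at_split)
    then show "set_integrable lborel (einterval (ereal 0) (ereal b)) f" "(LBINT t=ereal 0..ereal b. f t) = F b - 0"
      using that lim
      by (intro interval_integral_FTC_nonneg[where F = F] der cont AE_I2; (auto simp: ereal_tendsto_simps1 nonneg)?)+
  qed
  have "set_integrable lborel {0<..<(d + 1) / 2} f"
    using FTC(1)[of "(d + 1) / 2"] d by (simp add: einterval_eq)
  then show "set_integrable lborel {0<..d} f"
    by (rule set_integrable_subset) (use d in auto)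
  show "(LBINT t:{0<..d}. f t) = F d"
    using FTC(2)[OF d] d by (simp add: interval_integral_Ioc)
qed

definition weight :: "real \<Rightarrow> real \<Rightarrow> real" where
  "weight \<eta> t = 1 / (sqrt t * ln (1 / t) powr (1 + \<eta>))"

abbreviation J :: "real set" where "J \<equiv> {0<..exp (- 2)}"

lemma J_bounds:
  assumes "t \<in> J"
  shows "0 < t" "t \<le> 1/4" "t < 1" "2 \<le> ln (1 / t)"
proof -
  have "2 \<le> exp (1::real)" using exp_ge_add_one_self[of 1] by simp
  then have "2 * 2 \<le> exp (1::real) * exp 1" by (intro mult_mono) auto
  then have "4 \<le> exp (2::real)" by (simp flip: exp_add)
  then have "exp (-2::real) \<le> 1 / 4" by (simp add: exp_minus field_simps)
  then show "0 < t" "t \<le> 1/4" "t < 1" using assms by auto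
  have "ln t \<le> ln (exp (-2))" using assms by (subst ln_le_cancel_iff) auto
  then show "2 \<le> ln (1 / t)" using assms by (simp add: ln_div)
qed

lemma weight_nonneg: "t \<in> J \<Longrightarrow> 0 \<le> weight \<eta> t"
  by (simp add: weight_def)

text \<open>The source of the factor \<open>1 / \<eta>\<close> on the diagonal: the antiderivative is \<open>(- ln t) powr (- \<eta>) / \<eta>\<close>.\<close>

lemma log_weight_integral:
  assumes "0 < \<eta>" "0 < d" "d < 1"
  shows "set_integrable lborel {0<..d} (\<lambda>t. weight \<eta> t / sqrt t)"
    "(LBINT t:{0<..d}. weight \<eta> t / sqrt t) = 1 / (\<eta> * ln (1 / d) powr \<eta>)"
proof -
  define F where "F t = (- ln t) powr (- \<eta>) / \<eta>" for t :: real
  have eq: "weight \<eta> t / sqrt t = (- ln t) powr (- \<eta> - 1) / t" if "0 < t" for t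
  proof -
    have "- \<eta> - 1 = - (1 + \<eta>)" by simp
    then have "(- ln t) powr (- \<eta> - 1) = 1 / (- ln t) powr (1 + \<eta>)"
      by (simp only: powr_minus_divide)
    then show ?thesis using that by (simp add: weight_def ln_div)
  qed
  have "(F has_real_derivative (- ln t) powr (- \<eta> - 1) / t) (at t)" if "0 < t" "t < 1" for t
    unfolding F_def using that assms by (auto intro!: derivative_eq_intros simp: field_simps)
  moreover have "isCont (\<lambda>t. (- ln t) powr (- \<eta> - 1) / t) t" if "0 < t" "t < 1" for t
    using that by (auto intro!: continuous_intros)
  moreover have "(F \<longlongrightarrow> 0) (at_right 0)"
    unfolding F_def using assms by real_asymp
  ultimately have "set_integrable lborel {0<..d} (\<lambda>t. (- ln t) powr (- \<eta> - 1) / t)"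
     "(LBINT t:{0<..d}. (- ln t) powr (- \<eta> - 1) / t) = F d"
    using assms by (auto intro!: integral_from_zero)
  moreover have "set_integrable lborel {0<..d} (\<lambda>t. weight \<eta> t / sqrt t) \<longleftrightarrow> set_integrable lborel {0<..d} (\<lambda>t. (- ln t) powr (- \<eta> - 1) / t)"
    by (rule set_integrable_cong) (auto simp: eq)
  moreover have "(LBINT t:{0<..d}. weight \<eta> t / sqrt t) = (LBINT t:{0<..d}. (- ln t) powr (- \<eta> - 1) / t)"
    by (rule set_lebesgue_integral_cong) (auto simp: eq)
  moreover have "F d = 1 / (\<eta> * ln (1 / d) powr \<eta>)"
    using assms by (simp add: F_def ln_div powr_minus_divide)
  ultimately show "set_integrable lborel {0<..d} (\<lambda>t. weight \<eta> t / sqrt t)"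
    "(LBINT t:{0<..d}. weight \<eta> t / sqrt t) = 1 / (\<eta> * ln (1 / d) powr \<eta>)" by simp_all
qed

text \<open>A substitute for Euler's integral \<open>\<integral> t powr (q - 1) exp (- b t) dt\<close>, with the exponential weakened to a power so that
  \<open>(t / (1 + b t)) powr q / q\<close> is an antiderivative.\<close>

lemma power_weight_integral:
  fixes q b d :: real
  assumes q: "0 < q" and b: "0 < b" and d: "0 < d" "d < 1"
  shows "set_integrable lborel {0<..d} (\<lambda>t. t powr (q - 1) * (1 + b * t) powr (- q - 1))"
    "(LBINT t:{0<..d}. t powr (q - 1) * (1 + b * t) powr (- q - 1)) \<le> b powr (- q) / q"
proof -
  define F where "F t = (t / (1 + b * t)) powr q / q" for t :: real
  have der: "(F has_real_derivative t powr (q - 1) * (1 + b * t) powr (- q - 1)) (at t)" if "0 < t" for t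
  proof -
    have p: "0 < 1 + b * t" using b that by (simp add: add_pos_pos)
    have 1: "(F has_real_derivative (t / (1 + b * t)) powr (q - 1) * (1 / (1 + b * t)\<^sup>2)) (at t)"
      unfolding F_def using p that q by (auto intro!: derivative_eq_intros simp: power2_eq_square)
    have 2: "(t / (1 + b * t)) powr (q - 1) * (1 / (1 + b * t)\<^sup>2) = t powr (q - 1) * ((1 + b * t) powr (- (q - 1)) * (1 + b * t) powr (- 2))"
      using p that by (simp only: powr_minus_divide) (simp add: powr_divide powr_numeral)
    have 3: "- (q - 1) + - 2 = - q - 1" by simp
    show ?thesis using 1 unfolding 2 powr_add[symmetric] 3 .
  qed
  have cont: "isCont (\<lambda>t. t powr (q - 1) * (1 + b * t) powr (- q - 1)) t" if "0 < t" for t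
  proof -
    have "0 < 1 + b * t" using b that by (simp add: add_pos_pos)
    then show ?thesis using that by (auto intro!: continuous_intros)
  qed
  have lim: "(F \<longlongrightarrow> 0) (at_right 0)"
    unfolding F_def using q b by real_asymp
  note * = integral_from_zero[of F, OF der cont _ lim d]
  show "set_integrable lborel {0<..d} (\<lambda>t. t powr (q - 1) * (1 + b * t) powr (- q - 1))"
    by (rule *(1)) auto
  have "(LBINT t:{0<..d}. t powr (q - 1) * (1 + b * t) powr (- q - 1)) = F d"
    by (rule *(2)) auto
  also have "d / (1 + b * d) \<le> 1 / b" using b d by (simp add: field_simps add_pos_pos)
  then have "F d \<le> (1 / b) powr q / q"
    unfolding F_def using q b d by (intro divide_right_mono powr_mono2) (auto simp: add_pos_pos)
  also have "(1 / b) powr q = b powr (- q)" using b by (simp add: powr_divide powr_minus_divide)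
  finally show "(LBINT t:{0<..d}. t powr (q - 1) * (1 + b * t) powr (- q - 1)) \<le> b powr (- q) / q" .
qed

lemma set_integrable_J_bound:
  fixes f g :: "real \<Rightarrow> real"
  assumes "set_integrable lborel J g" "f \<in> borel_measurable borel" "\<And>t. t \<in> J \<Longrightarrow> \<bar>f t\<bar> \<le> g t"
  shows "set_integrable lborel J f"
proof (rule set_integrable_bound[OF assms(1)])
  show "set_borel_measurable lborel J f" unfolding set_borel_measurable_def
    using assms(2) by (intro borel_measurable_scaleR borel_measurable_indicator) auto
qed (use assms(3) in force)

lemma weight_measurable [measurable]: "weight \<eta> \<in> borel_measurable borel"
  unfolding weight_def by measurable

lemma heat_measurable [measurable]: "heat_a \<in> borel_measurable borel" "heat_s \<in> borel_measurable borel"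
  unfolding heat_a_def heat_s_def by measurable

lemma gauss_kernel_measurable [measurable]: "(\<lambda>t. heat_gauss t x y) \<in> borel_measurable borel"
  unfolding gauss_kernel_def by measurable

lemma cos_kernel_measurable [measurable]: "(\<lambda>t. heat_cos t x y) \<in> borel_measurable borel"
  unfolding cos_kernel_def by measurable

lemma integrable_weight_over_sqrt:
  assumes "0 < \<eta>"
  shows "set_integrable lborel J (\<lambda>t. c * (weight \<eta> t / sqrt t))"
  by (rule set_integrable_mult_right, rule log_weight_integral(1)[OF assms]) auto

lemma integrable_weight_heat:
  assumes "0 < \<eta>" "0 \<le> x" "0 \<le> y"
  shows "set_integrable lborel J (\<lambda>t. weight \<eta> t * exp (- t) * heat_gauss t x y)"
    "set_integrable lborel J (\<lambda>t. weight \<eta> t * exp (- t) * heat_gauss t x (- y))"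
    "set_integrable lborel J (\<lambda>t. weight \<eta> t * exp (- t) * heat_cos t x y)"
proof -
  have *: "set_integrable lborel J (\<lambda>t. weight \<eta> t * exp (- t) * f t)"
    if "f \<in> borel_measurable borel" "\<And>t. t \<in> J \<Longrightarrow> \<bar>f t\<bar> \<le> 4 / sqrt t" for f
  proof (rule set_integrable_J_bound[OF integrable_weight_over_sqrt[OF assms(1), of 4]])
    show "(\<lambda>t. weight \<eta> t * exp (- t) * f t) \<in> borel_measurable borel" using that(1) by measurable
    fix t assume t: "t \<in> J"
    have "\<bar>weight \<eta> t * exp (- t) * f t\<bar> = weight \<eta> t * exp (- t) * \<bar>f t\<bar>"
      using weight_nonneg[OF t] by (simp add: abs_mult)
    also have "\<dots> \<le> weight \<eta> t * 1 * (4 / sqrt t)"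
      using weight_nonneg[OF t] J_bounds[OF t] by (intro mult_mono that t) auto
    finally show "\<bar>weight \<eta> t * exp (- t) * f t\<bar> \<le> 4 * (weight \<eta> t / sqrt t)" by (simp add: mult.commute)
  qed
  have g: "\<bar>heat_gauss t x y\<bar> \<le> 4 / sqrt t"
     "\<bar>heat_gauss t x (- y)\<bar> \<le> 4 / sqrt t"
     "\<bar>heat_cos t x y\<bar> \<le> 4 / sqrt t" if "t \<in> J" for t
  proof -
    note t = J_bounds(1)[OF that] less_imp_le[OF J_bounds(3)[OF that]]
    interpret mehler_parameters "heat_a t" "heat_s t" by (rule heat_parameters[OF t(1)])
    have "0 \<le> (x - y)\<^sup>2 / t" "0 \<le> t * (x + y)\<^sup>2 / 16" using t by auto
    then have "exp (- (x - y)\<^sup>2 / t - t * (x + y)\<^sup>2 / 16) \<le> 1"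
      unfolding exp_le_one_iff minus_divide_left[symmetric] by linarith
    then have "4 / sqrt t * exp (- (x - y)\<^sup>2 / t - t * (x + y)\<^sup>2 / 16) \<le> 4 / sqrt t * 1" using t by (intro mult_left_mono) auto
    then show "\<bar>heat_gauss t x y\<bar> \<le> 4 / sqrt t" "\<bar>heat_gauss t x (- y)\<bar> \<le> 4 / sqrt t"
      using gauss_kernel_le[OF t assms(2,3)] gauss_kernel_nonneg[OF a(1)] by (simp_all add: abs_of_nonneg)
    have "exp (- t * (x\<^sup>2 + y\<^sup>2) / 4) \<le> 1" using t by simp
    moreover have "1 \<le> 1 / sqrt t" using t by simp
    moreover have "4 / sqrt t = 4 * (1 / sqrt t)" by simp
    ultimately show "\<bar>heat_cos t x y\<bar> \<le> 4 / sqrt t"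
      using abs_cos_kernel_le[OF t, of x y] by linarith
  qed
  show "set_integrable lborel J (\<lambda>t. weight \<eta> t * exp (- t) * heat_gauss t x y)"
    "set_integrable lborel J (\<lambda>t. weight \<eta> t * exp (- t) * heat_gauss t x (- y))"
    "set_integrable lborel J (\<lambda>t. weight \<eta> t * exp (- t) * heat_cos t x y)"
    by (intro * g; measurable)+
qed

definition kernel_P :: "real \<Rightarrow> real \<Rightarrow> real \<Rightarrow> real" where
  "kernel_P \<eta> x y = (LBINT t:J. weight \<eta> t * exp (- t) *
     (heat_gauss t x y + heat_gauss t x (- y)) / 4)"

definition kernel_Q :: "real \<Rightarrow> real \<Rightarrow> real \<Rightarrow> real" where
  "kernel_Q \<eta> x y = (LBINT t:J. weight \<eta> t * exp (- t) * heat_cos t x y / 2)"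

text \<open>Summation and integration are interchanged by dominated convergence. The partial sums with two different arguments are dominated by
  those with equal arguments, which are increasing and hence at most \<open>heat_sum t z z\<close>, of order \<open>t powr (- 1/2)\<close>; the weight times
  this bound is integrable.\<close>

lemma sums_kernel:
  assumes \<eta>: "0 < \<eta>" and xy: "0 \<le> x" "0 \<le> y"
  shows "(\<lambda>j. coeff_a \<eta> j * hermite_fun (4 * j) x * hermite_fun (4 * j) y) sums
     (LBINT t:J. weight \<eta> t * exp (- t) * heat_sum t x y)"
proof -
  define u where "u j t = weight \<eta> t * exp (- t) * (exp (- real j * t) * (hermite_fun (4 * j) x * hermite_fun (4 * j) y))" for j t
  define s where "s n t = (\<Sum>j<n. exp (- real j * t) * (hermite_fun (4 * j) x * hermite_fun (4 * j) y))" for n t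
  have diag: "(\<Sum>j<n. exp (- real j * t) * (hermite_fun (4 * j) z)\<^sup>2) \<le> 3 / sqrt t" if "t \<in> J" "0 \<le> z" for n t z
  proof -
    note t = J_bounds(1)[OF that(1)] less_imp_le[OF J_bounds(3)[OF that(1)]]
    have "(\<Sum>j<n. exp (- real j * t) * (hermite_fun (4 * j) z * hermite_fun (4 * j) z)) \<le> heat_sum t z z"
      using sums_heat_sum[OF t(1), of z z] by (subst sums_unique[OF sums_heat_sum[OF t(1), of z z]], intro sum_le_suminf) (auto simp: sums_iff)
    then show ?thesis using heat_sum_diag_le[OF t that(2)] by (simp add: power2_eq_square)
  qed
  have s_le: "\<bar>s n t\<bar> \<le> 3 / sqrt t" if t: "t \<in> J" for n t
  proof -
    have "\<bar>s n t\<bar> \<le> (\<Sum>j<n. \<bar>exp (- real j * t) * (hermite_fun (4 * j) x * hermite_fun (4 * j) y)\<bar>)"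
      unfolding s_def by (rule sum_abs)
    also have "\<dots> \<le> (\<Sum>j<n. (exp (- real j * t) * (hermite_fun (4 * j) x)\<^sup>2 + exp (- real j * t) * (hermite_fun (4 * j) y)\<^sup>2) / 2)"
    proof (rule sum_mono)
      fix j
      have "\<bar>hermite_fun (4 * j) x * hermite_fun (4 * j) y\<bar> \<le> ((hermite_fun (4 * j) x)\<^sup>2 + (hermite_fun (4 * j) y)\<^sup>2) / 2"
        using sum_squares_bound[of "\<bar>hermite_fun (4 * j) x\<bar>" "\<bar>hermite_fun (4 * j) y\<bar>"] by (simp add: abs_mult)
      then have "exp (- real j * t) * \<bar>hermite_fun (4 * j) x * hermite_fun (4 * j) y\<bar> \<le> exp (- real j * t) * (((hermite_fun (4 * j) x)\<^sup>2 + (hermite_fun (4 * j) y)\<^sup>2) / 2)"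
        by (intro mult_left_mono) auto
      then show "\<bar>exp (- real j * t) * (hermite_fun (4 * j) x * hermite_fun (4 * j) y)\<bar> \<le> (exp (- real j * t) * (hermite_fun (4 * j) x)\<^sup>2 + exp (- real j * t) * (hermite_fun (4 * j) y)\<^sup>2) / 2"
        by (simp add: abs_mult algebra_simps add_divide_distrib)
    qed
    also have "\<dots> = ((\<Sum>j<n. exp (- real j * t) * (hermite_fun (4 * j) x)\<^sup>2) + (\<Sum>j<n. exp (- real j * t) * (hermite_fun (4 * j) y)\<^sup>2)) / 2"
      by (simp add: sum.distrib sum_divide_distrib add_divide_distrib)
    also have "\<dots> \<le> 3 / sqrt t" using diag[OF t xy(1), of n] diag[OF t xy(2), of n] by simp
    finally show ?thesis .
  qed
  have partial_sum_le: "norm (indicator J t *\<^sub>R (weight \<eta> t * exp (- t) * s n t)) \<le> indicator J t *\<^sub>R (3 * (weight \<eta> t / sqrt t))" for n t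
  proof (cases "t \<in> J")
    case True
    have "\<bar>weight \<eta> t * exp (- t) * s n t\<bar> = weight \<eta> t * exp (- t) * \<bar>s n t\<bar>"
      using weight_nonneg[OF True] by (simp add: abs_mult)
    also have "\<dots> \<le> weight \<eta> t * 1 * (3 / sqrt t)"
      using weight_nonneg[OF True] J_bounds[OF True] by (intro mult_mono s_le True) auto
    finally show ?thesis using True by (simp add: mult.commute)
  qed auto
  have sm[measurable]: "s n \<in> borel_measurable borel" for n unfolding s_def by measurable
  have hm[measurable]: "(\<lambda>t. heat_sum t x y) \<in> borel_measurable borel" unfolding heat_sum_def by measurable
  have lim: "(\<lambda>n. LBINT t:J. weight \<eta> t * exp (- t) * s n t) \<longlonglongrightarrow> (LBINT t:J. weight \<eta> t * exp (- t) * heat_sum t x y)"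
    unfolding set_lebesgue_integral_def
  proof (rule integral_dominated_convergence)
    show "integrable lborel (\<lambda>t. indicator J t *\<^sub>R (3 * (weight \<eta> t / sqrt t)))"
      using integrable_weight_over_sqrt[OF \<eta>, of 3] unfolding set_integrable_def .
    show "AE t in lborel. (\<lambda>n. indicator J t *\<^sub>R (weight \<eta> t * exp (- t) * s n t)) \<longlonglongrightarrow> indicator J t *\<^sub>R (weight \<eta> t * exp (- t) * heat_sum t x y)"
    proof (rule AE_I2)
      fix t
      show "(\<lambda>n. indicator J t *\<^sub>R (weight \<eta> t * exp (- t) * s n t)) \<longlonglongrightarrow> indicator J t *\<^sub>R (weight \<eta> t * exp (- t) * heat_sum t x y)"
      proof (cases "t \<in> J")
        case True
        then have "(\<lambda>n. s n t) \<longlonglongrightarrow> heat_sum t x y"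
          using sums_heat_sum[OF J_bounds(1)[OF True], of x y] unfolding s_def sums_def by simp
        then show ?thesis by (intro tendsto_intros)
      qed auto
    qed
  qed (use partial_sum_le in \<open>auto simp del: real_scaleR_def\<close>)
  have "coeff_a \<eta> j * hermite_fun (4 * j) x * hermite_fun (4 * j) y = (LBINT t:J. u j t)" for j
  proof -
    have "(LBINT t:J. u j t) = (LBINT t:J. (exp (- (real j + 1) * t) / (sqrt t * ln (1 / t) powr (1 + \<eta>))) * (hermite_fun (4 * j) x * hermite_fun (4 * j) y))"
      by (rule set_lebesgue_integral_cong) (auto simp: u_def weight_def algebra_simps exp_diff exp_minus exp_add divide_simps)
    then show ?thesis unfolding coeff_a_def by (simp only: set_integral_mult_left mult.assoc)
  qed
  moreover have "(\<Sum>j<n. LBINT t:J. u j t) = (LBINT t:J. weight \<eta> t * exp (- t) * s n t)" for n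
  proof -
    have int: "set_integrable lborel J (u j)" for j
    proof (rule set_integrable_J_bound[OF integrable_weight_over_sqrt[OF \<eta>, of "\<bar>hermite_fun (4 * j) x * hermite_fun (4 * j) y\<bar>"]])
      show "u j \<in> borel_measurable borel" unfolding u_def by measurable
      fix t assume t: "t \<in> J"
      have "\<bar>u j t\<bar> = \<bar>hermite_fun (4 * j) x * hermite_fun (4 * j) y\<bar> * (weight \<eta> t * (exp (- t) * exp (- real j * t)))"
        using weight_nonneg[OF t] by (simp add: u_def abs_mult)
      also have "\<dots> \<le> \<bar>hermite_fun (4 * j) x * hermite_fun (4 * j) y\<bar> * (weight \<eta> t * (1 / sqrt t))"
      proof (intro mult_left_mono)
        have "exp (- t) * exp (- real j * t) \<le> 1 * 1" using J_bounds[OF t] by (intro mult_mono) auto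
        also have "\<dots> \<le> 1 / sqrt t" using J_bounds[OF t] by simp
        finally show "exp (- t) * exp (- real j * t) \<le> 1 / sqrt t" .
      qed (use weight_nonneg[OF t] in auto)
      finally show "\<bar>u j t\<bar> \<le> \<bar>hermite_fun (4 * j) x * hermite_fun (4 * j) y\<bar> * (weight \<eta> t / sqrt t)" by simp
    qed
    have "(\<Sum>j<n. LBINT t:J. u j t) = (LBINT t:J. \<Sum>j<n. u j t)"
      using int unfolding set_lebesgue_integral_def set_integrable_def scaleR_sum_right
      by (intro Bochner_Integration.integral_sum[symmetric])
    also have "\<dots> = (LBINT t:J. weight \<eta> t * exp (- t) * s n t)"
      by (rule set_lebesgue_integral_cong) (auto simp: u_def s_def sum_distrib_left)
    finally show ?thesis .
  qed
  ultimately show ?thesis using lim unfolding sums_def by simp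
qed

lemma kernel_K_split:
  assumes \<eta>: "0 < \<eta>" and xy: "0 \<le> x" "0 \<le> y"
  shows "kernel_K \<eta> x y = kernel_P \<eta> x y + kernel_Q \<eta> x y"
proof -
  note I = integrable_weight_heat[OF \<eta> xy]
  have "kernel_K \<eta> x y = (LBINT t:J. weight \<eta> t * exp (- t) * heat_sum t x y)"
    unfolding kernel_K_def using sums_kernel[OF assms] by (rule sums_unique[symmetric])
  also have "\<dots> = (LBINT t:J. weight \<eta> t * exp (- t) * (heat_gauss t x y + heat_gauss t x (- y)) / 4
     + weight \<eta> t * exp (- t) * heat_cos t x y / 2)"
    by (rule set_lebesgue_integral_cong) (auto simp: heat_sum_def field_simps)
  also have "\<dots> = kernel_P \<eta> x y + kernel_Q \<eta> x y"
    unfolding kernel_P_def kernel_Q_def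
    by (rule set_integral_add) (use I in \<open>auto simp: ring_distribs\<close>)
  finally show ?thesis .
qed

section \<open>Size of the two parts of the kernel\<close>

lemma exp_le_powr:
  fixes z p :: real
  assumes "0 < z" "0 < p" "p \<le> 1"
  shows "exp (- z) \<le> z powr (- p)"
proof -
  have "z powr p \<le> 1 + z"
  proof (cases "z \<le> 1")
    case True
    then have "z powr p \<le> 1 powr p" using assms by (intro powr_mono2) auto
    then show ?thesis using assms by simp
  next
    case False
    then have "z powr p \<le> z powr 1" using assms by (intro powr_mono) auto
    then show ?thesis using assms by simp
  qed
  also have "\<dots> \<le> exp z" by (rule exp_ge_add_one_self)
  finally show ?thesis using assms by (simp add: exp_minus powr_minus le_imp_inverse_le)
qed

text \<open>An exponential \<open>exp (- \<kappa> T t)\<close> confines \<open>t\<close> essentially to \<open>t \<le> 1 / T\<close>, where \<open>ln (1/t)\<close> is at least of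
  order \<open>ln T\<close>. The point of the lemma is that the logarithm of the weight may be replaced by the constant \<open>ln (e + T)\<close> at the cost of
  a power of \<open>1 + T t\<close>, because \<open>ln (e + T) \<le> ln (1/t) (1 + T t)\<close>.\<close>

lemma weight_exp_le:
  fixes \<kappa> :: real
  assumes \<kappa>: "0 < \<kappa>"
  obtains C where "0 < C"
    "\<And>\<eta> T t. 0 < \<eta> \<Longrightarrow> \<eta> \<le> 1 \<Longrightarrow> 0 \<le> T \<Longrightarrow> t \<in> J \<Longrightarrow>
       weight \<eta> t * exp (- \<kappa> * T * t) \<le> C * ln (exp 1 + T) powr (- (1 + \<eta>)) * (t powr (- 1/2) * (1 + T * t) powr (- 2))"
proof -
  define C where "C = (4 / \<kappa>) ^ 4 * exp \<kappa>"
  have C0: "0 < C" using \<kappa> by (simp add: C_def)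
  have main: "weight \<eta> t * exp (- \<kappa> * T * t) \<le> C * ln (exp 1 + T) powr (- (1 + \<eta>)) * (t powr (- 1/2) * (1 + T * t) powr (- 2))"
    if \<eta>: "0 < \<eta>" "\<eta> \<le> 1" and T: "0 \<le> T" and tJ: "t \<in> J" for \<eta> T t
  proof -
  note t = J_bounds[OF tJ]
  define z where "z = T * t"
  have z: "0 \<le> z" using T t by (simp add: z_def)
  define l \<Lambda> where "l = ln (1 / t)" and "\<Lambda> = ln (exp 1 + T)"
  have l: "2 \<le> l" using t by (simp add: l_def)
  have "ln (exp (1::real)) \<le> \<Lambda>" unfolding \<Lambda>_def using T by (subst ln_le_cancel_iff) (auto simp: add_pos_nonneg)
  then have \<Lambda>: "1 \<le> \<Lambda>" by simp
  have "\<Lambda> = ln ((1 / t) * (t * (exp 1 + T)))" using t by (simp add: \<Lambda>_def)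
  also have "\<dots> = l + ln (t * (exp 1 + T))"
    unfolding l_def by (rule ln_mult_pos) (use t T in \<open>auto simp: add_pos_nonneg\<close>)
  also have "ln (t * (exp 1 + T)) \<le> t * (exp 1 + T) - 1"
    using t T by (intro ln_le_minus_one) (auto simp: add_pos_nonneg)
  also have "t * (exp 1 + T) - 1 \<le> z"
  proof -
    have "t * exp 1 \<le> exp (-2) * exp (1::real)" using tJ by (intro mult_right_mono) auto
    also have "\<dots> \<le> 1" by (simp flip: exp_add)
    finally show ?thesis by (simp add: z_def algebra_simps)
  qed
  also have "l + z \<le> l * (1 + z)" using l z mult_right_mono[of 1 l z] by (simp add: algebra_simps)
  finally have "\<Lambda> / (1 + z) \<le> l" using z by (simp add: divide_le_eq)
  then have "l powr (- (1 + \<eta>)) \<le> (\<Lambda> / (1 + z)) powr (- (1 + \<eta>))"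
    using \<Lambda> z \<eta> by (intro powr_mono2') auto
  also have "\<dots> = \<Lambda> powr (- (1 + \<eta>)) * (1 + z) powr (1 + \<eta>)"
    using \<Lambda> z by (simp only: powr_divide[of \<Lambda> "1 + z"] powr_minus_divide) (simp add: field_simps)
  also have "\<dots> \<le> \<Lambda> powr (- (1 + \<eta>)) * (1 + z) powr 2" using z \<eta> by (intro mult_left_mono powr_mono) auto
  finally have 1: "l powr (- (1 + \<eta>)) \<le> \<Lambda> powr (- (1 + \<eta>)) * (1 + z) powr 2" .
  have "1 + z \<le> (4 / \<kappa>) * exp (\<kappa> * (1 + z) / 4)"
    using exp_ge_add_one_self[of "\<kappa> * (1 + z) / 4"] \<kappa> by (simp add: field_simps)
  then have "(1 + z) ^ 4 \<le> ((4 / \<kappa>) * exp (\<kappa> * (1 + z) / 4)) ^ 4" using z by (intro power_mono) auto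
  also have "exp (\<kappa> * (1 + z) / 4) ^ 4 = exp \<kappa> * exp (\<kappa> * z)"
    by (simp add: algebra_simps flip: exp_of_nat_mult exp_add)
  then have "((4 / \<kappa>) * exp (\<kappa> * (1 + z) / 4)) ^ 4 = C * exp (\<kappa> * z)"
    by (simp only: C_def power_mult_distrib mult.assoc)
  finally have "(1 + z) ^ 4 * exp (- \<kappa> * z) \<le> C * exp (\<kappa> * z) * exp (- \<kappa> * z)" by (intro mult_right_mono) auto
  also have "\<dots> = C" by (simp add: mult.assoc flip: exp_add)
  finally have 2: "(1 + z) ^ 4 * exp (- \<kappa> * z) \<le> C" .
  have "(1 + z) powr 2 = (1 + z) ^ 4 * (1 + z) powr (- 2)"
    using z by (simp add: powr_minus_divide powr_numeral field_simps flip: power_add)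
  then have "(1 + z) powr 2 * exp (- \<kappa> * z) = ((1 + z) ^ 4 * exp (- \<kappa> * z)) * (1 + z) powr (- 2)" by simp
  also have "\<dots> \<le> C * (1 + z) powr (- 2)" using 2 by (intro mult_right_mono) auto
  finally have 3: "(1 + z) powr 2 * exp (- \<kappa> * z) \<le> C * (1 + z) powr (- 2)" .
  have w: "weight \<eta> t = t powr (- 1/2) * l powr (- (1 + \<eta>))"
    unfolding powr_minus_divide using t by (simp add: weight_def l_def powr_half_sqrt[symmetric] powr_minus_divide)
  have "weight \<eta> t * exp (- \<kappa> * T * t) = t powr (- 1/2) * (l powr (- (1 + \<eta>)) * exp (- \<kappa> * z))"
    by (simp add: w z_def mult.assoc)
  also have "\<dots> \<le> t powr (- 1/2) * (\<Lambda> powr (- (1 + \<eta>)) * (1 + z) powr 2 * exp (- \<kappa> * z))"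
    using 1 by (intro mult_left_mono mult_right_mono) auto
  also have "\<dots> = t powr (- 1/2) * \<Lambda> powr (- (1 + \<eta>)) * ((1 + z) powr 2 * exp (- \<kappa> * z))" by simp
  also have "\<dots> \<le> t powr (- 1/2) * \<Lambda> powr (- (1 + \<eta>)) * (C * (1 + z) powr (- 2))"
    using 3 by (intro mult_left_mono) auto
  finally show ?thesis
    by (simp add: \<Lambda>_def z_def mult_ac)
  qed
  then show ?thesis using that[of C] C0 by blast
qed

lemma integral_weight_exp_le:
  fixes \<kappa> :: real
  assumes \<kappa>: "0 < \<kappa>"
  obtains C where "0 < C"
    "\<And>\<eta> T. 0 < \<eta> \<Longrightarrow> \<eta> \<le> 1 \<Longrightarrow> 0 < T \<Longrightarrow> set_integrable lborel J (\<lambda>t. weight \<eta> t * exp (- \<kappa> * T * t))"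
    "\<And>\<eta> T. 0 < \<eta> \<Longrightarrow> \<eta> \<le> 1 \<Longrightarrow> 0 < T \<Longrightarrow>
       (LBINT t:J. weight \<eta> t * exp (- \<kappa> * T * t)) \<le> C * (ln (exp 1 + T) powr (- (1 + \<eta>)) * T powr (- 1/2))"
proof -
  obtain C where C: "0 < C" and *: "\<And>\<eta> T t. 0 < \<eta> \<Longrightarrow> \<eta> \<le> 1 \<Longrightarrow> 0 \<le> T \<Longrightarrow> t \<in> J \<Longrightarrow>
       weight \<eta> t * exp (- \<kappa> * T * t) \<le> C * ln (exp 1 + T) powr (- (1 + \<eta>)) * (t powr (- 1/2) * (1 + T * t) powr (- 2))"
    using weight_exp_le[OF \<kappa>] by blast
  have b: "weight \<eta> t * exp (- \<kappa> * T * t) \<le> (C * ln (exp 1 + T) powr (- (1 + \<eta>))) * (t powr (1/2 - 1) * (1 + T * t) powr (- (1/2) - 1))"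
    if "0 < \<eta>" "\<eta> \<le> 1" "0 < T" "t \<in> J" for \<eta> T t
  proof -
    have "0 \<le> T * t" using that by simp
    then have "(1 + T * t) powr (- 2) \<le> (1 + T * t) powr (- (1/2) - 1)" by (intro powr_mono) auto
    then have "C * ln (exp 1 + T) powr (- (1 + \<eta>)) * (t powr (- 1/2) * (1 + T * t) powr (- 2)) \<le>
       C * ln (exp 1 + T) powr (- (1 + \<eta>)) * (t powr (1/2 - 1) * (1 + T * t) powr (- (1/2) - 1))"
      using C by (intro mult_left_mono mult_mono) auto
    then show ?thesis using *[of \<eta> T t] that by simp
  qed
  have int: "set_integrable lborel J (\<lambda>t. (C * ln (exp 1 + T) powr (- (1 + \<eta>))) * (t powr (1/2 - 1) * (1 + T * t) powr (- (1/2) - 1)))"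
    if "0 < T" for \<eta> T
    by (rule set_integrable_mult_right, rule power_weight_integral(1)) (use that in auto)
  have int2: "set_integrable lborel J (\<lambda>t. weight \<eta> t * exp (- \<kappa> * T * t))" if "0 < \<eta>" "\<eta> \<le> 1" "0 < T" for \<eta> T
    by (rule set_integrable_J_bound[OF int[OF that(3)]]) (use b[OF that] weight_nonneg in \<open>auto simp: abs_mult\<close>)
  show ?thesis
  proof (rule that[of "2 * C"])
    show "0 < 2 * C" using C by simp
    fix \<eta> T :: real assume h: "0 < \<eta>" "\<eta> \<le> 1" "0 < T"
    show "set_integrable lborel J (\<lambda>t. weight \<eta> t * exp (- \<kappa> * T * t))" by (rule int2[OF h])
    have "(LBINT t:J. weight \<eta> t * exp (- \<kappa> * T * t)) \<le> (LBINT t:J. (C * ln (exp 1 + T) powr (- (1 + \<eta>))) * (t powr (1/2 - 1) * (1 + T * t) powr (- (1/2) - 1)))"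
      by (intro set_integral_mono int2 int h b)
    also have "\<dots> = (C * ln (exp 1 + T) powr (- (1 + \<eta>))) * (LBINT t:J. t powr (1/2 - 1) * (1 + T * t) powr (- (1/2) - 1))"
      by (rule set_integral_mult_right)
    also have "\<dots> \<le> (C * ln (exp 1 + T) powr (- (1 + \<eta>))) * (T powr (- (1/2)) / (1/2))"
      using C h by (intro mult_left_mono power_weight_integral(2)) auto
    finally show "(LBINT t:J. weight \<eta> t * exp (- \<kappa> * T * t)) \<le> 2 * C * (ln (exp 1 + T) powr (- (1 + \<eta>)) * T powr (- 1/2))"
      by simp
  qed
qed

lemma kernel_P_nonneg:
  assumes "0 < \<eta>" "0 \<le> x" "0 \<le> y"
  shows "0 \<le> kernel_P \<eta> x y"
proof -
  have "0 \<le> weight \<eta> t * exp (- t) * (heat_gauss t x y + heat_gauss t x (- y)) / 4"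
    if t: "t \<in> J" for t
  proof -
    interpret mehler_parameters "heat_a t" "heat_s t" by (rule heat_parameters) (use t in auto)
    show "0 \<le> weight \<eta> t * exp (- t) * (heat_gauss t x y + heat_gauss t x (- y)) / 4"
      using weight_nonneg[OF t] gauss_kernel_nonneg[OF a(1)] by (intro divide_nonneg_nonneg mult_nonneg_nonneg add_nonneg_nonneg) auto
  qed
  then show ?thesis unfolding kernel_P_def set_lebesgue_integral_def
    by (intro Bochner_Integration.integral_nonneg) (auto simp: indicator_def)
qed

lemma kernel_P_integrable:
  assumes "0 < \<eta>" "0 \<le> x" "0 \<le> y"
  shows "set_integrable lborel J (\<lambda>t. weight \<eta> t * exp (- t) *
     (heat_gauss t x y + heat_gauss t x (- y)) / 4)"
  using set_integral_add(1)[OF integrable_weight_heat(1,2)[OF assms]] by (simp add: ring_distribs)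

text \<open>With \<open>\<delta> = (x - y)\<^sup>2\<close> and \<open>T = (x + y)\<^sup>2\<close> the Gaussian is at most \<open>exp (- \<delta> / t - T t / 16) / sqrt t\<close>. The first term of the
  exponent yields \<open>(t / \<delta>) powr p\<close> and the second limits \<open>t\<close> to about \<open>1 / T\<close>, so that the integral is about
  \<open>(\<delta> T) powr (- p)\<close>, where \<open>\<delta> T = (x\<^sup>2 - y\<^sup>2)\<^sup>2\<close>. Small \<open>p\<close> serves close nodes and \<open>p = 1\<close> distant ones.\<close>

lemma kernel_P_le:
  fixes p :: real
  assumes p: "0 < p" "p \<le> 1"
  obtains C where "0 < C"
    "\<And>\<eta> x y. 0 < \<eta> \<Longrightarrow> \<eta> \<le> 1 \<Longrightarrow> 0 \<le> x \<Longrightarrow> 0 \<le> y \<Longrightarrow> x \<noteq> y \<Longrightarrow>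
       kernel_P \<eta> x y \<le> C * (ln (exp 1 + (x + y)\<^sup>2) powr (- (1 + \<eta>)) * (x\<^sup>2 - y\<^sup>2)\<^sup>2 powr (- p))"
proof -
  obtain C where C: "0 < C" and *: "\<And>\<eta> T t. 0 < \<eta> \<Longrightarrow> \<eta> \<le> 1 \<Longrightarrow> 0 \<le> T \<Longrightarrow> t \<in> J \<Longrightarrow>
       weight \<eta> t * exp (- (1/16) * T * t) \<le> C * ln (exp 1 + T) powr (- (1 + \<eta>)) * (t powr (- 1/2) * (1 + T * t) powr (- 2))"
    using weight_exp_le[of "1/16"] by auto
  show ?thesis
  proof (rule that[of "2 * C / p"])
    show "0 < 2 * C / p" using C p by simp
    fix \<eta> x y :: real assume h: "0 < \<eta>" "\<eta> \<le> 1" "0 \<le> x" "0 \<le> y" "x \<noteq> y"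
    define T \<delta> where "T = (x + y)\<^sup>2" and "\<delta> = (x - y)\<^sup>2"
    have T: "0 < T" using h by (auto simp: T_def)
    have \<delta>: "0 < \<delta>" using h by (auto simp: \<delta>_def)
    define A where "A = 2 * C * ln (exp 1 + T) powr (- (1 + \<eta>)) * \<delta> powr (- p)"
    have A: "0 \<le> A" using C by (simp add: A_def)
    have le: "weight \<eta> t * exp (- t) * (heat_gauss t x y + heat_gauss t x (- y)) / 4
      \<le> A * (t powr (p - 1) * (1 + T * t) powr (- p - 1))" if tJ: "t \<in> J" for t
    proof -
      note t = J_bounds(1)[OF tJ] less_imp_le[OF J_bounds(3)[OF tJ]]
      have "\<delta> / t > 0" using \<delta> t by simp
      then have "exp (- (\<delta> / t)) \<le> (\<delta> / t) powr (- p)" by (rule exp_le_powr) (use p in auto)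
      also have "\<dots> = \<delta> powr (- p) * t powr p" using \<delta> t by (simp add: powr_divide powr_minus_divide)
      finally have e: "exp (- (\<delta> / t)) \<le> \<delta> powr (- p) * t powr p" .
      have ee: "exp (- (x - y)\<^sup>2 / t - t * (x + y)\<^sup>2 / 16) = exp (- (\<delta> / t)) * exp (- (1/16) * T * t)"
        by (simp add: T_def \<delta>_def flip: exp_add)
      have "heat_gauss t x y + heat_gauss t x (- y)
         \<le> 8 / sqrt t * (exp (- (\<delta> / t)) * exp (- (1/16) * T * t))"
        using gauss_kernel_le[OF t h(3,4)] unfolding ee by simp
      also have "\<dots> \<le> 8 / sqrt t * ((\<delta> powr (- p) * t powr p) * exp (- (1/16) * T * t))"
        using e t by (intro mult_left_mono mult_right_mono) auto
      finally have "exp (- t) * (heat_gauss t x y + heat_gauss t x (- y))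
         \<le> 1 * (8 / sqrt t * ((\<delta> powr (- p) * t powr p) * exp (- (1/16) * T * t)))"
        using t by (intro mult_mono) (auto intro!: add_nonneg_nonneg gauss_kernel_nonneg mehler_parameters.a[OF heat_parameters])
      then have "weight \<eta> t * (exp (- t) * (heat_gauss t x y + heat_gauss t x (- y)))
         \<le> weight \<eta> t * (1 * (8 / sqrt t * ((\<delta> powr (- p) * t powr p) * exp (- (1/16) * T * t))))"
        using weight_nonneg[OF tJ] by (intro mult_left_mono)
      then have "weight \<eta> t * exp (- t) * (heat_gauss t x y + heat_gauss t x (- y)) / 4
         \<le> (weight \<eta> t * exp (- (1/16) * T * t)) * (2 * \<delta> powr (- p) * t powr p / sqrt t)"
        by (simp add: mult_ac)
      also have "\<dots> \<le> (C * ln (exp 1 + T) powr (- (1 + \<eta>)) * (t powr (- 1/2) * (1 + T * t) powr (- p - 1))) * (2 * \<delta> powr (- p) * t powr p / sqrt t)"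
      proof (rule mult_right_mono)
        have "0 \<le> T * t" using T t by simp
        then have "(1 + T * t) powr (- 2) \<le> (1 + T * t) powr (- p - 1)" using p by (intro powr_mono) auto
        then have "C * ln (exp 1 + T) powr (- (1 + \<eta>)) * (t powr (- 1/2) * (1 + T * t) powr (- 2))
           \<le> C * ln (exp 1 + T) powr (- (1 + \<eta>)) * (t powr (- 1/2) * (1 + T * t) powr (- p - 1))"
          using C by (intro mult_left_mono mult_mono) auto
        then show "weight \<eta> t * exp (- (1/16) * T * t) \<le> C * ln (exp 1 + T) powr (- (1 + \<eta>)) * (t powr (- 1/2) * (1 + T * t) powr (- p - 1))"
          using *[OF h(1,2) less_imp_le[OF T] tJ] by linarith
      qed (use t in auto)
      also have "\<dots> = A * ((t powr (- 1/2) * t powr p / sqrt t) * (1 + T * t) powr (- p - 1))"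
        by (simp add: A_def)
      also have "t powr (- 1/2) * t powr p / sqrt t = t powr (- 1/2 + p + - 1/2)"
        unfolding powr_add using t by (simp add: powr_minus_divide powr_half_sqrt)
      also have "- 1/2 + p + - 1/2 = p - 1" by simp
      finally show ?thesis .
    qed
    have int: "set_integrable lborel J (\<lambda>t. A * (t powr (p - 1) * (1 + T * t) powr (- p - 1)))"
      by (rule set_integrable_mult_right, rule power_weight_integral(1)) (use p T in auto)
    have "kernel_P \<eta> x y \<le> (LBINT t:J. A * (t powr (p - 1) * (1 + T * t) powr (- p - 1)))"
      unfolding kernel_P_def by (intro set_integral_mono kernel_P_integrable int le h)
    also have "\<dots> = A * (LBINT t:J. t powr (p - 1) * (1 + T * t) powr (- p - 1))" by (rule set_integral_mult_right)
    also have "\<dots> \<le> A * (T powr (- p) / p)"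
      using A p T by (intro mult_left_mono power_weight_integral(2)) auto
    also have "\<dots> = 2 * C / p * (ln (exp 1 + T) powr (- (1 + \<eta>)) * (\<delta> * T) powr (- p))"
      using \<delta> T by (simp add: A_def powr_mult)
    also have "\<delta> * T = (x\<^sup>2 - y\<^sup>2)\<^sup>2" unfolding \<delta>_def T_def power_mult_distrib[symmetric]
      by (simp add: algebra_simps power2_eq_square)
    finally show "kernel_P \<eta> x y \<le> 2 * C / p * (ln (exp 1 + (x + y)\<^sup>2) powr (- (1 + \<eta>)) * (x\<^sup>2 - y\<^sup>2)\<^sup>2 powr (- p))"
      by (simp add: T_def)
  qed
qed

text \<open>For \<open>t \<le> 1 / (e\<^sup>2 + x\<^sup>2)\<close> the Gaussian at \<open>x = y\<close> is at least a constant times \<open>t powr (- 1/2)\<close>.\<close>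

lemma kernel_P_diag_ge:
  assumes \<eta>: "0 < \<eta>" and x: "0 \<le> x"
  shows "exp (- 1 - pi) / 4 / (\<eta> * ln (exp 2 + x\<^sup>2) powr \<eta>) \<le> kernel_P \<eta> x x"
proof -
  define d where "d = 1 / (exp 2 + x\<^sup>2)"
  have e2: "1 < exp (2::real)" by simp
  have d: "0 < d" "d < 1" "d \<le> exp (- 2)" "d * x\<^sup>2 \<le> 1"
    using e2 by (auto simp: d_def exp_minus field_simps add_pos_nonneg less_le_trans[of 1 "exp 2"] add_strict_increasing)
  define c where "c = exp (- 1 - pi) / (4::real)"
  have le: "c * (weight \<eta> t / sqrt t) \<le> weight \<eta> t * exp (- t) * (heat_gauss t x x + heat_gauss t x (- x)) / 4"
    if "t \<in> {0<..d}" for t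
  proof -
    have tJ: "t \<in> J" using that d by auto
    note t = J_bounds(1)[OF tJ] less_imp_le[OF J_bounds(3)[OF tJ]]
    interpret mehler_parameters "heat_a t" "heat_s t" by (rule heat_parameters[OF t(1)])
    have "t * x\<^sup>2 \<le> d * x\<^sup>2" using that by (intro mult_right_mono) auto
    then have "pi * (t * x\<^sup>2) \<le> pi * 1" using d by (intro mult_left_mono) auto
    then have "- 1 - pi \<le> - t + - pi * t * x\<^sup>2" unfolding mult.assoc minus_mult_left[symmetric] using t by linarith
    then have "exp (- 1 - pi) \<le> exp (- t) * exp (- pi * t * x\<^sup>2)" by (simp flip: exp_add)
    then have "exp (- 1 - pi) / sqrt t \<le> exp (- t) * (exp (- pi * t * x\<^sup>2) / sqrt t)"
      using t by (simp add: divide_right_mono)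
    also have "\<dots> \<le> exp (- t) * heat_gauss t x x"
      by (intro mult_left_mono gauss_kernel_diag_ge t) auto
    also have "\<dots> \<le> exp (- t) * (heat_gauss t x x + heat_gauss t x (- x))"
      using gauss_kernel_nonneg[OF a(1)] by (intro mult_left_mono) auto
    finally have "weight \<eta> t * (exp (- 1 - pi) / sqrt t) \<le> weight \<eta> t * (exp (- t) * (heat_gauss t x x + heat_gauss t x (- x)))"
      using weight_nonneg[OF tJ] by (intro mult_left_mono)
    then show ?thesis by (simp add: c_def mult_ac)
  qed
  have int: "set_integrable lborel {0<..d} (\<lambda>t. c * (weight \<eta> t / sqrt t))"
    by (rule set_integrable_mult_right, rule log_weight_integral(1)) (use \<eta> d in auto)
  have "c * (1 / (\<eta> * ln (1 / d) powr \<eta>)) = (LBINT t:{0<..d}. c * (weight \<eta> t / sqrt t))"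
    by (subst set_integral_mult_right, subst log_weight_integral(2)) (use \<eta> d in auto)
  also have "\<dots> \<le> kernel_P \<eta> x x"
    unfolding kernel_P_def set_lebesgue_integral_def
  proof (rule integral_mono)
    show "integrable lborel (\<lambda>t. indicat_real {0<..d} t *\<^sub>R (c * (weight \<eta> t / sqrt t)))"
      using int by (simp add: set_integrable_def)
    show "integrable lborel (\<lambda>t. indicat_real J t *\<^sub>R (weight \<eta> t * exp (- t) * (heat_gauss t x x + heat_gauss t x (- x)) / 4))"
      using kernel_P_integrable[OF \<eta> x x] by (simp add: set_integrable_def)
    fix t :: real
    show "indicat_real {0<..d} t *\<^sub>R (c * (weight \<eta> t / sqrt t)) \<le> indicat_real J t *\<^sub>R (weight \<eta> t * exp (- t) * (heat_gauss t x x + heat_gauss t x (- x)) / 4)"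
    proof (cases "t \<in> {0<..d}")
      case True
      then have "t \<in> J" using d by auto
      then show ?thesis using le[OF True] True by simp
    next
      case False
      have "0 \<le> weight \<eta> t * exp (- t) * (heat_gauss t x x + heat_gauss t x (- x)) / 4" if "t \<in> J"
        using weight_nonneg[OF that] that by (auto intro!: add_nonneg_nonneg mult_nonneg_nonneg gauss_kernel_nonneg mehler_parameters.a[OF heat_parameters])
      then show ?thesis using False by (auto simp: indicator_def)
    qed
  qed
  finally show ?thesis by (simp add: c_def d_def)
qed

text \<open>The cosine kernel has bounded height, so the singularity of the integrand at 0 is only \<open>t powr (- 1/2)\<close> and no factor \<open>1 / \<eta>\<close> arises.\<close>

lemma kernel_Q_diag_le:
  obtains C where "0 < C" "\<And>\<eta> x. 0 < \<eta> \<Longrightarrow> \<eta> \<le> 1 \<Longrightarrow> 0 \<le> x \<Longrightarrow> \<bar>kernel_Q \<eta> x x\<bar> \<le> C * ln (exp 1 + x\<^sup>2) powr (- \<eta>)"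
proof -
  obtain C where C: "0 < C" and int: "\<And>\<eta> T. 0 < \<eta> \<Longrightarrow> \<eta> \<le> 1 \<Longrightarrow> 0 < T \<Longrightarrow> set_integrable lborel J (\<lambda>t. weight \<eta> t * exp (- (1/2) * T * t))"
    and le: "\<And>\<eta> T. 0 < \<eta> \<Longrightarrow> \<eta> \<le> 1 \<Longrightarrow> 0 < T \<Longrightarrow>
       (LBINT t:J. weight \<eta> t * exp (- (1/2) * T * t)) \<le> C * (ln (exp 1 + T) powr (- (1 + \<eta>)) * T powr (- 1/2))"
    using integral_weight_exp_le[of "1/2"] by auto
  show ?thesis
  proof (rule that[of "2 * C"])
    show "0 < 2 * C" using C by simp
    fix \<eta> x :: real assume h: "0 < \<eta>" "\<eta> \<le> 1" "0 \<le> x"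
    \<comment> \<open>The summand 1 covers small \<open>x\<close>; it costs a factor \<open>exp (- t / 2)\<close>, taken from \<open>exp (- t)\<close>.\<close>
    define T where "T = 1 + x\<^sup>2"
    have T: "1 \<le> T" by (simp add: T_def)
    have b: "\<bar>weight \<eta> t * exp (- t) * heat_cos t x x / 2\<bar> \<le> 2 * (weight \<eta> t * exp (- (1/2) * T * t))" if tJ: "t \<in> J" for t
    proof -
      note t = J_bounds(1)[OF tJ] less_imp_le[OF J_bounds(3)[OF tJ]]
      have "exp (- t) * \<bar>heat_cos t x x\<bar> \<le> exp (- t) * (2 * exp (- t * (x\<^sup>2 + x\<^sup>2) / 4))"
        by (intro mult_left_mono abs_cos_kernel_le t) auto
      also have "\<dots> = 2 * exp (- t - t * x\<^sup>2 / 2)" by (simp flip: exp_add)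
      also have "\<dots> \<le> 2 * exp (- (1/2) * T * t)" using t by (simp add: T_def field_simps)
      finally have "weight \<eta> t * (exp (- t) * \<bar>heat_cos t x x\<bar>) \<le> weight \<eta> t * (2 * exp (- (1/2) * T * t))"
        using weight_nonneg[OF tJ] by (intro mult_left_mono)
      also have "\<dots> = 2 * (weight \<eta> t * exp (- (1/2) * T * t))" by simp
      finally have "weight \<eta> t * (exp (- t) * \<bar>heat_cos t x x\<bar>) \<le> 2 * (weight \<eta> t * exp (- (1/2) * T * t))" .
      moreover have "0 \<le> weight \<eta> t * (exp (- t) * \<bar>heat_cos t x x\<bar>)" using weight_nonneg[OF tJ] by simp
      moreover have "\<bar>weight \<eta> t * exp (- t) * heat_cos t x x / 2\<bar> = weight \<eta> t * (exp (- t) * \<bar>heat_cos t x x\<bar>) / 2"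
        using weight_nonneg[OF tJ] by (simp add: abs_mult)
      ultimately show ?thesis by linarith
    qed
    have i: "set_integrable lborel J (\<lambda>t. 2 * (weight \<eta> t * exp (- (1/2) * T * t)))"
      by (intro set_integrable_mult_right int h) (use T in auto)
    have i2: "set_integrable lborel J (\<lambda>t. weight \<eta> t * exp (- t) * heat_cos t x x / 2)"
      using integrable_weight_heat(3)[OF h(1,3,3)] by simp
    have "\<bar>kernel_Q \<eta> x x\<bar> \<le> (LBINT t:J. \<bar>weight \<eta> t * exp (- t) * heat_cos t x x / 2\<bar>)"
      unfolding kernel_Q_def using set_integral_norm_bound[OF i2] by simp
    also have "\<dots> \<le> (LBINT t:J. 2 * (weight \<eta> t * exp (- (1/2) * T * t)))"
      by (intro set_integral_mono set_integrable_abs i i2 b)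
    also have "\<dots> = 2 * (LBINT t:J. weight \<eta> t * exp (- (1/2) * T * t))" by (rule set_integral_mult_right)
    also have "\<dots> \<le> 2 * (C * (ln (exp 1 + T) powr (- (1 + \<eta>)) * T powr (- 1/2)))"
      using le[OF h(1,2), of T] T by simp
    also have "\<dots> \<le> 2 * (C * (ln (exp 1 + x\<^sup>2) powr (- \<eta>) * 1))"
    proof (intro mult_left_mono mult_mono)
      have l1: "1 \<le> ln (exp 1 + x\<^sup>2)"
        using ln_le_cancel_iff[of "exp 1" "exp 1 + x\<^sup>2"] by (simp add: add_pos_nonneg)
      have l2: "ln (exp 1 + x\<^sup>2) \<le> ln (exp 1 + T)" by (subst ln_le_cancel_iff) (auto simp: T_def add_pos_nonneg)
      have "ln (exp 1 + T) powr (- (1 + \<eta>)) \<le> ln (exp 1 + x\<^sup>2) powr (- (1 + \<eta>))"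
        using l1 l2 h by (intro powr_mono2') auto
      also have "\<dots> \<le> ln (exp 1 + x\<^sup>2) powr (- \<eta>)" using l1 by (intro powr_mono) auto
      finally show "ln (exp 1 + T) powr (- (1 + \<eta>)) \<le> ln (exp 1 + x\<^sup>2) powr (- \<eta>)" .
      have "T powr (- 1/2) \<le> T powr 0" using T by (intro powr_mono) auto
      then show "T powr (- 1/2) \<le> 1" using T by simp
    qed (use C in auto)
    finally show "\<bar>kernel_Q \<eta> x x\<bar> \<le> 2 * C * ln (exp 1 + x\<^sup>2) powr (- \<eta>)" by simp
  qed
qed

section \<open>Geometry of the nodes\<close>

definition lg :: "real \<Rightarrow> real" where "lg v = ln (exp 1 + v)"

lemma exp1_bounds: "2 \<le> exp (1::real)" "exp (1::real) \<le> 3"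
  using exp_ge_add_one_self[of 1] exp_le by auto

lemma lg_ge_1: "0 \<le> v \<Longrightarrow> 1 \<le> lg v"
  unfolding lg_def using ln_le_cancel_iff[of "exp 1" "exp 1 + v"] by (simp add: add_pos_nonneg)

lemma lg_mono: "0 \<le> v \<Longrightarrow> v \<le> w \<Longrightarrow> lg v \<le> lg w"
  unfolding lg_def by (subst ln_le_cancel_iff) (auto simp: add_pos_nonneg)

lemma lg_add_le:
  assumes "0 \<le> v" "0 \<le> w"
  shows "lg (v + w) \<le> lg v + lg w"
proof -
  define e where "e = exp (1::real)"
  have e: "1 \<le> e" using exp1_bounds by (simp add: e_def)
  have "1 * e + 1 * v + 1 * w + 0 \<le> e * e + e * v + e * w + v * w"
    using assms e by (intro add_mono mult_right_mono mult_nonneg_nonneg) auto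
  also have "\<dots> = (e + v) * (e + w)" by (simp add: algebra_simps)
  finally have "exp 1 + (v + w) \<le> (exp 1 + v) * (exp 1 + w)" by (simp add: e_def)
  then have "lg (v + w) \<le> ln ((exp 1 + v) * (exp 1 + w))"
    unfolding lg_def using assms by (subst ln_le_cancel_iff) (auto simp: add_pos_nonneg)
  also have "\<dots> = lg v + lg w" unfolding lg_def using assms
    by (intro ln_mult_pos) (auto simp: add_pos_nonneg)
  finally show ?thesis .
qed

lemma lg_le_sqrt:
  assumes "0 \<le> v"
  shows "lg v \<le> 2 * sqrt (exp 1 + v)"
proof -
  have p: "0 < sqrt (exp 1 + v)" using assms by (simp add: add_pos_nonneg)
  have "lg v = 2 * ln (sqrt (exp 1 + v))" unfolding lg_def using assms by (simp add: ln_sqrt add_pos_nonneg)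
  also have "ln (sqrt (exp 1 + v)) \<le> sqrt (exp 1 + v)" using ln_le_minus_one[OF p] by simp
  finally show ?thesis by simp
qed

definition node_sq :: "real \<Rightarrow> real \<Rightarrow> real" where
  "node_sq \<gamma> v = v / lg v powr \<gamma>"

text \<open>Mean value theorem: the derivative of \<open>v / (lg v) powr \<gamma>\<close> is \<open>(lg v) powr (- \<gamma>)\<close> times
  \<open>1 - \<gamma> v / ((e + v) lg v)\<close>, and the last factor is at least \<open>1/2\<close>.\<close>

lemma node_sq_diff:
  assumes \<gamma>: "0 \<le> \<gamma>" "\<gamma> \<le> 1" and mn: "0 \<le> m" "m \<le> n"
  shows "(n - m) / (2 * lg n powr \<gamma>) \<le> node_sq \<gamma> n - node_sq \<gamma> m"
proof (cases "m = n")
  case False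
  then have "m < n" using mn by simp
  have der: "(node_sq \<gamma> has_real_derivative lg v powr (- \<gamma>) * (1 - \<gamma> * (v / ((exp 1 + v) * lg v)))) (at v)"
    if "0 \<le> v" for v
  proof -
    define e where "e = exp (1::real)"
    have p: "0 < e + v" "0 < ln (e + v)"
      using that lg_ge_1[OF that] exp1_bounds by (auto simp: add_pos_nonneg lg_def e_def)
    have e: "node_sq \<gamma> = (\<lambda>v. v * ln (e + v) powr (- \<gamma>))"
      by (auto simp: node_sq_def lg_def powr_minus_divide e_def)
    have "((\<lambda>v. ln (e + v)) has_real_derivative 1 / (e + v)) (at v)"
      using p(1) by (auto intro!: derivative_eq_intros)
    from DERIV_mult[OF DERIV_ident DERIV_fun_powr[OF this p(2), of "- \<gamma>"]]
    have "((\<lambda>v. v * ln (e + v) powr (- \<gamma>)) has_real_derivative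
       ln (e + v) powr (- \<gamma>) + v * (- \<gamma> * ln (e + v) powr (- \<gamma> - 1) * (1 / (e + v)))) (at v)"
      by (simp add: mult_ac)
    moreover have "ln (e + v) powr (- \<gamma> - 1) = ln (e + v) powr (- \<gamma>) / ln (e + v)"
      using p by (simp add: powr_diff)
    ultimately show ?thesis unfolding e lg_def e_def[symmetric] by (simp add: algebra_simps)
  qed
  obtain \<xi> where \<xi>: "m < \<xi>" "\<xi> < n" and eq: "node_sq \<gamma> n - node_sq \<gamma> m = (n - m) * (lg \<xi> powr (- \<gamma>) * (1 - \<gamma> * (\<xi> / ((exp 1 + \<xi>) * lg \<xi>))))"
    using MVT2[OF \<open>m < n\<close> der] mn by auto
  have \<xi>0: "0 \<le> \<xi>" using \<xi> mn by simp
  have l1: "1 \<le> lg \<xi>" by (rule lg_ge_1[OF \<xi>0])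
  \<comment> \<open>The left side equals \<open>1 - exp (1 - lg \<xi>)\<close>, hence is at most \<open>lg \<xi> - 1\<close> and at most 1, and so at most their mean.\<close>
  have "\<xi> / (exp 1 + \<xi>) \<le> lg \<xi> / 2"
  proof -
    have p: "0 < exp 1 + \<xi>" using \<xi>0 by (simp add: add_pos_nonneg)
    have "exp (1 - lg \<xi>) = exp 1 / (exp 1 + \<xi>)" using p by (simp add: exp_diff lg_def)
    moreover have "2 - lg \<xi> \<le> exp (1 - lg \<xi>)" using exp_ge_add_one_self[of "1 - lg \<xi>"] by simp
    moreover have "\<xi> / (exp 1 + \<xi>) = 1 - exp 1 / (exp 1 + \<xi>)" using p by (simp add: field_simps)
    moreover have "\<xi> / (exp 1 + \<xi>) \<le> 1" using p by simp
    ultimately show ?thesis by linarith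
  qed
  then have "\<xi> / (exp 1 + \<xi>) / lg \<xi> \<le> lg \<xi> / 2 / lg \<xi>" using l1 by (intro divide_right_mono) auto
  then have "\<xi> / ((exp 1 + \<xi>) * lg \<xi>) \<le> 1 / 2" using l1 by simp
  moreover have "0 \<le> \<xi> / ((exp 1 + \<xi>) * lg \<xi>)" using \<xi>0 l1 by simp
  ultimately have "\<gamma> * (\<xi> / ((exp 1 + \<xi>) * lg \<xi>)) \<le> 1 * (1/2)" using \<gamma> by (intro mult_mono) auto
  then have half: "1 / 2 \<le> 1 - \<gamma> * (\<xi> / ((exp 1 + \<xi>) * lg \<xi>))" by simp
  have "lg n powr (- \<gamma>) \<le> lg \<xi> powr (- \<gamma>)" using l1 \<gamma> lg_mono[of \<xi> n] \<xi> \<xi>0 by (intro powr_mono2') auto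
  then have "lg n powr (- \<gamma>) * (1 / 2) \<le> lg \<xi> powr (- \<gamma>) * (1 - \<gamma> * (\<xi> / ((exp 1 + \<xi>) * lg \<xi>)))"
    using half by (intro mult_mono) auto
  then have "(n - m) * (lg n powr (- \<gamma>) * (1 / 2)) \<le> node_sq \<gamma> n - node_sq \<gamma> m"
    unfolding eq using mn by (intro mult_left_mono) auto
  then show ?thesis by (simp add: powr_minus_divide)
qed (use assms in auto)

lemma node_star_nonneg: "0 \<le> node_star \<beta> i"
  by (auto simp: node_star_def node_def split: nat.split)

lemma node_star_sq:
  "(node_star \<beta> 0)\<^sup>2 = 1 / 4" "(node_star \<beta> (Suc n))\<^sup>2 = node_sq (2 * \<beta>) n"
proof -
  show "(node_star \<beta> 0)\<^sup>2 = 1 / 4" by (simp add: node_star_def power2_eq_square)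
  have "(lg n powr \<beta>)\<^sup>2 = lg n powr (2 * \<beta>)" for n
    by (simp add: power2_eq_square flip: powr_add)
  then show "(node_star \<beta> (Suc n))\<^sup>2 = node_sq (2 * \<beta>) n"
    by (simp add: node_star_def node_def node_sq_def power_divide lg_def)
qed

text \<open>The estimates depend on the exponent only through \<open>\<gamma> = 2 \<beta>\<close>, the exponent of the logarithm in the squares of the nodes.\<close>

locale nodes =
  fixes \<beta> :: real
  assumes \<beta>: "0 \<le> \<beta>" "\<beta> \<le> 1 / 2"
begin

definition \<gamma> :: real where "\<gamma> = 2 * \<beta>"

lemma \<gamma>: "0 \<le> \<gamma>" "\<gamma> \<le> 1" using \<beta> by (auto simp: \<gamma>_def)

abbreviation x :: "nat \<Rightarrow> real" where "x \<equiv> node_star \<beta>"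

lemma x_nonneg: "0 \<le> x i" by (rule node_star_nonneg)

lemma x_sq: "(x 0)\<^sup>2 = 1 / 4" "(x (Suc n))\<^sup>2 = node_sq \<gamma> n"
  unfolding \<gamma>_def by (rule node_star_sq)+

lemma lg_powr: "1 \<le> lg (real i) powr \<gamma>" "lg (real i) powr \<gamma> \<le> lg (real i)"
proof -
  have 1: "1 \<le> lg (real i)" by (rule lg_ge_1) simp
  then show "1 \<le> lg (real i) powr \<gamma>" using \<gamma> by (simp add: ge_one_powr_ge_zero)
  have "lg (real i) powr \<gamma> \<le> lg (real i) powr 1" using 1 \<gamma> by (intro powr_mono) auto
  then show "lg (real i) powr \<gamma> \<le> lg (real i)" using 1 by simp
qed

lemma lg_powr_mono: "i \<le> j \<Longrightarrow> lg (real i) powr \<gamma> \<le> lg (real j) powr \<gamma>"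
  using \<gamma> lg_ge_1[of "real i"] by (intro powr_mono2 lg_mono) auto

text \<open>For the nodes proper this is the increment bound. The additional node \<open>1/2\<close>, with index 0, has square \<open>1/4\<close>, whereas the
  squares of the others are 0 and then at least \<open>2/3\<close>.\<close>

lemma separation_less:
  assumes "i < j"
  shows "(real j - real i) / (4 * lg (real j) powr \<gamma>) \<le> \<bar>(x j)\<^sup>2 - (x i)\<^sup>2\<bar>"
proof -
  obtain n where j: "j = Suc n" using assms by (cases j) auto
  note L = lg_powr(1)[of j] lg_powr(1)[of n] lg_powr_mono[of n j, unfolded j]
  show ?thesis
  proof (cases i)
    case (Suc m)
    then have mn: "m \<le> n" using assms j by simp
    have "(real j - real i) / (4 * lg (real j) powr \<gamma>) \<le> (real n - real m) / (2 * lg (real n) powr \<gamma>)"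
      using mn L unfolding j Suc by (intro frac_le) auto
    also have "\<dots> \<le> node_sq \<gamma> n - node_sq \<gamma> m" using \<gamma> mn by (intro node_sq_diff) auto
    finally show ?thesis by (simp add: j Suc x_sq)
  next
    case 0
    show ?thesis
    proof (cases "n = 0")
      case True
      have "1 / (4 * lg (real j) powr \<gamma>) \<le> 1 / (4 * 1)" using L by (intro divide_left_mono) auto
      then show ?thesis using True by (simp add: 0 j x_sq node_sq_def)
    next
      case False
      have "lg 1 \<le> 3 / 2"
      proof -
        have "lg 1 = ln (exp 1 * (1 + exp (- 1)))" by (simp add: lg_def algebra_simps flip: exp_add)
        also have "\<dots> = 1 + ln (1 + exp (- 1))" by (subst ln_mult_pos) (auto simp: add_pos_pos)
        also have "ln (1 + exp (- 1)) \<le> exp (- 1 :: real)" by (intro ln_add_one_self_le_self) simp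
        also have "exp (- 1 :: real) \<le> 1 / 2" using exp1_bounds by (simp add: exp_minus field_simps)
        finally show ?thesis by simp
      qed
      then have "lg (real 1) powr \<gamma> \<le> 3 / 2" using lg_powr(2)[of 1] by simp
      then have "1 / (3 / 2) \<le> 1 / lg (real 1) powr \<gamma>" using lg_powr(1)[of 1] by (intro divide_left_mono) auto
      then have f1: "2 / 3 \<le> node_sq \<gamma> 1" by (simp add: node_sq_def)
      have "(real n - 1) / (2 * lg (real n) powr \<gamma>) \<le> node_sq \<gamma> n - node_sq \<gamma> 1"
        using False \<gamma> by (intro node_sq_diff) auto
      moreover have "0 \<le> (real n - 1) / (2 * lg (real n) powr \<gamma>)" using False L by simp
      ultimately have "2 / 3 \<le> node_sq \<gamma> n" using f1 by linarith
      then have "node_sq \<gamma> n / 2 \<le> node_sq \<gamma> n - 1 / 4" by simp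
      moreover have "(real n + 1) / (4 * lg (real j) powr \<gamma>) \<le> (2 * real n) / (4 * lg (real n) powr \<gamma>)"
        using False L unfolding j by (intro frac_le) auto
      then have "(real n + 1) / (4 * lg (real j) powr \<gamma>) \<le> node_sq \<gamma> n / 2" by (simp add: node_sq_def)
      ultimately have "(real n + 1) / (4 * lg (real j) powr \<gamma>) \<le> node_sq \<gamma> n - 1 / 4" by linarith
      also have "\<dots> \<le> \<bar>node_sq \<gamma> n - 1 / 4\<bar>" by simp
      finally show ?thesis by (simp add: 0 j x_sq add.commute)
    qed
  qed
qed

lemma separation:
  "\<bar>real i - real j\<bar> / (4 * lg (real (max i j)) powr \<gamma>) \<le> \<bar>(x i)\<^sup>2 - (x j)\<^sup>2\<bar>"
proof (cases i j rule: linorder_cases)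
  case less
  then show ?thesis using separation_less[OF less] by (simp add: max_def abs_minus_commute)
next
  case greater
  then show ?thesis using separation_less[OF greater] by (simp add: max_def)
qed simp

lemma x_sq_le:
  assumes "i \<le> M"
  shows "(x i)\<^sup>2 \<le> (1 + real M) / lg (real M) powr \<gamma>"
proof (cases i)
  case 0
  have "lg (real M) \<le> 1 + real M"
  proof -
    have "exp 1 + real M \<le> exp 1 * (1 + real M)" using exp1_bounds mult_right_mono[of 1 "exp 1" "real M"] by (simp add: algebra_simps)
    then have "lg (real M) \<le> ln (exp 1 * (1 + real M))" unfolding lg_def by (subst ln_le_cancel_iff) (auto simp: add_pos_nonneg)
    also have "\<dots> = 1 + ln (1 + real M)" by (subst ln_mult_pos) auto
    also have "ln (1 + real M) \<le> real M" by (rule ln_add_one_self_le_self) simp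
    finally show ?thesis by simp
  qed
  then have "1 \<le> (1 + real M) / lg (real M) powr \<gamma>" using lg_powr[of M] by (simp add: le_divide_eq)
  then show ?thesis unfolding 0 x_sq by linarith
next
  case (Suc m)
  have "node_sq \<gamma> m \<le> node_sq \<gamma> M"
  proof -
    have "(real M - real m) / (2 * lg (real M) powr \<gamma>) \<le> node_sq \<gamma> M - node_sq \<gamma> m"
      using assms Suc \<gamma> by (intro node_sq_diff) auto
    moreover have "0 \<le> (real M - real m) / (2 * lg (real M) powr \<gamma>)" using assms Suc by simp
    ultimately show ?thesis by linarith
  qed
  also have "\<dots> \<le> (1 + real M) / lg (real M) powr \<gamma>" unfolding node_sq_def by (intro divide_right_mono) auto
  finally show ?thesis by (simp add: Suc x_sq)
qed

lemma x_sq_ge: "(1 + real i) / (2 * lg (real i) powr \<gamma>) \<le> (x i)\<^sup>2 + 1"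
proof (cases i)
  case 0
  have "1 / (2 * lg (real i) powr \<gamma>) \<le> 1 / (2 * 1)" using lg_powr[of i] by (intro divide_left_mono) auto
  then show ?thesis unfolding 0 x_sq by simp
next
  case (Suc m)
  note L = lg_powr(1)[of i] lg_powr(1)[of m] lg_powr_mono[of m i, unfolded Suc]
  have "(1 + real i) / (2 * lg (real i) powr \<gamma>) = (real m / 2) / lg (real i) powr \<gamma> + 1 / lg (real i) powr \<gamma>"
    by (simp add: Suc add_divide_distrib)
  also have "\<dots> \<le> real m / lg (real m) powr \<gamma> + 1 / 1"
    using L unfolding Suc by (intro add_mono frac_le) auto
  finally show ?thesis by (simp add: Suc x_sq node_sq_def)
qed

lemma lg_index_le: "lg (real i) \<le> 24 * lg ((x i)\<^sup>2)"
proof -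
  define q where "q = sqrt (exp 1 + real i)"
  have q0: "0 < q" by (simp add: q_def add_pos_nonneg)
  have q2: "q * q = exp 1 + real i" by (simp add: q_def)
  have "lg (real i) powr \<gamma> \<le> 2 * q" using lg_powr(2)[of i] lg_le_sqrt[of "real i"] by (simp add: q_def)
  then have "(1 + real i) / (2 * (2 * q)) \<le> (1 + real i) / (2 * lg (real i) powr \<gamma>)"
    using lg_powr(1)[of i] q0 by (intro divide_left_mono mult_pos_pos) auto
  also have "\<dots> \<le> (x i)\<^sup>2 + 1" by (rule x_sq_ge)
  finally have "1 + real i \<le> ((x i)\<^sup>2 + 1) * (4 * q)" using q0 by (simp add: divide_le_eq)
  also have "\<dots> = 4 * (((x i)\<^sup>2 + 1) * q)" by simp
  finally have a: "1 + real i \<le> 4 * (((x i)\<^sup>2 + 1) * q)" .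
  have "q * q \<le> 3 * (1 + real i)" unfolding q2 using exp1_bounds by simp
  also have "\<dots> \<le> 3 * (4 * (((x i)\<^sup>2 + 1) * q))" by (rule mult_left_mono[OF a]) simp
  also have "\<dots> = (12 * ((x i)\<^sup>2 + 1)) * q" by simp
  finally have "q * q \<le> (12 * ((x i)\<^sup>2 + 1)) * q" .
  then have "q \<le> 12 * ((x i)\<^sup>2 + 1)" using q0 by simp
  also have "\<dots> \<le> 12 * (exp 1 + (x i)\<^sup>2)" using exp1_bounds by simp
  finally have "ln q \<le> ln (12 * (exp 1 + (x i)\<^sup>2))" using q0 by (subst ln_le_cancel_iff) (auto simp: add_pos_nonneg)
  also have "\<dots> = ln 12 + lg ((x i)\<^sup>2)" unfolding lg_def by (rule ln_mult_pos) (auto simp: add_pos_nonneg)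
  also have "ln 12 \<le> (12 - 1 :: real)" by (rule ln_le_minus_one) simp
  also have "12 - 1 \<le> 11 * lg ((x i)\<^sup>2)" using lg_ge_1[of "(x i)\<^sup>2"] by simp
  finally have "ln q \<le> 12 * lg ((x i)\<^sup>2)" by simp
  moreover have "lg (real i) = 2 * ln q" unfolding q_def lg_def by (simp add: ln_sqrt add_pos_nonneg)
  ultimately show ?thesis by simp
qed

lemma lg_x_sq_le: "ln (exp 2 + (x i)\<^sup>2) \<le> 4 * lg (real i)"
proof -
  have "(x i)\<^sup>2 \<le> (1 + real i) / lg (real i) powr \<gamma>" by (rule x_sq_le) simp
  also have "\<dots> \<le> (1 + real i) / 1" using lg_powr(1)[of i] by (intro divide_left_mono) auto
  finally have u: "(x i)\<^sup>2 \<le> 1 + real i" by simp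
  have e2: "exp (2::real) = exp 1 * exp 1" by (simp flip: exp_add)
  have "exp 2 + (x i)\<^sup>2 \<le> (exp 1 + real i) ^ 4"
  proof -
    define e where "e = exp (1::real)"
    have e: "2 \<le> e" using exp1_bounds by (simp add: e_def)
    have "exp 2 + (x i)\<^sup>2 \<le> (e + real i) ^ 2 + (e + real i)"
    proof -
      have "0 \<le> real i * real i + e * (real i * 2)" using e by simp
      moreover have "(e + real i) ^ 2 = e * e + (real i * real i + e * (real i * 2))"
        by (simp add: power2_eq_square algebra_simps)
      ultimately show ?thesis using u e unfolding e2 e_def[symmetric] by linarith
    qed
    also have "\<dots> \<le> (e + real i) ^ 2 + (e + real i) ^ 2" using e by (simp add: power2_eq_square mult_left_le)
    also have "\<dots> = 2 * (e + real i) ^ 2" by simp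
    also have "\<dots> \<le> (e + real i) ^ 2 * (e + real i) ^ 2"
    proof (rule mult_right_mono)
      have "2 * 1 \<le> (e + real i) * (e + real i)" using e by (intro mult_mono) auto
      then show "2 \<le> (e + real i)\<^sup>2" by (simp add: power2_eq_square)
    qed auto
    finally show ?thesis by (simp add: e_def flip: power_add)
  qed
  moreover have p: "0 < exp 1 + real i" "0 < exp 2 + (x i)\<^sup>2" by (auto simp: add_pos_nonneg)
  ultimately have "ln (exp 2 + (x i)\<^sup>2) \<le> ln ((exp 1 + real i) ^ 4)" by (subst ln_le_cancel_iff) auto
  also have "\<dots> = 4 * lg (real i)" unfolding lg_def using p by (subst ln_realpow) auto
  finally show ?thesis .
qed

end

lemma sum_distance_le:
  fixes f :: "nat \<Rightarrow> real"
  assumes "\<And>n. 0 \<le> f n" "i < N"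
  shows "(\<Sum>j<N. f (if j \<le> i then i - j else j - i)) \<le> 2 * (\<Sum>n<N. f n)"
proof -
  have "(\<Sum>j<N. f (if j \<le> i then i - j else j - i)) =
     (\<Sum>j\<in>{..i}. f (i - j)) + (\<Sum>j\<in>{i<..<N}. f (j - i))"
  proof -
    have eq: "{..<N} = {..i} \<union> {i<..<N}" using assms(2) by auto
    have "(\<Sum>j<N. f (if j \<le> i then i - j else j - i)) =
       (\<Sum>j\<in>{..i}. f (if j \<le> i then i - j else j - i)) + (\<Sum>j\<in>{i<..<N}. f (if j \<le> i then i - j else j - i))"
      unfolding eq by (rule sum.union_disjoint) auto
    also have "(\<Sum>j\<in>{..i}. f (if j \<le> i then i - j else j - i)) = (\<Sum>j\<in>{..i}. f (i - j))"
      by (rule sum.cong) auto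
    also have "(\<Sum>j\<in>{i<..<N}. f (if j \<le> i then i - j else j - i)) = (\<Sum>j\<in>{i<..<N}. f (j - i))"
      by (rule sum.cong) auto
    finally show ?thesis .
  qed
  also have "(\<Sum>j\<in>{..i}. f (i - j)) = sum f ((\<lambda>j. i - j) ` {..i})"
    by (subst sum.reindex) (auto simp: inj_on_def)
  also have "\<dots> \<le> (\<Sum>n<N. f n)" using assms by (intro sum_mono2) auto
  also have "(\<Sum>j\<in>{i<..<N}. f (j - i)) = sum f ((\<lambda>j. j - i) ` {i<..<N})"
    by (subst sum.reindex) (auto simp: inj_on_def)
  also have "\<dots> \<le> (\<Sum>n<N. f n)" using assms by (intro sum_mono2) auto
  finally show ?thesis by simp
qed

section \<open>The Gaussian part off the diagonal, and the diagonal\<close>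

text \<open>Schur's test in weighted form: each row enters only with its own sum.\<close>

lemma schur_symmetric:
  fixes A :: "'i \<Rightarrow> 'i \<Rightarrow> real"
  assumes "finite I" "\<And>i j. i \<in> I \<Longrightarrow> j \<in> I \<Longrightarrow> 0 \<le> A i j" "\<And>i j. i \<in> I \<Longrightarrow> j \<in> I \<Longrightarrow> A i j = A j i"
    and row: "\<And>i. i \<in> I \<Longrightarrow> (\<Sum>j\<in>I. A i j) \<le> R i"
  shows "(\<Sum>i\<in>I. \<Sum>j\<in>I. A i j * (\<bar>b i\<bar> * \<bar>b j\<bar>)) \<le> (\<Sum>i\<in>I. R i * (b i)\<^sup>2)"
proof -
  have "(\<Sum>i\<in>I. \<Sum>j\<in>I. A i j * (\<bar>b i\<bar> * \<bar>b j\<bar>)) \<le> (\<Sum>i\<in>I. \<Sum>j\<in>I. (A i j * (b i)\<^sup>2 + A i j * (b j)\<^sup>2) / 2)"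
  proof (intro sum_mono)
    fix i j assume "i \<in> I" "j \<in> I"
    have "\<bar>b i\<bar> * \<bar>b j\<bar> \<le> ((b i)\<^sup>2 + (b j)\<^sup>2) / 2"
      using sum_squares_bound[of "\<bar>b i\<bar>" "\<bar>b j\<bar>"] by simp
    then have "A i j * (\<bar>b i\<bar> * \<bar>b j\<bar>) \<le> A i j * (((b i)\<^sup>2 + (b j)\<^sup>2) / 2)"
      using assms \<open>i \<in> I\<close> \<open>j \<in> I\<close> by (intro mult_left_mono) auto
    then show "A i j * (\<bar>b i\<bar> * \<bar>b j\<bar>) \<le> (A i j * (b i)\<^sup>2 + A i j * (b j)\<^sup>2) / 2"
      by (simp add: algebra_simps)
  qed
  also have "\<dots> = ((\<Sum>i\<in>I. \<Sum>j\<in>I. A i j * (b i)\<^sup>2) + (\<Sum>i\<in>I. \<Sum>j\<in>I. A i j * (b j)\<^sup>2)) / 2"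
    by (simp add: sum.distrib add_divide_distrib sum_divide_distrib)
  also have "(\<Sum>i\<in>I. \<Sum>j\<in>I. A i j * (b j)\<^sup>2) = (\<Sum>i\<in>I. \<Sum>j\<in>I. A i j * (b i)\<^sup>2)"
    by (subst sum.swap) (intro sum.cong refl, use assms in simp)
  also have "((\<Sum>i\<in>I. \<Sum>j\<in>I. A i j * (b i)\<^sup>2) + (\<Sum>i\<in>I. \<Sum>j\<in>I. A i j * (b i)\<^sup>2)) / 2 = (\<Sum>i\<in>I. (\<Sum>j\<in>I. A i j) * (b i)\<^sup>2)"
    by (simp add: sum_distrib_right)
  also have "\<dots> \<le> (\<Sum>i\<in>I. R i * (b i)\<^sup>2)"
    by (intro sum_mono mult_right_mono row) auto
  finally show ?thesis .
qed

lemma sum_inverse_sqrt_le: "(\<Sum>n=1..K. 1 / sqrt (real n)) \<le> 2 * sqrt (real K)"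
proof (induction K)
  case (Suc K)
  define p q where "p = sqrt (real K)" and "q = sqrt (real (Suc K))"
  have pq: "0 \<le> p" "0 < q" "p \<le> q" "q * q - p * p = 1" by (auto simp: p_def q_def)
  have "1 = (q - p) * (q + p)" using pq by (simp add: algebra_simps)
  also have "\<dots> \<le> (q - p) * (q + q)" using pq by (intro mult_left_mono) auto
  also have "\<dots> = 2 * (q - p) * q" by simp
  finally have "1 / q \<le> 2 * (q - p)" using pq(2) by (simp only: pos_divide_le_eq)
  then show ?case using Suc by (simp add: p_def q_def)
qed simp

lemma sum_inverse_squares_le:
  assumes "1 \<le> K"
  shows "(\<Sum>n\<in>{K<..N}. 1 / (real n)\<^sup>2) \<le> 1 / real K"
proof (cases "K \<le> N")
  case True
  have "(\<Sum>n\<in>{K<..N}. 1 / (real n)\<^sup>2) \<le> 1 / real K - 1 / real N"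
    using True
  proof (induction N rule: dec_induct)
    case (step N)
    have "1 / (real (Suc N))\<^sup>2 \<le> 1 / (real N * real (Suc N))"
      using step assms by (intro divide_left_mono) (auto simp: power2_eq_square)
    also have "\<dots> = 1 / real N - 1 / real (Suc N)" using step assms by (simp add: field_simps)
    finally have "1 / (real (Suc N))\<^sup>2 \<le> 1 / real N - 1 / real (Suc N)" .
    moreover have "{K<..Suc N} = insert (Suc N) {K<..N}" using step by auto
    ultimately show ?case using step.IH by simp
  qed simp
  moreover have "0 \<le> 1 / real N" by simp
  ultimately show ?thesis by linarith
qed simp

lemma summable_lg_over_square: "summable (\<lambda>n. lg (real n) / (real n)\<^sup>2)"
proof (rule summable_comparison_test')
  show "summable (\<lambda>n. 4 * real n powr (- 3/2))" by (intro summable_mult) (simp add: summable_real_powr_iff)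
  fix n :: nat assume "1 \<le> n"
  then have n: "1 \<le> real n" by simp
  have "lg (real n) \<le> 2 * sqrt (exp 1 + real n)" by (rule lg_le_sqrt) simp
  also have "\<dots> \<le> 2 * sqrt (4 * real n)" using exp1_bounds n by simp
  also have "\<dots> = 4 * sqrt (real n)" by (simp add: real_sqrt_mult)
  finally have "lg (real n) / (real n)\<^sup>2 \<le> 4 * sqrt (real n) / (real n)\<^sup>2" by (intro divide_right_mono) auto
  also have "\<dots> = 4 * (real n powr (1/2) * real n powr (- 2))"
    using n by (simp add: powr_half_sqrt powr_minus_divide powr_numeral)
  also have "\<dots> = 4 * real n powr (- 3/2)" by (simp flip: powr_add)
  finally show "norm (lg (real n) / (real n)\<^sup>2) \<le> 4 * real n powr (- 3/2)"
    using lg_ge_1[of "real n"] by simp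
qed

text \<open>The bound for the entries of the Gaussian part after removal of the weights: \<open>1 / L\<close> times the smaller of
  \<open>(L / n) powr (1/2)\<close> and \<open>(L / n) powr 2\<close>, where \<open>n / L\<close> is a lower bound, up to a constant, for the distance of the squares of the nodes.\<close>

definition near_diag :: "nat \<Rightarrow> nat \<Rightarrow> real" where
  "near_diag i j = (if i = j then 0 else
     (let L = lg (real (max i j)); n = \<bar>real i - real j\<bar> in min (1 / sqrt (L * n)) (L / n\<^sup>2)))"

text \<open>About \<open>L = lg i\<close> neighbours lie within distance 1 in the squared variable, and each contributes about \<open>1 / L\<close>. The
  square-root bound is summed for \<open>n \<le> L\<close> and the quadratic one for \<open>n > L\<close>. To the right of the diagonal \<open>lg (max i j)\<close> grows
  with \<open>n\<close>, but \<open>lg (i + n) \<le> lg i + lg n\<close>, and \<open>lg n / n\<^sup>2\<close> is summable.\<close>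

lemma near_diag_row_sum:
  obtains C where "0 < C" "\<And>i N. i < N \<Longrightarrow> (\<Sum>j<N. near_diag i j) \<le> C"
proof -
  define S where "S = (\<Sum>n. lg (real n) / (real n)\<^sup>2)"
  have lgn: "0 \<le> lg (real n) / (real n)\<^sup>2" for n using lg_ge_1[of "real n"] by simp
  have S0: "0 \<le> S" unfolding S_def by (rule suminf_nonneg[OF summable_lg_over_square lgn])
  have bound: "(\<Sum>j<N. near_diag i j) \<le> 2 * (4 + S)" if iN: "i < N" for i N
  proof -
    define L where "L = lg (real i)"
    have L1: "1 \<le> L" unfolding L_def by (rule lg_ge_1) simp
    define K where "K = nat \<lfloor>L\<rfloor>"
    have rK: "real K = of_int \<lfloor>L\<rfloor>" using L1 by (simp add: K_def)
    have K: "1 \<le> K" "real K \<le> L" "L < real K + 1"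
    proof -
      have "1 \<le> \<lfloor>L\<rfloor>" using L1 by (simp add: le_floor_iff)
      then have "1 \<le> real K" unfolding rK by (simp only: of_int_1_le_iff)
      then show "1 \<le> K" by simp
      show "real K \<le> L" "L < real K + 1" unfolding rK by linarith+
    qed
    define f where "f n = (if n = 0 then 0 else if n \<le> K then 1 / sqrt L * (1 / sqrt (real n)) else 0) +
        (if K < n then L * (1 / (real n)\<^sup>2) else 0) + lg (real n) / (real n)\<^sup>2" for n :: nat
    have f0: "0 \<le> f n" for n
      unfolding f_def using L1 lgn[of n] by (intro add_nonneg_nonneg) auto
    have "near_diag i j \<le> f (if j \<le> i then i - j else j - i)" for j
    proof (cases "i = j")
      case True
      then show ?thesis using f0[of 0] by (simp add: near_diag_def)
    next
      case False
      define n where "n = (if j \<le> i then i - j else j - i)"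
      define M where "M = lg (real (max i j))"
      have n: "1 \<le> n" "\<bar>real i - real j\<bar> = real n" using False by (auto simp: n_def)
      have nd: "near_diag i j = min (1 / sqrt (M * real n)) (M / (real n)\<^sup>2)"
        using False by (simp add: near_diag_def M_def Let_def n)
      have M1: "L \<le> M" unfolding L_def M_def by (intro lg_mono) auto
      have "M \<le> lg (real i + real n)" unfolding M_def n_def by (intro lg_mono) auto
      also have "\<dots> \<le> L + lg (real n)" unfolding L_def by (rule lg_add_le) auto
      finally have M2: "M \<le> L + lg (real n)" .
      have "near_diag i j \<le> f n"
      proof (cases "n \<le> K")
        case True
        have "near_diag i j \<le> 1 / sqrt (M * real n)" by (simp add: nd)
        also have "\<dots> \<le> 1 / sqrt (L * real n)" using M1 L1 n by (intro divide_left_mono real_sqrt_le_mono mult_right_mono) auto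
        also have "\<dots> \<le> f n" using True n lgn[of n] by (simp add: f_def real_sqrt_mult)
        finally show ?thesis .
      next
        case False
        have "near_diag i j \<le> M / (real n)\<^sup>2" by (simp add: nd)
        also have "\<dots> \<le> (L + lg (real n)) / (real n)\<^sup>2" using M2 by (intro divide_right_mono) auto
        also have "\<dots> = f n" using False n by (simp add: f_def add_divide_distrib)
        finally show ?thesis .
      qed
      then show ?thesis by (simp add: n_def)
    qed
    then have "(\<Sum>j<N. near_diag i j) \<le> (\<Sum>j<N. f (if j \<le> i then i - j else j - i))" by (rule sum_mono)
    also have "\<dots> \<le> 2 * (\<Sum>n<N. f n)" by (rule sum_distance_le[OF f0 iN])
    also have "(\<Sum>n<N. f n) \<le> 2 + 2 + S"
      unfolding f_def sum.distrib
    proof (intro add_mono)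
      have "(\<Sum>n<N. if n = 0 then 0 else if n \<le> K then 1 / sqrt L * (1 / sqrt (real n)) else 0)
         = (\<Sum>n\<in>{1..K} \<inter> {..<N}. 1 / sqrt L * (1 / sqrt (real n)))"
        by (rule sum.mono_neutral_cong_right) auto
      also have "\<dots> \<le> (\<Sum>n\<in>{1..K}. 1 / sqrt L * (1 / sqrt (real n)))" using L1 by (intro sum_mono2) auto
      also have "\<dots> = 1 / sqrt L * (\<Sum>n=1..K. 1 / sqrt (real n))" by (simp add: sum_distrib_left)
      also have "\<dots> \<le> 1 / sqrt L * (2 * sqrt (real K))" using L1 by (intro mult_left_mono sum_inverse_sqrt_le) auto
      also have "\<dots> \<le> 1 / sqrt L * (2 * sqrt L)" using L1 K by (intro mult_left_mono) auto
      also have "\<dots> = 2" using L1 by simp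
      finally show "(\<Sum>n<N. if n = 0 then 0 else if n \<le> K then 1 / sqrt L * (1 / sqrt (real n)) else 0) \<le> 2" .
      have "(\<Sum>n<N. if K < n then L * (1 / (real n)\<^sup>2) else 0) = (\<Sum>n\<in>{K<..N} \<inter> {..<N}. L * (1 / (real n)\<^sup>2))"
        by (rule sum.mono_neutral_cong_right) auto
      also have "\<dots> \<le> (\<Sum>n\<in>{K<..N}. L * (1 / (real n)\<^sup>2))" using L1 by (intro sum_mono2) auto
      also have "\<dots> = L * (\<Sum>n\<in>{K<..N}. 1 / (real n)\<^sup>2)" by (simp add: sum_distrib_left)
      also have "\<dots> \<le> L * (1 / real K)" using L1 by (intro mult_left_mono sum_inverse_squares_le K) auto
      also have "\<dots> \<le> 2" using K by (simp add: divide_le_eq)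
      finally show "(\<Sum>n<N. if K < n then L * (1 / (real n)\<^sup>2) else 0) \<le> 2" .
      show "(\<Sum>n<N. lg (real n) / (real n)\<^sup>2) \<le> S"
        unfolding S_def by (intro sum_le_suminf summable_lg_over_square) (use lgn in auto)
    qed
    finally show ?thesis by simp
  qed
  show ?thesis by (rule that[of "2 * (4 + S)"]) (use S0 bound in auto)
qed

text \<open>The exponents \<open>p = 1/4\<close> and \<open>p = 1\<close> in \<open>kernel_P_le\<close> give the two bounds in \<open>near_diag\<close>. The separation
  enters with exponent 1 of the logarithm, the worst case, which covers all \<open>\<beta> \<le> 1/2\<close>.\<close>

lemma kernel_P_form_le:
  obtains C where "0 < C"
    "\<And>\<beta> \<eta> N c. 0 \<le> \<beta> \<Longrightarrow> \<beta> \<le> 1/2 \<Longrightarrow> 0 < \<eta> \<Longrightarrow> \<eta> \<le> 1 \<Longrightarrow>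
       (\<Sum>i<N. \<Sum>j<N. (if i = j then 0 else kernel_P \<eta> (node_star \<beta> i) (node_star \<beta> j)) * (\<bar>c i\<bar> * \<bar>c j\<bar>))
         \<le> C * (\<Sum>i<N. lg (real i) powr (- \<eta>) * (c i)\<^sup>2)"
proof -
  obtain C1 where C1: "0 < C1" and P1: "\<And>\<eta> x y. 0 < \<eta> \<Longrightarrow> \<eta> \<le> 1 \<Longrightarrow> 0 \<le> x \<Longrightarrow> 0 \<le> y \<Longrightarrow> x \<noteq> y \<Longrightarrow>
       kernel_P \<eta> x y \<le> C1 * (ln (exp 1 + (x + y)\<^sup>2) powr (- (1 + \<eta>)) * (x\<^sup>2 - y\<^sup>2)\<^sup>2 powr (- (1/4)))"
    using kernel_P_le[of "1/4"] by auto
  obtain C2 where C2: "0 < C2" and P2: "\<And>\<eta> x y. 0 < \<eta> \<Longrightarrow> \<eta> \<le> 1 \<Longrightarrow> 0 \<le> x \<Longrightarrow> 0 \<le> y \<Longrightarrow> x \<noteq> y \<Longrightarrow>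
       kernel_P \<eta> x y \<le> C2 * (ln (exp 1 + (x + y)\<^sup>2) powr (- (1 + \<eta>)) * (x\<^sup>2 - y\<^sup>2)\<^sup>2 powr (- 1))"
    using kernel_P_le[of "1"] by auto
  obtain C3 where C3: "0 < C3" and row: "\<And>i N. i < N \<Longrightarrow> (\<Sum>j<N. near_diag i j) \<le> C3"
    using near_diag_row_sum by blast
  \<comment> \<open>The factor \<open>576 = 24\<^sup>2\<close> comes from \<open>lg_index_le\<close>; 2 and 16 are \<open>4 powr (1/2)\<close> and \<open>4\<^sup>2\<close>, the 4 being that of the separation.\<close>
  define C0 where "C0 = 576 * (2 * C1 + 16 * C2)"
  have C0: "0 < C0" using C1 C2 by (simp add: C0_def)
  show ?thesis
  proof (rule that[of "C0 * C3"])
    show "0 < C0 * C3" using C0 C3 by simp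
    fix \<beta> \<eta> :: real and N :: nat and c :: "nat \<Rightarrow> real"
    assume h: "0 \<le> \<beta>" "\<beta> \<le> 1/2" and \<eta>: "0 < \<eta>" "\<eta> \<le> 1"
    interpret nodes \<beta> by unfold_locales (use h in auto)
    define w where "w i = lg (real i) powr (- \<eta> / 2)" for i :: nat
    have w0: "0 \<le> w i" for i by (simp add: w_def)
    have entry: "kernel_P \<eta> (x i) (x j) \<le> C0 * (w i * w j * near_diag i j)" if ij: "i \<noteq> j" for i j
    proof -
      define M where "M = lg (real (max i j))"
      define n where "n = \<bar>real i - real j\<bar>"
      have n: "0 < n" using ij by (simp add: n_def)
      have M1: "1 \<le> M" unfolding M_def by (rule lg_ge_1) simp
      define D where "D = (x i)\<^sup>2 - (x j)\<^sup>2"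
      have "n / (4 * M) \<le> n / (4 * lg (real (max i j)) powr \<gamma>)"
        using n lg_powr[of "max i j"] by (intro divide_left_mono) (auto simp: M_def)
      also have "\<dots> \<le> \<bar>D\<bar>" unfolding n_def D_def by (rule separation)
      finally have sep: "n / (4 * M) \<le> \<bar>D\<bar>" .
      have pos: "0 < n / (4 * M)" using n M1 by simp
      then have D0: "D \<noteq> 0" using sep by auto
      then have xij: "x i \<noteq> x j" by (auto simp: D_def)
      have "M / 24 \<le> lg ((x (max i j))\<^sup>2)" using lg_index_le[of "max i j"] by (simp add: M_def)
      also have "\<dots> \<le> lg ((x i + x j)\<^sup>2)"
        using x_nonneg[of i] x_nonneg[of j] by (intro lg_mono power_mono) (auto simp: max_def)
      finally have "M / 24 \<le> ln (exp 1 + (x i + x j)\<^sup>2)" by (simp add: lg_def)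
      then have "ln (exp 1 + (x i + x j)\<^sup>2) powr (- (1 + \<eta>)) \<le> (M / 24) powr (- (1 + \<eta>))"
        using M1 \<eta> by (intro powr_mono2') auto
      also have "\<dots> = M powr (- (1 + \<eta>)) * 24 powr (1 + \<eta>)"
        using M1 by (simp only: powr_divide[of M 24] powr_minus_divide) simp
      also have "\<dots> \<le> M powr (- (1 + \<eta>)) * 24 powr 2" using \<eta> by (intro mult_left_mono powr_mono) auto
      finally have lgb: "ln (exp 1 + (x i + x j)\<^sup>2) powr (- (1 + \<eta>)) \<le> M powr (- (1 + \<eta>)) * 576" by simp
      have powb: "(D\<^sup>2) powr (- p) \<le> ((4 * M / n) powr (2 * p))" if "0 < p" for p
      proof -
        have "(D\<^sup>2) powr (- p) = \<bar>D\<bar> powr (- (2 * p))"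
        proof -
          have "D\<^sup>2 = \<bar>D\<bar> powr 2" using D0 by (simp add: powr_numeral)
          moreover have "- (2 * p) = 2 * (- p)" by simp
          ultimately show ?thesis by (simp only: powr_powr)
        qed
        also have "\<dots> \<le> (n / (4 * M)) powr (- (2 * p))" using pos sep that by (intro powr_mono2') auto
        also have "\<dots> = (4 * M / n) powr (2 * p)"
          using n M1 by (simp add: powr_minus_divide powr_divide)
        finally show ?thesis .
      qed
      have b1: "(D\<^sup>2) powr (- (1/4)) \<le> 2 * (M * (1 / sqrt (M * n)))"
      proof -
        have "(4 * M / n) powr (2 * (1/4)) = sqrt (4 * M / n)" using n M1 by (simp add: powr_half_sqrt)
        also have "\<dots> = 2 * (sqrt M / sqrt n)" by (simp add: real_sqrt_mult real_sqrt_divide)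
        also have "sqrt M / sqrt n = M * (1 / sqrt (M * n))"
          using M1 n by (simp add: real_sqrt_mult field_simps)
        finally show ?thesis using powb[of "1/4"] by simp
      qed
      have b2: "(D\<^sup>2) powr (- 1) \<le> 16 * (M * (M / n\<^sup>2))"
      proof -
        have "(4 * M / n) powr (2 * 1) = 16 * (M * (M / n\<^sup>2))" using n M1
          by (simp add: powr_numeral power_divide power_mult_distrib power2_eq_square)
        then show ?thesis using powb[of 1] by simp
      qed
      have w: "M powr (- (1 + \<eta>)) * M \<le> w i * w j"
      proof -
        have "M powr (- (1 + \<eta>)) * M = M powr (- (1 + \<eta>)) * M powr 1" using M1 by simp
        also have "\<dots> = M powr (- (1 + \<eta>) + 1)" by (simp only: powr_add)
        also have "- (1 + \<eta>) + 1 = - \<eta> / 2 + - \<eta> / 2" by simp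
        also have "M powr (- \<eta> / 2 + - \<eta> / 2) = M powr (- \<eta> / 2) * M powr (- \<eta> / 2)" by (simp only: powr_add)
        also have "\<dots> \<le> w i * w j"
        proof -
          have "lg (real i) \<le> M" "lg (real j) \<le> M" unfolding M_def by (auto intro!: lg_mono)
          then have "M powr (- \<eta> / 2) \<le> w i" "M powr (- \<eta> / 2) \<le> w j"
            unfolding w_def using \<eta> lg_ge_1[of "real i"] lg_ge_1[of "real j"] by (auto intro!: powr_mono2')
          then show ?thesis using w0 by (intro mult_mono) auto
        qed
        finally show ?thesis .
      qed
      have gen: "kernel_P \<eta> (x i) (x j) \<le> C0 * (w i * w j * m)"
        if K: "kernel_P \<eta> (x i) (x j) \<le> C' * (ln (exp 1 + (x i + x j)\<^sup>2) powr (- (1 + \<eta>)) * q)"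
          and q: "0 \<le> q" "q \<le> k * (M * m)" and m: "0 \<le> m" and C': "0 < C'" "0 \<le> k" "576 * (k * C') \<le> C0" for C' q k m
      proof -
        note K
        also have "C' * (ln (exp 1 + (x i + x j)\<^sup>2) powr (- (1 + \<eta>)) * q) \<le> C' * (M powr (- (1 + \<eta>)) * 576 * (k * (M * m)))"
          using C' q by (intro mult_left_mono mult_mono lgb) auto
        also have "\<dots> = 576 * (k * C') * ((M powr (- (1 + \<eta>)) * M) * m)" by simp
        also have "\<dots> \<le> C0 * ((w i * w j) * m)"
          using C' m w M1 C0 by (intro mult_mono w mult_right_mono) auto
        finally show ?thesis .
      qed
      have "kernel_P \<eta> (x i) (x j) \<le> C0 * (w i * w j * (1 / sqrt (M * n)))"
        by (rule gen[OF P1[OF \<eta> x_nonneg x_nonneg xij, folded D_def] _ b1]) (use C1 C2 M1 n in \<open>auto simp: C0_def\<close>)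
      moreover have "kernel_P \<eta> (x i) (x j) \<le> C0 * (w i * w j * (M / n\<^sup>2))"
        by (rule gen[OF P2[OF \<eta> x_nonneg x_nonneg xij, folded D_def] _ b2]) (use C1 C2 M1 n in \<open>auto simp: C0_def\<close>)
      ultimately show ?thesis using ij
        by (auto simp: near_diag_def Let_def M_def[symmetric] n_def[symmetric] min_def)
    qed
    have nd0: "0 \<le> near_diag i j" for i j
      using lg_ge_1[of "real (max i j)"] by (auto simp: near_diag_def Let_def)
    have nds: "near_diag i j = near_diag j i" for i j
      by (simp add: near_diag_def Let_def max.commute abs_minus_commute)
    have "(\<Sum>i<N. \<Sum>j<N. (if i = j then 0 else kernel_P \<eta> (x i) (x j)) * (\<bar>c i\<bar> * \<bar>c j\<bar>))
       \<le> (\<Sum>i<N. \<Sum>j<N. C0 * (near_diag i j * (\<bar>w i * c i\<bar> * \<bar>w j * c j\<bar>)))"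
    proof (intro sum_mono)
      fix i j
      have "(if i = j then 0 else kernel_P \<eta> (x i) (x j)) \<le> C0 * (w i * w j * near_diag i j)"
        using entry[of i j] C0 w0 nd0 by auto
      then have "(if i = j then 0 else kernel_P \<eta> (x i) (x j)) * (\<bar>c i\<bar> * \<bar>c j\<bar>) \<le> C0 * (w i * w j * near_diag i j) * (\<bar>c i\<bar> * \<bar>c j\<bar>)"
        by (rule mult_right_mono) auto
      then show "(if i = j then 0 else kernel_P \<eta> (x i) (x j)) * (\<bar>c i\<bar> * \<bar>c j\<bar>) \<le> C0 * (near_diag i j * (\<bar>w i * c i\<bar> * \<bar>w j * c j\<bar>))"
        using w0 by (simp add: abs_mult mult_ac)
    qed
    also have "\<dots> = C0 * (\<Sum>i<N. \<Sum>j<N. near_diag i j * (\<bar>w i * c i\<bar> * \<bar>w j * c j\<bar>))"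
      by (simp add: sum_distrib_left)
    also have "\<dots> \<le> C0 * (\<Sum>i<N. C3 * (w i * c i)\<^sup>2)"
      using C0 by (intro mult_left_mono schur_symmetric nd0 nds row) auto
    also have "\<dots> = C0 * C3 * (\<Sum>i<N. lg (real i) powr (- \<eta>) * (c i)\<^sup>2)"
    proof -
      have "(w i * c i)\<^sup>2 = lg (real i) powr (- \<eta>) * (c i)\<^sup>2" for i
        by (simp add: w_def power_mult_distrib power2_eq_square[of "_ powr _"] flip: powr_add)
      then show ?thesis by (simp add: sum_distrib_left mult.assoc)
    qed
    finally show "(\<Sum>i<N. \<Sum>j<N. (if i = j then 0 else kernel_P \<eta> (x i) (x j)) * (\<bar>c i\<bar> * \<bar>c j\<bar>))
         \<le> C0 * C3 * (\<Sum>i<N. lg (real i) powr (- \<eta>) * (c i)\<^sup>2)" .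
  qed
qed

text \<open>The Gaussian part is of order \<open>1 / \<eta>\<close> times \<open>(lg i) powr (- \<eta>)\<close>, the cosine part at most of order \<open>(lg i) powr (- \<eta>)\<close>.
  The threshold on \<open>\<eta>\<close> makes the second at most half of the first.\<close>

lemma kernel_K_diag_ge:
  obtains c \<eta>0 where "0 < c" "0 < \<eta>0" "\<eta>0 < 1"
    "\<And>\<beta> \<eta> i. 0 \<le> \<beta> \<Longrightarrow> \<beta> \<le> 1/2 \<Longrightarrow> 0 < \<eta> \<Longrightarrow> \<eta> \<le> \<eta>0 \<Longrightarrow>
       c / \<eta> * lg (real i) powr (- \<eta>) \<le> kernel_K \<eta> (node_star \<beta> i) (node_star \<beta> i)"
proof -
  obtain C where C: "0 < C" and Q: "\<And>\<eta> x. 0 < \<eta> \<Longrightarrow> \<eta> \<le> 1 \<Longrightarrow> 0 \<le> x \<Longrightarrow> \<bar>kernel_Q \<eta> x x\<bar> \<le> C * ln (exp 1 + x\<^sup>2) powr (- \<eta>)"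
    using kernel_Q_diag_le by blast
  define c0 where "c0 = exp (- 1 - pi) / (4::real)"
  have c0: "0 < c0" by (simp add: c0_def)
  define \<eta>0 where "\<eta>0 = min (1/2) (c0 / (192 * C))"
  have \<eta>0: "0 < \<eta>0" "\<eta>0 < 1" using c0 C by (auto simp: \<eta>0_def min_less_iff_disj)
  show ?thesis
  proof (rule that[of "c0 / 8" \<eta>0])
    show "0 < c0 / 8" using c0 by simp
    fix \<beta> \<eta> :: real and i :: nat
    assume h: "0 \<le> \<beta>" "\<beta> \<le> 1/2" and \<eta>: "0 < \<eta>" "\<eta> \<le> \<eta>0"
    have \<eta>1: "\<eta> \<le> 1" using \<eta> \<eta>0 by simp
    interpret nodes \<beta> by unfold_locales (use h in auto)
    define L where "L = lg (real i)"
    have L: "1 \<le> L" unfolding L_def by (rule lg_ge_1) simp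
    have l2: "0 < ln (exp 2 + (x i)\<^sup>2)" 
    proof (rule ln_gt_zero)
      have "1 < exp (2::real)" by simp
      then show "1 < exp 2 + (x i)\<^sup>2" using zero_le_power2[of "x i"] by linarith
    qed
    have "ln (exp 2 + (x i)\<^sup>2) powr \<eta> \<le> (4 * L) powr \<eta>"
      using l2 \<eta> lg_x_sq_le[of i] by (intro powr_mono2) (auto simp: L_def)
    also have "\<dots> = 4 powr \<eta> * L powr \<eta>" using L by (simp add: powr_mult)
    also have "\<dots> \<le> 4 powr 1 * L powr \<eta>" using \<eta>1 by (intro mult_right_mono powr_mono) auto
    finally have "c0 / (\<eta> * (4 * L powr \<eta>)) \<le> c0 / (\<eta> * ln (exp 2 + (x i)\<^sup>2) powr \<eta>)"
      using c0 \<eta> l2 L by (intro divide_left_mono mult_left_mono mult_pos_pos) auto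
    also have "\<dots> \<le> kernel_P \<eta> (x i) (x i)"
      unfolding c0_def by (rule kernel_P_diag_ge[OF \<eta>(1) x_nonneg])
    finally have P: "c0 / (\<eta> * (4 * L powr \<eta>)) \<le> kernel_P \<eta> (x i) (x i)" .
    have "ln (exp 1 + (x i)\<^sup>2) powr (- \<eta>) \<le> (L / 24) powr (- \<eta>)"
      using L \<eta> lg_index_le[of i] by (intro powr_mono2') (auto simp: L_def lg_def)
    also have "\<dots> = L powr (- \<eta>) * 24 powr \<eta>" using L by (simp add: powr_divide powr_minus_divide)
    also have "\<dots> \<le> L powr (- \<eta>) * 24 powr 1" using \<eta>1 by (intro mult_left_mono powr_mono) auto
    finally have "C * ln (exp 1 + (x i)\<^sup>2) powr (- \<eta>) \<le> C * (L powr (- \<eta>) * 24)" using C by simp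
    then have Q': "\<bar>kernel_Q \<eta> (x i) (x i)\<bar> \<le> 24 * C * L powr (- \<eta>)" using Q[OF \<eta>(1) \<eta>1 x_nonneg, of i] by simp
    have "\<eta> \<le> c0 / (192 * C)" using \<eta> by (simp add: \<eta>0_def)
    then have "24 * C \<le> c0 / (8 * \<eta>)" using C \<eta> by (simp add: field_simps)
    then have "24 * C * L powr (- \<eta>) \<le> c0 / (8 * \<eta>) * L powr (- \<eta>)" by (intro mult_right_mono) auto
    moreover have "c0 / (\<eta> * (4 * L powr \<eta>)) = 2 * (c0 / (8 * \<eta>) * L powr (- \<eta>))"
      using L \<eta> by (simp add: powr_minus_divide)
    moreover have "c0 / 8 / \<eta> * L powr (- \<eta>) = c0 / (8 * \<eta>) * L powr (- \<eta>)" by simp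
    ultimately show "c0 / 8 / \<eta> * lg (real i) powr (- \<eta>) \<le> kernel_K \<eta> (x i) (x i)"
      unfolding kernel_K_split[OF \<eta>(1) x_nonneg x_nonneg] L_def[symmetric] using P Q' by linarith
  qed (use \<eta>0 in auto)
qed

section \<open>Dyadic shells of nodes\<close>

text \<open>The shell with number \<open>k\<close> consists of the indices \<open>i\<close> with \<open>2 ^ k \<le> i + 1 < 2 ^ (k + 1)\<close>.\<close>

definition shell :: "nat \<Rightarrow> nat" where "shell i = floor_log (Suc i)"

lemma shell_bounds: "2 ^ shell i \<le> real i + 1" "real i + 1 < 2 ^ (shell i + 1)"
proof -
  have "2 ^ shell i \<le> Suc i" unfolding shell_def by (rule floor_log_exp2_le) simp
  then have "real (2 ^ shell i) \<le> real (Suc i)" by (simp only: of_nat_le_iff)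
  then show "2 ^ shell i \<le> real i + 1" by simp
  have "Suc i < 2 ^ (shell i + 1)" unfolding shell_def using floor_log_exp2_gt[of "Suc i"] by simp
  then have "real (Suc i) < real (2 ^ (shell i + 1))" by (simp only: of_nat_less_iff)
  then show "real i + 1 < 2 ^ (shell i + 1)" by simp
qed

lemma Suc_le_power2: "real k + 1 \<le> 2 ^ k"
  by (induction k) auto

lemma shell_le: "shell i \<le> i"
proof -
  have "real (shell i) + 1 \<le> 2 ^ shell i" by (rule Suc_le_power2)
  then show ?thesis using shell_bounds(1)[of i] by simp
qed

lemma ln2_bounds: "1 / 2 \<le> ln (2::real)" "ln (2::real) \<le> 1"
  using ln_2_less_1 ln_le_minus_one[of "1/2 :: real"] by (auto simp: ln_div)

lemma lg_shell: "lg (real i) \<le> 2 * (real (shell i) + 1)" "real (shell i) + 1 \<le> 4 * lg (real i)"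
proof -
  define k where "k = shell i"
  have "exp 1 + real i \<le> 2 ^ (k + 2)"
  proof -
    have "(2::real) \<le> 2 ^ (k + 1)" by simp
    moreover have "(2::real) ^ (k + 2) = 2 * 2 ^ (k + 1)" by simp
    ultimately show ?thesis using shell_bounds(2)[of i] exp1_bounds unfolding k_def by linarith
  qed
  then have "lg (real i) \<le> ln (2 ^ (k + 2))" unfolding lg_def by (subst ln_le_cancel_iff) (auto simp: add_pos_nonneg)
  also have "\<dots> = (real k + 2) * ln 2" by (subst ln_realpow) auto
  also have "\<dots> \<le> (real k + 2) * 1" using ln2_bounds by (intro mult_left_mono) auto
  finally show "lg (real i) \<le> 2 * (real (shell i) + 1)" by (simp add: k_def)
  have "2 ^ k \<le> exp 1 + real i" using shell_bounds(1)[of i] exp1_bounds by (simp add: k_def)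
  then have "ln (2 ^ k) \<le> lg (real i)" unfolding lg_def by (subst ln_le_cancel_iff) (auto simp: add_pos_nonneg)
  then have "real k * ln 2 \<le> lg (real i)" by (simp add: ln_realpow)
  moreover have "real k * (1/2) \<le> real k * ln 2" using ln2_bounds by (intro mult_left_mono) auto
  moreover have "1 \<le> lg (real i)" by (rule lg_ge_1) simp
  ultimately show "real (shell i) + 1 \<le> 4 * lg (real i)" by (simp add: k_def)
qed

context nodes
begin

text \<open>Up to constants, the square of the nodes in the \<open>k\<close>-th shell.\<close>

definition T :: "nat \<Rightarrow> real" where "T k = 2 ^ k / (real k + 1) powr \<gamma>"

lemma k_powr: "1 \<le> (real k + 1) powr \<gamma>" "(real k + 1) powr \<gamma> \<le> real k + 1"
proof -
  show "1 \<le> (real k + 1) powr \<gamma>" using \<gamma> by (simp add: ge_one_powr_ge_zero)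
  have "(real k + 1) powr \<gamma> \<le> (real k + 1) powr 1" using \<gamma> by (intro powr_mono) auto
  then show "(real k + 1) powr \<gamma> \<le> real k + 1" by simp
qed

lemma T_ge: "1 \<le> T k"
  unfolding T_def using k_powr[of k] Suc_le_power2[of k] by (simp add: le_divide_eq)

lemma T_mono:
  assumes "m \<le> k"
  shows "T m \<le> T k"
proof -
  define d where "d = k - m"
  have k: "k = m + d" using assms by (simp add: d_def)
  have "real k + 1 \<le> (real m + 1) * (real d + 1)" by (simp add: k algebra_simps)
  then have "(real k + 1) powr \<gamma> \<le> ((real m + 1) * (real d + 1)) powr \<gamma>" using \<gamma> by (intro powr_mono2) auto
  also have "\<dots> = (real m + 1) powr \<gamma> * (real d + 1) powr \<gamma>" by (simp add: powr_mult)
  also have "\<dots> \<le> (real m + 1) powr \<gamma> * 2 ^ d"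
    using k_powr(2)[of d] Suc_le_power2[of d] by (intro mult_left_mono) auto
  finally have "2 ^ m * (real k + 1) powr \<gamma> \<le> 2 ^ m * ((real m + 1) powr \<gamma> * 2 ^ d)" by simp
  also have "\<dots> = 2 ^ k * (real m + 1) powr \<gamma>" by (simp add: k power_add)
  finally show ?thesis unfolding T_def using k_powr(1)[of m] k_powr(1)[of k]
    by (simp add: divide_le_eq le_divide_eq mult.commute)
qed

lemma lg_powr_shell: "lg (real i) powr \<gamma> \<le> 2 * (real (shell i) + 1) powr \<gamma>"
  "(real (shell i) + 1) powr \<gamma> \<le> 4 * lg (real i) powr \<gamma>"
proof -
  have two: "2 powr \<gamma> \<le> (2::real)" "4 powr \<gamma> \<le> (4::real)"
    using \<gamma> powr_mono[of \<gamma> 1 "2::real"] powr_mono[of \<gamma> 1 "4::real"] by auto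
  have l: "0 \<le> lg (real i)" using lg_ge_1[of "real i"] by simp
  have "lg (real i) powr \<gamma> \<le> (2 * (real (shell i) + 1)) powr \<gamma>"
    using l \<gamma> lg_shell by (intro powr_mono2) auto
  also have "\<dots> = 2 powr \<gamma> * (real (shell i) + 1) powr \<gamma>" by (rule powr_mult)
  also have "\<dots> \<le> 2 * (real (shell i) + 1) powr \<gamma>" using two by (intro mult_right_mono) auto
  finally show "lg (real i) powr \<gamma> \<le> 2 * (real (shell i) + 1) powr \<gamma>" .
  have "(real (shell i) + 1) powr \<gamma> \<le> (4 * lg (real i)) powr \<gamma>"
    using l \<gamma> lg_shell by (intro powr_mono2) auto
  also have "\<dots> = 4 powr \<gamma> * lg (real i) powr \<gamma>" using l by (simp add: powr_mult)
  also have "\<dots> \<le> 4 * lg (real i) powr \<gamma>" using two by (intro mult_right_mono) auto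
  finally show "(real (shell i) + 1) powr \<gamma> \<le> 4 * lg (real i) powr \<gamma>" .
qed

lemma x_sq_le_T:
  assumes "shell i \<le> k"
  shows "(x i)\<^sup>2 \<le> 8 * T k"
proof -
  have "(x i)\<^sup>2 \<le> (1 + real i) / lg (real i) powr \<gamma>" by (rule x_sq_le) simp
  also have "\<dots> \<le> (2 * 2 ^ shell i) / ((real (shell i) + 1) powr \<gamma> / 4)"
    using shell_bounds(2)[of i] lg_powr_shell(2)[of i] k_powr(1)[of "shell i"] by (intro frac_le) auto
  also have "\<dots> = 8 * T (shell i)" by (simp add: T_def)
  also have "\<dots> \<le> 8 * T k" using T_mono[OF assms] by simp
  finally show ?thesis .
qed

text \<open>The summand 1 on the right covers the node 0 and the node \<open>1/2\<close>.\<close>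

lemma T_shell_le: "T (shell i) \<le> 4 * ((x i)\<^sup>2 + 1)"
proof -
  have "T (shell i) = 4 * (2 ^ shell i / (2 * (2 * (real (shell i) + 1) powr \<gamma>)))" by (simp add: T_def)
  also have "\<dots> \<le> 4 * ((1 + real i) / (2 * lg (real i) powr \<gamma>))"
    using shell_bounds(1)[of i] lg_powr_shell(1)[of i] lg_powr(1)[of i] by (intro mult_left_mono frac_le) auto
  also have "\<dots> \<le> 4 * ((x i)\<^sup>2 + 1)" using x_sq_ge[of i] by (rule mult_left_mono) simp
  finally show ?thesis .
qed

text \<open>Since \<open>(k + 1)\<^sup>2 \<le> 8 * 2 ^ k\<close>, the denominator of \<open>T k\<close> is at most of order \<open>2 powr (k / 2)\<close>, so the logarithm of \<open>T k\<close> still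
  grows linearly.\<close>

lemma lg_T_ge: "(real k + 1) / 12 \<le> lg (T k)"
proof -
  have 1: "1 \<le> lg (T k)" using T_ge[of k] by (intro lg_ge_1) simp
  have "real k / 4 - 1 \<le> lg (T k)"
  proof (cases "k < 4")
    case False
    have sq: "(real n + 1)\<^sup>2 \<le> 8 * 2 ^ n" for n
    proof (induction n)
      case (Suc n)
      show ?case
      proof (cases "n < 3")
        case True
        then have "n = 0 \<or> n = 1 \<or> n = 2" by auto
        then show ?thesis by (auto simp: power2_eq_square)
      next
        case False
        then have "3 * 3 \<le> real n * real n" by (intro mult_mono) auto
        then have "(real (Suc n) + 1)\<^sup>2 \<le> 2 * (real n + 1)\<^sup>2" using False by (simp add: power2_eq_square algebra_simps)
        also have "\<dots> \<le> 2 * (8 * 2 ^ n)" using Suc by simp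
        finally show ?thesis by simp
      qed
    qed simp
    have "(2 ^ k)\<^sup>2 \<le> (T k * (real k + 1))\<^sup>2"
    proof (intro power_mono)
      have "2 ^ k = T k * (real k + 1) powr \<gamma>" unfolding T_def using k_powr(1)[of k] by simp
      also have "\<dots> \<le> T k * (real k + 1)" using k_powr(2)[of k] T_ge[of k] by (intro mult_left_mono) auto
      finally show "2 ^ k \<le> T k * (real k + 1)" .
    qed simp
    also have "\<dots> = (T k)\<^sup>2 * (real k + 1)\<^sup>2" by (rule power_mult_distrib)
    also have "\<dots> \<le> (T k)\<^sup>2 * (8 * 2 ^ k)" by (intro mult_left_mono sq) auto
    finally have "2 ^ k * 2 ^ k \<le> (8 * (T k)\<^sup>2) * 2 ^ k" by (simp add: power2_eq_square mult_ac)
    then have "2 ^ k \<le> 8 * (T k)\<^sup>2" by simp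
    then have "ln (2 ^ k) \<le> ln (8 * (T k)\<^sup>2)" using T_ge[of k] by (subst ln_le_cancel_iff) auto
    also have "\<dots> = ln (2 ^ 3) + 2 * ln (T k)" using T_ge[of k] by (subst ln_mult_pos) (auto simp: ln_realpow)
    also have "ln (2 ^ 3 :: real) = 3 * ln 2" by (subst ln_realpow) auto
    also have "ln (T k) \<le> lg (T k)" unfolding lg_def using T_ge[of k] by (subst ln_le_cancel_iff) (auto simp: add_pos_pos)
    finally have "real k * ln 2 \<le> 3 * ln 2 + 2 * lg (T k)" by (simp add: ln_realpow)
    then have "(real k - 3) * ln 2 \<le> 2 * lg (T k)" by (simp add: algebra_simps)
    moreover have "(real k - 3) * (1/2) \<le> (real k - 3) * ln 2" using ln2_bounds False by (intro mult_left_mono) auto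
    ultimately show ?thesis by simp
  qed (use 1 in simp)
  then show ?thesis using 1 by simp
qed

end

text \<open>Completing the square, \<open>s\<^sup>2 n\<^sup>2 \<ge> s n - 1/4\<close> with \<open>s = sqrt z\<close>, reduces the sum to a geometric one.\<close>

lemma sum_exp_square_le:
  fixes z :: real
  assumes "0 < z"
  shows "(\<Sum>n<N. exp (- z * (real n)\<^sup>2)) \<le> 2 * (1 + 1 / sqrt z)"
proof -
  define s where "s = sqrt z"
  have s: "0 < s" "s\<^sup>2 = z" using assms by (auto simp: s_def)
  have q: "exp (- s) < 1" using s by simp
  have "(\<Sum>n<N. exp (- z * (real n)\<^sup>2)) \<le> (\<Sum>n<N. exp (1/4) * exp (- s) ^ n)"
  proof (rule sum_mono)
    fix n
    have "0 \<le> (s * real n - 1/2)\<^sup>2" by simp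
    then have "s * real n - 1/4 \<le> z * (real n)\<^sup>2"
      by (simp add: power2_diff power_mult_distrib s(2)) (simp add: power2_eq_square)
    then show "exp (- z * (real n)\<^sup>2) \<le> exp (1/4) * exp (- s) ^ n"
      by (simp flip: exp_of_nat_mult exp_add add: mult.commute)
  qed
  also have "\<dots> = exp (1/4) * (\<Sum>n<N. exp (- s) ^ n)" by (simp add: sum_distrib_left)
  also have "\<dots> \<le> 2 * (1 + 1 / s)"
  proof (rule mult_mono)
    have "(exp (1/4)) ^ 4 \<le> (2::real) ^ 4"
      using exp1_bounds by (simp flip: exp_of_nat_mult)
    then show "exp (1/4) \<le> (2::real)" by (rule power_le_imp_le_base[where n = 3, simplified]) auto
    have "(\<Sum>n<N. exp (- s) ^ n) \<le> (\<Sum>n. exp (- s) ^ n)" using q by (intro sum_le_suminf summable_geometric) auto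
    also have "\<dots> = 1 / (1 - exp (- s))" using q by (intro suminf_geometric) auto
    also have "\<dots> \<le> 1 / (s / (1 + s))"
    proof (rule divide_left_mono)
      have "1 + s \<le> exp s" by (rule exp_ge_add_one_self)
      then have "exp (- s) \<le> 1 / (1 + s)" using s by (simp add: exp_minus divide_simps)
      then show "s / (1 + s) \<le> 1 - exp (- s)" using s by (simp add: field_simps)
      then show "0 < (1 - exp (- s)) * (s / (1 + s))" using s q by simp
    qed simp
    also have "\<dots> = 1 + 1 / s" using s by (simp add: field_simps)
    finally show "(\<Sum>n<N. exp (- s) ^ n) \<le> 1 + 1 / s" .
  qed (auto intro: sum_nonneg)
  finally show ?thesis by (simp add: s_def)
qed

lemma summable_exp_over_lg: "summable (\<lambda>n. exp (- (1/256) * (real n / lg (real n))))"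
proof (rule summable_comparison_test_bigo)
  show "summable (\<lambda>n. norm (1 / real n ^ 2))" using inverse_power_summable[of 2, where 'a = real] by (simp add: inverse_eq_divide)
  show "(\<lambda>n. exp (- (1/256) * (real n / lg (real n)))) \<in> O(\<lambda>n. 1 / real n ^ 2)"
    unfolding lg_def by real_asymp
qed

text \<open>The node \<open>x i\<close> has spacing about \<open>1 / (x i * (lg i) powr \<gamma>)\<close> to its neighbours, so a Gaussian of width
  \<open>1 / sqrt (T k)\<close> around it sees about \<open>1 + x i * (lg i) powr \<gamma> / sqrt (T k)\<close> of them. The decay in
  \<open>k - shell i\<close> makes the low shells cheap.

  With \<open>M = max i j\<close> and \<open>n = \<bar>i - j\<bar>\<close> the separation gives \<open>(x i - x j)\<^sup>2\<close> at least of order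
  \<open>n\<^sup>2 / ((1 + M) (lg M) powr \<gamma>)\<close>. For \<open>n \<le> i + 1\<close> one may replace \<open>M\<close> by \<open>i\<close>, which yields the Gaussian sum; for larger
  \<open>n\<close> one may replace \<open>M\<close> by \<open>n\<close>, which yields a sum bounded by a constant.\<close>

lemma gauss_row_sum:
  obtains C where "0 < C"
    "\<And>\<beta> i k N. 0 \<le> \<beta> \<Longrightarrow> \<beta> \<le> 1/2 \<Longrightarrow> shell i \<le> k \<Longrightarrow> i < N \<Longrightarrow>
       (\<Sum>j<N. exp (- nodes.T \<beta> k * (node_star \<beta> i - node_star \<beta> j)\<^sup>2))
         \<le> C * (1 + (real k + 1) powr (2 * \<beta>) * 2 powr (- (real k - real (shell i)) / 2))"
proof -
  define g where "g n = exp (- (1/256) * (real n / lg (real n)))" for n :: nat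
  have g0: "0 \<le> g n" for n by (simp add: g_def)
  define S where "S = (\<Sum>n. g n)"
  have sg: "summable g" unfolding g_def by (rule summable_exp_over_lg)
  have S0: "0 \<le> S" unfolding S_def by (intro suminf_nonneg sg g0)
  show ?thesis
  proof (rule that[of "2 * (64 + S)"])
    show "0 < 2 * (64 + S)" using S0 by simp
    fix \<beta> :: real and i k N :: nat
    assume h: "0 \<le> \<beta>" "\<beta> \<le> 1/2" and s: "shell i \<le> k" and iN: "i < N"
    interpret nodes \<beta> by unfold_locales (use h in auto)
    define P where "P = (1 + real i) * lg (real i) powr \<gamma>"
    have P: "0 < P" unfolding P_def using lg_powr(1)[of i] by (intro mult_pos_pos) auto
    define z where "z = T k / (256 * P)"
    have T0: "1 \<le> T k" by (rule T_ge)
    have z: "0 < z" using P T0 by (simp add: z_def)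
    define f where "f n = exp (- z * (real n)\<^sup>2) + g n" for n :: nat
    have f0: "0 \<le> f n" for n by (simp add: f_def g0)
    have "exp (- T k * (x i - x j)\<^sup>2) \<le> f (if j \<le> i then i - j else j - i)" for j
    proof (cases "i = j")
      case True
      then show ?thesis using g0[of 0] by (simp add: f_def)
    next
      case False
      define n where "n = (if j \<le> i then i - j else j - i)"
      have n: "1 \<le> n" "\<bar>real i - real j\<bar> = real n" using False by (auto simp: n_def)
      define M where "M = max i j"
      define L where "L = lg (real M) powr \<gamma>"
      have L: "1 \<le> L" unfolding L_def by (rule lg_powr)
      have Mn: "M \<le> i + n" unfolding M_def n_def by auto
      define D where "D = (x i)\<^sup>2 - (x j)\<^sup>2"
      have sep: "real n / (4 * L) \<le> \<bar>D\<bar>" using separation[of i j] by (simp add: n L_def M_def D_def)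
      have "real n / (4 * L) > 0" using n L by simp
      then have D0: "D \<noteq> 0" using sep by auto
      have Dfac: "D = (x i - x j) * (x i + x j)" by (simp add: D_def power2_eq_square algebra_simps)
      have sum0: "x i + x j \<noteq> 0" using D0 Dfac by auto
      have sumle: "(x i + x j)\<^sup>2 \<le> 4 * ((1 + real M) / L)"
      proof -
        have "(x i + x j)\<^sup>2 \<le> 2 * (x i)\<^sup>2 + 2 * (x j)\<^sup>2"
          using sum_squares_bound[of "x i" "x j"] by (simp add: power2_sum)
        moreover have "(x i)\<^sup>2 \<le> (1 + real M) / L" "(x j)\<^sup>2 \<le> (1 + real M) / L"
          unfolding L_def by (auto intro!: x_sq_le simp: M_def)
        ultimately show ?thesis by linarith
      qed
      have "(real n)\<^sup>2 / (64 * ((1 + real M) * L)) = (real n / (4 * L))\<^sup>2 / (4 * ((1 + real M) / L))"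
        using L by (simp add: power2_eq_square field_simps)
      also have "\<dots> \<le> \<bar>D\<bar>\<^sup>2 / (x i + x j)\<^sup>2"
        using sep sumle sum0 L by (intro frac_le power_mono) auto
      also have "\<dots> = (x i - x j)\<^sup>2" unfolding Dfac using sum0 by (simp add: power_mult_distrib)
      finally have base: "(real n)\<^sup>2 / (64 * ((1 + real M) * L)) \<le> (x i - x j)\<^sup>2" .
      have twog: "2 powr \<gamma> \<le> 2" using \<gamma> powr_mono[of \<gamma> 1 "2::real"] by auto
      have dbl: "lg (real m + real m') powr \<gamma> \<le> 2 * lg (real m) powr \<gamma>" if "m' \<le> m + 1" "1 \<le> m + m'" for m m' :: nat
      proof -
        have "exp 1 + (real m + real m') \<le> (exp 1 + real m) ^ 2"
        proof -
          define e where "e = exp (1::real)"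
          have e: "2 \<le> e" using exp1_bounds by (simp add: e_def)
          have "2 * e \<le> e * e" using e by (intro mult_right_mono) auto
          moreover have "2 * (2 * real m) \<le> e * (2 * real m)" using e by (intro mult_right_mono) auto
          moreover have "real m' \<le> real m + 1" using that by linarith
          moreover have "0 \<le> real m * real m" by simp
          ultimately have "e + (real m + real m') \<le> e * e + e * (2 * real m) + real m * real m" using e by linarith
          then show ?thesis by (simp add: e_def[symmetric] power2_eq_square algebra_simps)
        qed
        moreover have p: "0 < exp 1 + real m" "0 < exp 1 + (real m + real m')" by (auto simp: add_pos_nonneg)
        ultimately have "lg (real m + real m') \<le> ln ((exp 1 + real m) ^ 2)" unfolding lg_def by (subst ln_le_cancel_iff) auto
        also have "\<dots> = 2 * lg (real m)" unfolding lg_def using p by (subst ln_realpow) auto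
        finally have "lg (real m + real m') powr \<gamma> \<le> (2 * lg (real m)) powr \<gamma>"
          using \<gamma> lg_ge_1[of "real m + real m'"] by (intro powr_mono2) auto
        also have "\<dots> = 2 powr \<gamma> * lg (real m) powr \<gamma>" using lg_ge_1[of "real m"] by (simp add: powr_mult)
        also have "\<dots> \<le> 2 * lg (real m) powr \<gamma>" using twog by (intro mult_right_mono) auto
        finally show ?thesis .
      qed
      have LM: "L \<le> lg (real i + real n) powr \<gamma>"
        unfolding L_def using \<gamma> Mn lg_ge_1[of "real M"] by (intro powr_mono2 lg_mono) auto
      have "exp (- T k * (x i - x j)\<^sup>2) \<le> f n"
      proof (cases "n \<le> i + 1")
        case True
        have "(1 + real M) * L \<le> (2 * (1 + real i)) * (2 * lg (real i) powr \<gamma>)"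
          using LM dbl[of n i] True n Mn L by (intro mult_mono) auto
        also have "(2 * (1 + real i)) * (2 * lg (real i) powr \<gamma>) = 4 * P" by (simp add: P_def algebra_simps)
        finally have "(1 + real M) * L \<le> 4 * P" .
        then have "(real n)\<^sup>2 / (64 * (4 * P)) \<le> (real n)\<^sup>2 / (64 * ((1 + real M) * L))"
          using L P by (intro divide_left_mono mult_left_mono mult_pos_pos) auto
        then have "(real n)\<^sup>2 / (64 * (4 * P)) \<le> (x i - x j)\<^sup>2" using base by linarith
        then have "T k * ((real n)\<^sup>2 / (64 * (4 * P))) \<le> T k * (x i - x j)\<^sup>2" using T0 by (intro mult_left_mono) auto
        then have "z * (real n)\<^sup>2 \<le> T k * (x i - x j)\<^sup>2" by (simp add: z_def)
        then have "exp (- T k * (x i - x j)\<^sup>2) \<le> exp (- z * (real n)\<^sup>2)" by simp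
        then show ?thesis using g0[of n] unfolding f_def by linarith
      next
        case False
        have "L \<le> 2 * lg (real n)"
        proof -
          have "L \<le> 2 * lg (real n) powr \<gamma>" using LM dbl[of i n] False by (simp add: add.commute)
          then show ?thesis using lg_powr(2)[of n] by linarith
        qed
        then have "(1 + real M) * L \<le> (2 * real n) * (2 * lg (real n))"
          using False Mn L by (intro mult_mono) auto
        then have le: "(1 + real M) * L \<le> 4 * (real n * lg (real n))" by simp
        have ln0: "0 < lg (real n)" using lg_ge_1[of "real n"] by simp
        have "1/256 * (real n / lg (real n)) = (real n)\<^sup>2 / (64 * (4 * (real n * lg (real n))))"
          using n ln0 by (simp add: power2_eq_square)
        also have "\<dots> \<le> (real n)\<^sup>2 / (64 * ((1 + real M) * L))"
          using le L n ln0 by (intro divide_left_mono mult_left_mono mult_pos_pos) auto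
        also have "\<dots> \<le> 1 * (x i - x j)\<^sup>2" using base by simp
        also have "\<dots> \<le> T k * (x i - x j)\<^sup>2" using T0 by (intro mult_right_mono) auto
        finally have "exp (- T k * (x i - x j)\<^sup>2) \<le> g n" by (simp add: g_def)
        then show ?thesis by (simp add: f_def add_increasing)
      qed
      then show ?thesis by (simp add: n_def)
    qed
    then have "(\<Sum>j<N. exp (- T k * (x i - x j)\<^sup>2)) \<le> (\<Sum>j<N. f (if j \<le> i then i - j else j - i))"
      by (rule sum_mono)
    also have "\<dots> \<le> 2 * (\<Sum>n<N. f n)" by (rule sum_distance_le[OF f0 iN])
    also have "(\<Sum>n<N. f n) \<le> 2 * (1 + 1 / sqrt z) + S"
      unfolding f_def sum.distrib S_def by (intro add_mono sum_exp_square_le z sum_le_suminf sg) (auto simp: g0)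
    also have "1 / sqrt z \<le> 32 * ((real k + 1) powr \<gamma> * 2 powr (- (real k - real (shell i)) / 2))"
    proof -
      define K S' where "K = (real k + 1) powr \<gamma>" and "S' = (real (shell i) + 1) powr \<gamma>"
      have K: "1 \<le> K" "1 \<le> S'" unfolding K_def S'_def by (rule k_powr)+
      have SK: "S' \<le> K" unfolding S'_def K_def using s \<gamma> by (intro powr_mono2) auto
      have "P \<le> (2 * 2 ^ shell i) * (2 * S')"
        unfolding P_def S'_def using shell_bounds(2)[of i] lg_powr_shell(1)[of i] by (intro mult_mono) auto
      also have "\<dots> \<le> (2 * 2 ^ shell i) * (2 * K)" using SK by (intro mult_left_mono) auto
      finally have "P \<le> (2 * 2 ^ shell i) * (2 * K)" .
      from mult_left_mono[OF this, of 256]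
      have "256 * P / T k \<le> 256 * ((2 * 2 ^ shell i) * (2 * K)) / T k" using T0 by (intro divide_right_mono) (simp only:, simp)
      also have "\<dots> = 1024 * (K * K) * (2 ^ shell i / 2 ^ k)" using K by (simp add: T_def K_def)
      also have "2 ^ shell i / 2 ^ k = (2::real) powr (- (real k - real (shell i)))"
        by (simp add: powr_diff powr_realpow)
      also have "\<dots> = (2 powr (- (real k - real (shell i)) / 2))\<^sup>2"
        by (simp add: power2_eq_square flip: powr_add)
      also have "1024 * (K * K) * (2 powr (- (real k - real (shell i)) / 2))\<^sup>2 = (32 * (K * 2 powr (- (real k - real (shell i)) / 2)))\<^sup>2"
        by (simp add: power2_eq_square)
      finally have "sqrt (256 * P / T k) \<le> 32 * (K * 2 powr (- (real k - real (shell i)) / 2))"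
        using K by (intro real_le_lsqrt) auto
      moreover have "1 / sqrt z = sqrt (256 * P / T k)" by (simp add: z_def real_sqrt_divide)
      ultimately show ?thesis by (simp add: K_def)
    qed
    finally have "(\<Sum>j<N. exp (- T k * (x i - x j)\<^sup>2)) \<le> 2 * (2 * (1 + 32 * ((real k + 1) powr \<gamma> * 2 powr (- (real k - real (shell i)) / 2))) + S)"
      by simp
    also have "\<dots> \<le> 2 * (64 + S) * (1 + (real k + 1) powr \<gamma> * 2 powr (- (real k - real (shell i)) / 2))"
    proof -
      define Y where "Y = (real k + 1) powr \<gamma> * 2 powr (- (real k - real (shell i)) / 2)"
      have "0 \<le> Y" by (simp add: Y_def)
      then have "0 \<le> S * Y" using S0 by simp
      then show ?thesis unfolding Y_def[symmetric] using \<open>0 \<le> Y\<close> by (simp add: algebra_simps)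
    qed
    finally show "(\<Sum>j<N. exp (- T k * (x i - x j)\<^sup>2))
         \<le> 2 * (64 + S) * (1 + (real k + 1) powr (2 * \<beta>) * 2 powr (- (real k - real (shell i)) / 2))"
      by (simp add: \<gamma>_def)
  qed
qed

section \<open>The cosine part\<close>

lemma set_integral_sum_finite:
  fixes f :: "'i \<Rightarrow> real \<Rightarrow> real"
  assumes "\<And>i. i \<in> A \<Longrightarrow> set_integrable lborel S (f i)"
  shows "set_integrable lborel S (\<lambda>t. \<Sum>i\<in>A. f i t)"
    "(LBINT t:S. \<Sum>i\<in>A. f i t) = (\<Sum>i\<in>A. LBINT t:S. f i t)"
proof -
  show "set_integrable lborel S (\<lambda>t. \<Sum>i\<in>A. f i t)"
    using assms unfolding set_integrable_def scaleR_sum_right by (rule Bochner_Integration.integrable_sum)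
  show "(LBINT t:S. \<Sum>i\<in>A. f i t) = (\<Sum>i\<in>A. LBINT t:S. f i t)"
    using assms unfolding set_lebesgue_integral_def set_integrable_def scaleR_sum_right
    by (rule Bochner_Integration.integral_sum)
qed

context nodes
begin

text \<open>In \<open>cos (2 pi s y z)\<close> the factor \<open>s\<close> can be moved into the variables, and the Gaussian factor, being a product
  of a function of \<open>y\<close> and one of \<open>z\<close>, can be changed at will.\<close>

lemma cos_kernel_rescale:
  assumes "mehler_parameters a s" "mehler_parameters a0 s0"
  defines "\<kappa> \<equiv> sqrt (s / s0)"
  shows "cos_kernel a s y z = sqrt ((1 + a) / (1 + a0)) *
    (exp (- pi * (a - a0 * \<kappa>\<^sup>2) * y\<^sup>2) * exp (- pi * (a - a0 * \<kappa>\<^sup>2) * z\<^sup>2)) * cos_kernel a0 s0 (\<kappa> * y) (\<kappa> * z)"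
proof -
  interpret A: mehler_parameters a s by fact
  interpret B: mehler_parameters a0 s0 by fact
  have k2: "\<kappa>\<^sup>2 = s / s0" using A.s_pos B.s_pos by (simp add: \<kappa>_def)
  have c: "2 * pi * s0 * (\<kappa> * y) * (\<kappa> * z) = 2 * pi * s * y * z"
  proof -
    have "2 * pi * s0 * (\<kappa> * y) * (\<kappa> * z) = 2 * pi * (s0 * \<kappa>\<^sup>2) * y * z" by (simp add: power2_eq_square mult_ac)
    also have "s0 * \<kappa>\<^sup>2 = s" using B.s_pos by (simp add: k2)
    finally show ?thesis .
  qed
  have r: "sqrt ((1 + a) / (1 + a0)) * sqrt (1 + a0) = sqrt (1 + a)"
    using B.a by (simp add: real_sqrt_divide)
  have e: "exp (- pi * (a - a0 * \<kappa>\<^sup>2) * y\<^sup>2) * exp (- pi * (a - a0 * \<kappa>\<^sup>2) * z\<^sup>2) * exp (- pi * a0 * ((\<kappa> * y)\<^sup>2 + (\<kappa> * z)\<^sup>2))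
     = exp (- pi * a * (y\<^sup>2 + z\<^sup>2))"
    unfolding exp_add[symmetric] by (rule arg_cong[of _ _ exp]) (simp add: power_mult_distrib algebra_simps)
  have "sqrt ((1 + a) / (1 + a0)) *
    (exp (- pi * (a - a0 * \<kappa>\<^sup>2) * y\<^sup>2) * exp (- pi * (a - a0 * \<kappa>\<^sup>2) * z\<^sup>2)) * cos_kernel a0 s0 (\<kappa> * y) (\<kappa> * z)
    = (sqrt ((1 + a) / (1 + a0)) * sqrt (1 + a0)) *
      (exp (- pi * (a - a0 * \<kappa>\<^sup>2) * y\<^sup>2) * exp (- pi * (a - a0 * \<kappa>\<^sup>2) * z\<^sup>2) * exp (- pi * a0 * ((\<kappa> * y)\<^sup>2 + (\<kappa> * z)\<^sup>2)))
      * cos (2 * pi * s0 * (\<kappa> * y) * (\<kappa> * z))"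
    by (simp only: cos_kernel_def mult_ac)
  also have "\<dots> = cos_kernel a s y z" unfolding r e c cos_kernel_def ..
  finally show ?thesis by simp
qed

text \<open>The parameters are changed to \<open>a0 = 1 / (2 T k)\<close>, whose Gaussian kernel has width about \<open>1 / sqrt (T k)\<close> and height about
  \<open>sqrt (T k)\<close>. The new weights \<open>W i\<close> are bounded as long as \<open>(x i)\<^sup>2\<close> is at most of order \<open>T k\<close>; on the shell itself they
  moreover keep the decay of the original Gaussian factor. As the bound for the Gaussian forms does not depend on \<open>t\<close>, there is no loss for small \<open>t\<close>.\<close>

lemma cos_form_shell_le:
  fixes d b :: "nat \<Rightarrow> real" and \<theta> t :: real
  assumes t: "0 < t" "t \<le> 1" and \<theta>: "0 < \<theta>"
    and d: "\<And>i. i < N \<Longrightarrow> shell i \<noteq> k \<Longrightarrow> d i = 0" and b: "\<And>i. i < N \<Longrightarrow> \<not> shell i \<le> k \<Longrightarrow> b i = 0"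
    and R: "\<And>i. i < N \<Longrightarrow> (\<Sum>j<N. exp (- T k * (x i - x j)\<^sup>2)) \<le> R i"
  shows "\<bar>\<Sum>i<N. \<Sum>j<N. d i * b j * heat_cos t (x i) (x j)\<bar> \<le>
     8 * exp (16 * pi) * (sqrt (T k) * exp (- (1/16) * T k * t)) *
       (\<theta> * (\<Sum>i<N. R i * (d i)\<^sup>2) + (\<Sum>i<N. R i * (b i)\<^sup>2) / \<theta>)"
proof -
  define a s where "a = heat_a t" and "s = heat_s t"
  have par: "mehler_parameters a s" unfolding a_def s_def by (rule heat_parameters[OF t(1)])
  interpret A: mehler_parameters a s by (rule par)
  have hb: "t / 8 \<le> a" "a \<le> t / 2" "1 / 2 \<le> s" unfolding a_def s_def by (rule heat_bounds[OF t])+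
  have s1: "s \<le> 1"
  proof (rule power2_le_imp_le)
    show "s\<^sup>2 \<le> 1\<^sup>2" using A.circle zero_le_power2[of a] unfolding one_power2 by linarith
  qed simp
  define T' where "T' = T k"
  have T: "1 \<le> T'" unfolding T'_def by (rule T_ge)
  define a0 where "a0 = 1 / (2 * T')"
  have a0: "0 < a0" "a0 \<le> 1 / 2" using T by (auto simp: a0_def divide_le_eq)
  define s0 where "s0 = sqrt (1 - a0\<^sup>2)"
  have "a0\<^sup>2 \<le> (1/2)\<^sup>2" using a0 by (intro power_mono) auto
  then have a02: "a0\<^sup>2 \<le> 1/4" by (simp add: power2_eq_square)
  have s02: "s0\<^sup>2 = 1 - a0\<^sup>2" unfolding s0_def using a02 by simp
  have s0: "1 / 2 \<le> s0"
  proof (rule power2_le_imp_le)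
    show "(1/2)\<^sup>2 \<le> s0\<^sup>2" unfolding s02 using a02 by (simp add: power2_eq_square)
  qed (use a02 in \<open>simp add: s0_def\<close>)
  have par0: "mehler_parameters a0 s0" by unfold_locales (use a0 s0 s02 in auto)
  interpret B: mehler_parameters a0 s0 by (rule par0)
  define \<kappa> where "\<kappa> = sqrt (s / s0)"
  have k2: "\<kappa>\<^sup>2 = s / s0" using hb s0 by (simp add: \<kappa>_def)
  have "s / s0 \<le> 1 / (1/2)" using s1 hb s0 by (intro frac_le) auto
  then have k2le: "\<kappa>\<^sup>2 \<le> 2" by (simp add: k2)
  define W where "W i = exp (- pi * (a - a0 * \<kappa>\<^sup>2) * (x i)\<^sup>2)" for i
  define E where "E = exp (8 * pi)"
  define q where "q = exp (- (1/16) * T' * t)"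
  have q0: "0 < q" by (simp add: q_def)
  have W0: "0 \<le> W i" for i by (simp add: W_def)
  have W_le: "W i \<le> E * exp (- pi * a * (x i)\<^sup>2)" if "shell i \<le> k" for i
  proof -
    have "a0 * \<kappa>\<^sup>2 * (x i)\<^sup>2 \<le> a0 * 2 * (8 * T')"
      using k2le a0 x_sq_le_T[OF that] by (intro mult_mono) (auto simp: T'_def)
    also have "\<dots> = 8" using T by (simp add: a0_def)
    finally have "pi * (a0 * \<kappa>\<^sup>2 * (x i)\<^sup>2) \<le> pi * 8" by (intro mult_left_mono) auto
    then have "- pi * (a - a0 * \<kappa>\<^sup>2) * (x i)\<^sup>2 \<le> 8 * pi + - pi * a * (x i)\<^sup>2" by (simp add: algebra_simps)
    then have "W i \<le> exp (8 * pi + - pi * a * (x i)\<^sup>2)" unfolding W_def by simp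
    then show ?thesis by (simp only: E_def exp_add)
  qed
  have Wb: "(b i * W i)\<^sup>2 \<le> E\<^sup>2 * (b i)\<^sup>2" if "i < N" for i
  proof (cases "shell i \<le> k")
    case True
    have "W i \<le> E * 1" using W_le[OF True] A.a by (rule_tac order_trans[OF _ mult_left_mono]) (auto simp: E_def)
    then have "(W i)\<^sup>2 \<le> E\<^sup>2" using W0[of i] by (intro power_mono) auto
    from mult_right_mono[OF this, of "(b i)\<^sup>2"]
    show ?thesis by (simp add: power_mult_distrib mult.commute)
  qed (use b that in auto)
  have Wd: "(d i * W i)\<^sup>2 \<le> 4 * E\<^sup>2 * q\<^sup>2 * (d i)\<^sup>2" if "i < N" for i
  proof (cases "shell i = k")
    case True
    have "T' / 4 - 1 \<le> (x i)\<^sup>2" using T_shell_le[of i] by (simp add: True T'_def)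
    then have "t / 4 * (T' / 4 - 1) \<le> t / 4 * (x i)\<^sup>2" using t by (intro mult_left_mono) auto
    also have "t / 4 * (x i)\<^sup>2 = 2 * (t / 8) * (x i)\<^sup>2" by simp
    also have "\<dots> \<le> pi * a * (x i)\<^sup>2" using pi_ge_two hb t by (intro mult_right_mono mult_mono) auto
    finally have "- pi * a * (x i)\<^sup>2 \<le> t / 4 + - (1/16) * T' * t" by (simp add: algebra_simps)
    also have "\<dots> \<le> ln 2 + - (1/16) * T' * t" using t ln2_bounds by simp
    finally have "exp (- pi * a * (x i)\<^sup>2) \<le> exp (ln 2 + - (1/16) * T' * t)" by simp
    also have "\<dots> = 2 * q" by (simp only: exp_add q_def) simp
    finally have "E * exp (- pi * a * (x i)\<^sup>2) \<le> E * (2 * q)" by (intro mult_left_mono) (auto simp: E_def)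
    then have "W i \<le> E * (2 * q)" using W_le[of i] True by simp
    then have "(W i)\<^sup>2 \<le> (E * (2 * q))\<^sup>2" using W0[of i] by (intro power_mono) auto
    also have "\<dots> = 4 * E\<^sup>2 * q\<^sup>2" by (simp add: power_mult_distrib)
    finally have "(d i)\<^sup>2 * (W i)\<^sup>2 \<le> (d i)\<^sup>2 * (4 * E\<^sup>2 * q\<^sup>2)" by (rule mult_left_mono) simp
    then show ?thesis by (simp add: power_mult_distrib mult_ac)
  qed (use d that in auto)
  have gk: "gauss_kernel a0 s0 (\<kappa> * y) (\<kappa> * z) \<le> 2 * sqrt T' * exp (- T' * (y - z)\<^sup>2)" for y z
  proof -
    have "(1 + a0) / a0 \<le> 2 / a0" using a0 by (intro divide_right_mono) auto
    also have "\<dots> = 4 * T'" by (simp add: a0_def)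
    finally have "sqrt ((1 + a0) / a0) \<le> sqrt (4 * T')" by simp
    also have "\<dots> = 2 * sqrt T'" by (simp add: real_sqrt_mult)
    finally have pre: "sqrt ((1 + a0) / a0) \<le> 2 * sqrt T'" .
    have s01: "s0 \<le> 1" unfolding s0_def by simp
    have "(\<kappa> * y)\<^sup>2 + (\<kappa> * z)\<^sup>2 - 2 * s0 * (\<kappa> * y) * (\<kappa> * z) = \<kappa>\<^sup>2 * s0 * (y - z)\<^sup>2 + \<kappa>\<^sup>2 * (1 - s0) * (y\<^sup>2 + z\<^sup>2)"
      by (simp add: power2_eq_square algebra_simps)
    moreover have "0 \<le> \<kappa>\<^sup>2 * (1 - s0) * (y\<^sup>2 + z\<^sup>2)" using s01 by simp
    moreover have "\<kappa>\<^sup>2 * s0 = s" using s0 by (simp add: k2)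
    ultimately have "s * (y - z)\<^sup>2 \<le> (\<kappa> * y)\<^sup>2 + (\<kappa> * z)\<^sup>2 - 2 * s0 * (\<kappa> * y) * (\<kappa> * z)" by simp
    moreover have "1/2 * (y - z)\<^sup>2 \<le> s * (y - z)\<^sup>2" using hb by (intro mult_right_mono) auto
    ultimately have "1/2 * (y - z)\<^sup>2 \<le> (\<kappa> * y)\<^sup>2 + (\<kappa> * z)\<^sup>2 - 2 * s0 * (\<kappa> * y) * (\<kappa> * z)" by linarith
    then have "pi * (1/2 * (y - z)\<^sup>2) / a0 \<le> pi * ((\<kappa> * y)\<^sup>2 + (\<kappa> * z)\<^sup>2 - 2 * s0 * (\<kappa> * y) * (\<kappa> * z)) / a0"
      using a0 by (intro divide_right_mono mult_left_mono) auto
    moreover have "pi * (1/2 * (y - z)\<^sup>2) / a0 = pi * (T' * (y - z)\<^sup>2)" by (simp add: a0_def)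
    moreover have "1 * (T' * (y - z)\<^sup>2) \<le> pi * (T' * (y - z)\<^sup>2)" using pi_ge_two T by (intro mult_right_mono) auto
    ultimately have "T' * (y - z)\<^sup>2 \<le> pi * ((\<kappa> * y)\<^sup>2 + (\<kappa> * z)\<^sup>2 - 2 * s0 * (\<kappa> * y) * (\<kappa> * z)) / a0" by linarith
    then have "- pi * ((\<kappa> * y)\<^sup>2 + (\<kappa> * z)\<^sup>2 - 2 * s0 * (\<kappa> * y) * (\<kappa> * z)) / a0 \<le> - T' * (y - z)\<^sup>2"
      by simp
    then show ?thesis unfolding gauss_kernel_def using pre T a0 by (intro mult_mono) auto
  qed
  have form: "(\<Sum>i<N. \<Sum>j<N. p i * p j * gauss_kernel a0 s0 (\<kappa> * x i) (\<kappa> * x j)) \<le> 2 * sqrt T' * (\<Sum>i<N. R i * (p i)\<^sup>2)" for p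
  proof -
    have "(\<Sum>i<N. \<Sum>j<N. p i * p j * gauss_kernel a0 s0 (\<kappa> * x i) (\<kappa> * x j))
       \<le> (\<Sum>i<N. \<Sum>j<N. 2 * sqrt T' * (exp (- T' * (x i - x j)\<^sup>2) * (\<bar>p i\<bar> * \<bar>p j\<bar>)))"
    proof (intro sum_mono)
      fix i j
      have "p i * p j * gauss_kernel a0 s0 (\<kappa> * x i) (\<kappa> * x j) \<le> (\<bar>p i\<bar> * \<bar>p j\<bar>) * gauss_kernel a0 s0 (\<kappa> * x i) (\<kappa> * x j)"
        using gauss_kernel_nonneg[OF a0(1)] by (intro mult_right_mono) (auto simp flip: abs_mult)
      also have "\<dots> \<le> (\<bar>p i\<bar> * \<bar>p j\<bar>) * (2 * sqrt T' * exp (- T' * (x i - x j)\<^sup>2))"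
        by (intro mult_left_mono gk) auto
      finally show "p i * p j * gauss_kernel a0 s0 (\<kappa> * x i) (\<kappa> * x j) \<le> 2 * sqrt T' * (exp (- T' * (x i - x j)\<^sup>2) * (\<bar>p i\<bar> * \<bar>p j\<bar>))"
        by (simp add: mult_ac)
    qed
    also have "\<dots> = 2 * sqrt T' * (\<Sum>i<N. \<Sum>j<N. exp (- T' * (x i - x j)\<^sup>2) * (\<bar>p i\<bar> * \<bar>p j\<bar>))"
      by (simp add: sum_distrib_left)
    also have "\<dots> \<le> 2 * sqrt T' * (\<Sum>i<N. R i * (p i)\<^sup>2)"
      by (intro mult_left_mono schur_symmetric) (use T R in \<open>auto simp: T'_def power2_commute\<close>)
    finally show ?thesis .
  qed
  have R0: "0 \<le> R i" if "i < N" for i using R[OF that] by (rule order_trans[rotated]) (auto intro: sum_nonneg)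
  have Fd: "(\<Sum>i<N. \<Sum>j<N. (d i * W i) * (d j * W j) * gauss_kernel a0 s0 (\<kappa> * x i) (\<kappa> * x j))
      \<le> 2 * sqrt T' * (4 * E\<^sup>2 * q\<^sup>2 * (\<Sum>i<N. R i * (d i)\<^sup>2))"
  proof -
    have "(\<Sum>i<N. R i * (d i * W i)\<^sup>2) \<le> (\<Sum>i<N. R i * (4 * E\<^sup>2 * q\<^sup>2 * (d i)\<^sup>2))"
      by (intro sum_mono mult_left_mono Wd R0) auto
    also have "\<dots> = 4 * E\<^sup>2 * q\<^sup>2 * (\<Sum>i<N. R i * (d i)\<^sup>2)" by (simp add: sum_distrib_left mult_ac)
    finally have "2 * sqrt T' * (\<Sum>i<N. R i * (d i * W i)\<^sup>2) \<le> 2 * sqrt T' * (4 * E\<^sup>2 * q\<^sup>2 * (\<Sum>i<N. R i * (d i)\<^sup>2))"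
      using T by (intro mult_left_mono) auto
    then show ?thesis using form[of "\<lambda>i. d i * W i"] by linarith
  qed
  have Fb: "(\<Sum>i<N. \<Sum>j<N. (b i * W i) * (b j * W j) * gauss_kernel a0 s0 (\<kappa> * x i) (\<kappa> * x j))
      \<le> 2 * sqrt T' * (E\<^sup>2 * (\<Sum>i<N. R i * (b i)\<^sup>2))"
  proof -
    have "(\<Sum>i<N. R i * (b i * W i)\<^sup>2) \<le> (\<Sum>i<N. R i * (E\<^sup>2 * (b i)\<^sup>2))"
      by (intro sum_mono mult_left_mono Wb R0) auto
    also have "\<dots> = E\<^sup>2 * (\<Sum>i<N. R i * (b i)\<^sup>2)" by (simp add: sum_distrib_left mult_ac)
    finally have "2 * sqrt T' * (\<Sum>i<N. R i * (b i * W i)\<^sup>2) \<le> 2 * sqrt T' * (E\<^sup>2 * (\<Sum>i<N. R i * (b i)\<^sup>2))"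
      using T by (intro mult_left_mono) auto
    then show ?thesis using form[of "\<lambda>i. b i * W i"] by linarith
  qed
  define \<rho> where "\<rho> = sqrt ((1 + a) / (1 + a0))"
  have \<rho>: "0 \<le> \<rho>" "\<rho> \<le> 2"
  proof -
    show "0 \<le> \<rho>" using A.a a0 by (simp add: \<rho>_def)
    have "(1 + a) / (1 + a0) \<le> 2 / 1" using A.a a0 by (intro frac_le) auto
    then show "\<rho> \<le> 2" unfolding \<rho>_def by (intro real_le_lsqrt) auto
  qed
  define X Y where "X = (\<Sum>i<N. R i * (d i)\<^sup>2)" and "Y = (\<Sum>i<N. R i * (b i)\<^sup>2)"
  have XY: "0 \<le> X" "0 \<le> Y" unfolding X_def Y_def using R0 by (auto intro!: sum_nonneg mult_nonneg_nonneg)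
  have eq: "(\<Sum>i<N. \<Sum>j<N. d i * b j * cos_kernel a s (x i) (x j)) =
     \<rho> * (\<Sum>i<N. \<Sum>j<N. (d i * W i) * (b j * W j) * cos_kernel a0 s0 (\<kappa> * x i) (\<kappa> * x j))"
    unfolding cos_kernel_rescale[OF par par0, folded \<kappa>_def \<rho>_def W_def] W_def sum_distrib_left
    by (intro sum.cong refl) (simp add: mult_ac)
  \<comment> \<open>The decay \<open>q\<close> is present in one of the two vectors only; this choice of the parameter shares it out between both terms.\<close>
  have th: "0 < \<theta> / q" using \<theta> q0 by simp
  have "\<bar>\<Sum>i<N. \<Sum>j<N. d i * b j * cos_kernel a s (x i) (x j)\<bar> \<le>
      2 * \<bar>\<Sum>i<N. \<Sum>j<N. (d i * W i) * (b j * W j) * cos_kernel a0 s0 (\<kappa> * x i) (\<kappa> * x j)\<bar>"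
    unfolding eq abs_mult using \<rho> by (intro mult_right_mono) auto
  also have "\<dots> \<le> 2 * ((\<theta> / q * (\<Sum>i<N. \<Sum>j<N. (d i * W i) * (d j * W j) * gauss_kernel a0 s0 (\<kappa> * x i) (\<kappa> * x j))
      + (\<Sum>i<N. \<Sum>j<N. (b i * W i) * (b j * W j) * gauss_kernel a0 s0 (\<kappa> * x i) (\<kappa> * x j)) / (\<theta> / q)) / 2)"
    by (intro mult_left_mono B.cos_kernel_form_le th) auto
  also have "\<dots> \<le> 2 * ((\<theta> / q * (2 * sqrt T' * (4 * E\<^sup>2 * q\<^sup>2 * X)) + (2 * sqrt T' * (E\<^sup>2 * Y)) / (\<theta> / q)) / 2)"
    unfolding X_def Y_def using th by (intro mult_left_mono divide_right_mono add_mono Fd Fb) auto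
  also have "\<dots> = 2 * E\<^sup>2 * (sqrt T' * q) * (4 * (\<theta> * X) + Y / \<theta>)"
    using q0 \<theta> by (simp add: field_simps power2_eq_square)
  also have "\<dots> \<le> 2 * E\<^sup>2 * (sqrt T' * q) * (4 * (\<theta> * X) + 4 * (Y / \<theta>))"
  proof -
    have "0 \<le> Y / \<theta>" using XY \<theta> by simp
    then have "4 * (\<theta> * X) + Y / \<theta> \<le> 4 * (\<theta> * X) + 4 * (Y / \<theta>)" by linarith
    then show ?thesis using q0 T by (intro mult_left_mono) auto
  qed
  also have "\<dots> = 8 * E\<^sup>2 * (sqrt T' * q) * (\<theta> * X + Y / \<theta>)" by (simp add: algebra_simps)
  also have "E\<^sup>2 = exp (16 * pi)" by (simp add: E_def power2_eq_square flip: exp_add)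
  finally show ?thesis by (simp only: a_def s_def T'_def q_def X_def Y_def)
qed

end

text \<open>Integration over \<open>t\<close> of the previous bound: the factor \<open>sqrt (T k)\<close> cancels and the logarithm of \<open>T k\<close> remains.\<close>

lemma kernel_Q_shell_le:
  obtains C where "0 < C"
    "\<And>\<beta> \<eta> N k d b R \<theta>. 0 \<le> \<beta> \<Longrightarrow> \<beta> \<le> 1/2 \<Longrightarrow> 0 < \<eta> \<Longrightarrow> \<eta> \<le> 1 \<Longrightarrow> 0 < \<theta> \<Longrightarrow>
       (\<And>i. i < N \<Longrightarrow> shell i \<noteq> k \<Longrightarrow> d i = 0) \<Longrightarrow> (\<And>i. i < N \<Longrightarrow> \<not> shell i \<le> k \<Longrightarrow> b i = 0) \<Longrightarrow>
       (\<And>i. i < N \<Longrightarrow> (\<Sum>j<N. exp (- nodes.T \<beta> k * (node_star \<beta> i - node_star \<beta> j)\<^sup>2)) \<le> R i) \<Longrightarrow>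
       \<bar>\<Sum>i<N. \<Sum>j<N. d i * b j * kernel_Q \<eta> (node_star \<beta> i) (node_star \<beta> j)\<bar> \<le>
         C * (real k + 1) powr (- (1 + \<eta>)) * (\<theta> * (\<Sum>i<N. R i * (d i)\<^sup>2) + (\<Sum>i<N. R i * (b i)\<^sup>2) / \<theta>)"
proof -
  obtain C where C: "0 < C" and int: "\<And>\<eta> T. 0 < \<eta> \<Longrightarrow> \<eta> \<le> 1 \<Longrightarrow> 0 < T \<Longrightarrow> set_integrable lborel J (\<lambda>t. weight \<eta> t * exp (- (1/16) * T * t))"
    and le: "\<And>\<eta> T. 0 < \<eta> \<Longrightarrow> \<eta> \<le> 1 \<Longrightarrow> 0 < T \<Longrightarrow>
       (LBINT t:J. weight \<eta> t * exp (- (1/16) * T * t)) \<le> C * (ln (exp 1 + T) powr (- (1 + \<eta>)) * T powr (- 1/2))"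
    using integral_weight_exp_le[of "1/16"] by auto
  define C' where "C' = 4 * exp (16 * pi) * (C * 144)"
  show ?thesis
  proof (rule that[of C'])
    show "0 < C'" using C by (simp add: C'_def)
    fix \<beta> \<eta> \<theta> :: real and N k :: nat and d b R :: "nat \<Rightarrow> real"
    assume h: "0 \<le> \<beta>" "\<beta> \<le> 1/2" and \<eta>: "0 < \<eta>" "\<eta> \<le> 1" and \<theta>: "0 < \<theta>"
      and db: "\<And>i. i < N \<Longrightarrow> shell i \<noteq> k \<Longrightarrow> d i = 0" "\<And>i. i < N \<Longrightarrow> \<not> shell i \<le> k \<Longrightarrow> b i = 0"
      and R: "\<And>i. i < N \<Longrightarrow> (\<Sum>j<N. exp (- nodes.T \<beta> k * (node_star \<beta> i - node_star \<beta> j)\<^sup>2)) \<le> R i"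
    interpret nodes \<beta> by unfold_locales (use h in auto)
    define Z where "Z = \<theta> * (\<Sum>i<N. R i * (d i)\<^sup>2) + (\<Sum>i<N. R i * (b i)\<^sup>2) / \<theta>"
    have R0: "0 \<le> R i" if "i < N" for i using R[OF that] by (rule order_trans[rotated]) (auto intro: sum_nonneg)
    have Z0: "0 \<le> Z" unfolding Z_def using R0 \<theta> by (auto intro!: add_nonneg_nonneg sum_nonneg mult_nonneg_nonneg divide_nonneg_nonneg)
    have T: "1 \<le> T k" by (rule T_ge)
    define u where "u i j t = d i * b j * (weight \<eta> t * exp (- t) * heat_cos t (x i) (x j) / 2)" for i j t
    have iu: "set_integrable lborel J (u i j)" for i j
      unfolding u_def using integrable_weight_heat(3)[OF \<eta>(1) x_nonneg x_nonneg, of i j] by (intro set_integrable_mult_right set_integrable_divide)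
    define F where "F t = (\<Sum>i<N. \<Sum>j<N. d i * b j * heat_cos t (x i) (x j))" for t
    have sumu: "(\<Sum>i<N. \<Sum>j<N. u i j t) = weight \<eta> t * exp (- t) / 2 * F t" for t
      unfolding u_def F_def sum_distrib_left by (intro sum.cong refl) (simp add: mult_ac)
    have "(\<Sum>i<N. \<Sum>j<N. d i * b j * kernel_Q \<eta> (x i) (x j)) = (\<Sum>i<N. \<Sum>j<N. LBINT t:J. u i j t)"
      unfolding kernel_Q_def u_def by (simp only: set_integral_mult_right)
    also have "\<dots> = (LBINT t:J. \<Sum>i<N. \<Sum>j<N. u i j t)"
      by (simp only: set_integral_sum_finite iu)
    also have "\<dots> = (LBINT t:J. weight \<eta> t * exp (- t) / 2 * F t)" unfolding sumu ..
    finally have Qeq: "(\<Sum>i<N. \<Sum>j<N. d i * b j * kernel_Q \<eta> (x i) (x j)) = (LBINT t:J. weight \<eta> t * exp (- t) / 2 * F t)" .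
    have iF: "set_integrable lborel J (\<lambda>t. weight \<eta> t * exp (- t) / 2 * F t)"
      unfolding sumu[symmetric] by (intro set_integral_sum_finite iu)
    define A where "A = 4 * exp (16 * pi) * sqrt (T k) * Z"
    have A0: "0 \<le> A" unfolding A_def using Z0 T by simp
    have pt: "\<bar>weight \<eta> t * exp (- t) / 2 * F t\<bar> \<le> A * (weight \<eta> t * exp (- (1/16) * T k * t))" if tJ: "t \<in> J" for t
    proof -
      note t = J_bounds(1)[OF tJ] less_imp_le[OF J_bounds(3)[OF tJ]]
      have "\<bar>F t\<bar> \<le> 8 * exp (16 * pi) * (sqrt (T k) * exp (- (1/16) * T k * t)) * Z"
        unfolding F_def Z_def by (rule cos_form_shell_le[OF t \<theta> db R])
      then have "weight \<eta> t * exp (- t) / 2 * \<bar>F t\<bar> \<le> weight \<eta> t * 1 / 2 * (8 * exp (16 * pi) * (sqrt (T k) * exp (- (1/16) * T k * t)) * Z)"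
        using weight_nonneg[OF tJ, of \<eta>] t by (intro mult_mono divide_right_mono) auto
      then show ?thesis using weight_nonneg[OF tJ, of \<eta>] by (simp add: abs_mult A_def mult_ac)
    qed
    have iA: "set_integrable lborel J (\<lambda>t. A * (weight \<eta> t * exp (- (1/16) * T k * t)))"
      by (intro set_integrable_mult_right int \<eta>) (use T in auto)
    have "\<bar>LBINT t:J. weight \<eta> t * exp (- t) / 2 * F t\<bar> \<le> (LBINT t:J. \<bar>weight \<eta> t * exp (- t) / 2 * F t\<bar>)"
      using set_integral_norm_bound[OF iF] by simp
    also have "\<dots> \<le> (LBINT t:J. A * (weight \<eta> t * exp (- (1/16) * T k * t)))"
      by (intro set_integral_mono set_integrable_abs iF iA pt)
    also have "\<dots> = A * (LBINT t:J. weight \<eta> t * exp (- (1/16) * T k * t))" by (rule set_integral_mult_right)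
    also have "\<dots> \<le> A * (C * (ln (exp 1 + T k) powr (- (1 + \<eta>)) * T k powr (- 1/2)))"
      using A0 T by (intro mult_left_mono le \<eta>) auto
    also have "\<dots> \<le> A * (C * (((real k + 1) powr (- (1 + \<eta>)) * 144) * T k powr (- 1/2)))"
    proof -
      have "ln (exp 1 + T k) powr (- (1 + \<eta>)) \<le> ((real k + 1) / 12) powr (- (1 + \<eta>))"
        using lg_T_ge[of k] \<eta> by (intro powr_mono2') (auto simp: lg_def)
      also have "\<dots> = (real k + 1) powr (- (1 + \<eta>)) * 12 powr (1 + \<eta>)"
        by (simp only: powr_divide[of "real k + 1" 12] powr_minus_divide) simp
      also have "\<dots> \<le> (real k + 1) powr (- (1 + \<eta>)) * 12 powr 2" using \<eta> by (intro mult_left_mono powr_mono) auto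
      finally have "ln (exp 1 + T k) powr (- (1 + \<eta>)) \<le> (real k + 1) powr (- (1 + \<eta>)) * 144" by simp
      then show ?thesis using A0 C by (intro mult_left_mono mult_right_mono) auto
    qed
    also have "\<dots> = C' * (real k + 1) powr (- (1 + \<eta>)) * Z * (sqrt (T k) * T k powr (- 1/2))"
      by (simp add: A_def C'_def)
    also have "sqrt (T k) * T k powr (- 1/2) = 1"
      using T by (simp add: powr_half_sqrt powr_minus_divide)
    finally show "\<bar>\<Sum>i<N. \<Sum>j<N. d i * b j * kernel_Q \<eta> (x i) (x j)\<bar> \<le>
         C' * (real k + 1) powr (- (1 + \<eta>)) * (\<theta> * (\<Sum>i<N. R i * (d i)\<^sup>2) + (\<Sum>i<N. R i * (b i)\<^sup>2) / \<theta>)"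
      unfolding Qeq Z_def by simp
  qed
qed

lemma sum_powr_tail_le:
  fixes p :: real
  assumes p: "0 < p"
  shows "(\<Sum>k\<in>{s..<N}. (real k + 1) powr (- 1 - p)) \<le> (real s + 1) powr (- p) * (1 + 1 / p)"
proof -
  have tail: "(real n + 2) powr (- 1 - p) \<le> ((real n + 1) powr (- p) - (real n + 2) powr (- p)) / p" for n :: nat
  proof -
    have "((\<lambda>v. v powr (- p)) has_real_derivative (- p * v powr (- p - 1))) (at v)" if "0 < v" for v
      using that by (auto intro!: derivative_eq_intros)
    then have "\<exists>\<xi>. real n + 1 < \<xi> \<and> \<xi> < real n + 2 \<and>
        (real n + 2) powr (- p) - (real n + 1) powr (- p) = (real n + 2 - (real n + 1)) * (- p * \<xi> powr (- p - 1))"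
      by (intro MVT2) auto
    then obtain \<xi> where \<xi>: "real n + 1 < \<xi>" "\<xi> < real n + 2"
      and eq: "(real n + 2) powr (- p) - (real n + 1) powr (- p) = - p * \<xi> powr (- p - 1)" by auto
    have mono: "(real n + 2) powr (- p - 1) \<le> \<xi> powr (- p - 1)" using \<xi> p by (intro powr_mono2') auto
    then have "p * (real n + 2) powr (- p - 1) \<le> (real n + 1) powr (- p) - (real n + 2) powr (- p)"
      using eq mult_left_mono[OF mono less_imp_le[OF p]] unfolding mult_minus_left by linarith
    then have "(real n + 2) powr (- p - 1) \<le> ((real n + 1) powr (- p) - (real n + 2) powr (- p)) / p"
      using p by (simp add: le_divide_eq mult.commute)
    moreover have "- 1 - p = - p - 1" by simp
    ultimately show ?thesis by (simp only:)
  qed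
  have "(\<Sum>k\<in>{s..<N}. (real k + 1) powr (- 1 - p)) \<le> (real s + 1) powr (- 1 - p) + ((real s + 1) powr (- p) - (real N) powr (- p)) / p"
    if "Suc s \<le> N"
    using that
  proof (induction N rule: dec_induct)
    case base
    show ?case by (simp add: add.commute)
  next
    case (step n)
    then obtain m where m: "n = Suc m" by (cases n) auto
    have "(\<Sum>k\<in>{s..<Suc n}. (real k + 1) powr (- 1 - p)) = (\<Sum>k\<in>{s..<n}. (real k + 1) powr (- 1 - p)) + (real n + 1) powr (- 1 - p)"
      using step(1) by simp
    moreover have "(real n + 1) powr (- 1 - p) \<le> (real n powr (- p) - real (Suc n) powr (- p)) / p"
      using tail[of m] by (simp add: m add.commute)
    ultimately show ?case using step.IH unfolding diff_divide_distrib by linarith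
  qed
  moreover have "(real s + 1) powr (- 1 - p) \<le> (real s + 1) powr (- p)" by (intro powr_mono) auto
  moreover have "0 \<le> real N powr (- p) / p" using p by simp
  moreover have "0 \<le> (real s + 1) powr (- p) * (1 + 1 / p)" using p by simp
  moreover have "(real s + 1) powr (- p) * (1 + 1 / p) = (real s + 1) powr (- p) + (real s + 1) powr (- p) / p"
    by (simp add: distrib_left)
  moreover have "(\<Sum>k\<in>{s..<N}. (real k + 1) powr (- 1 - p)) = 0" if "\<not> Suc s \<le> N"
    using that by simp
  ultimately show ?thesis unfolding diff_divide_distrib by linarith
qed

lemma sum_half_powers_le: "(\<Sum>k\<in>{s..<N}. 2 powr (- (real k - real s) / 2)) \<le> 4"
proof -
  define q where "q = 2 powr (- 1 / 2 :: real)"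
  have q0: "0 \<le> q" by (simp add: q_def)
  have "q\<^sup>2 = 2 powr (- 1 / 2 + - 1 / 2)" by (simp only: q_def power2_eq_square powr_add)
  then have "q\<^sup>2 = 1 / 2" by (simp add: powr_minus_divide)
  then have "q\<^sup>2 \<le> (3/4)\<^sup>2" by (simp add: power2_eq_square)
  then have q: "q \<le> 3/4" by (rule power2_le_imp_le) simp
  have "(\<Sum>k\<in>{s..<N}. 2 powr (- (real k - real s) / 2)) = (\<Sum>k\<in>{s..<N}. q ^ (k - s))"
  proof (rule sum.cong)
    fix k assume "k \<in> {s..<N}"
    then have "real (k - s) = real k - real s" by (simp add: of_nat_diff)
    then have "- (real k - real s) / 2 = (- 1 / 2) * real (k - s)" by (simp add: field_simps)
    then show "2 powr (- (real k - real s) / 2) = q ^ (k - s)"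
      by (simp only: q_def powr_powr[symmetric] powr_realpow[symmetric] powr_gt_zero)
  qed simp
  also have "\<dots> = (\<Sum>m<N - s. q ^ m)"
    by (subst sum.atLeastLessThan_shift_0) (simp add: atLeast0LessThan)
  also have "\<dots> \<le> (\<Sum>m. q ^ m)" using q q0 by (intro sum_le_suminf summable_geometric) auto
  also have "\<dots> = 1 / (1 - q)" using q q0 by (intro suminf_geometric) auto
  also have "\<dots> \<le> 1 / (1 / 4)" using q by (intro divide_left_mono) auto
  finally show ?thesis by simp
qed

lemma kernel_Q_commute: "kernel_Q \<eta> x y = kernel_Q \<eta> y x"
  unfolding kernel_Q_def cos_kernel_def by (simp add: mult_ac add.commute)

text \<open>By symmetry the form is the sum over \<open>k\<close> of the pairings of the \<open>k\<close>-th shell \<open>d k\<close> with the vector \<open>b k\<close>,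
  which is the same shell plus twice all lower ones. The lower shells must be kept together: their Gaussian row sums are of order 1 while
  that of the shell itself is of order \<open>(k + 1) powr \<gamma>\<close>. With \<open>\<theta> = \<mu> (k + 1) powr (1 - \<gamma>)\<close> the coefficient of
  \<open>(c i)\<^sup>2\<close> consists of \<open>\<mu> (k + 1) powr (- \<eta>)\<close> from the shell containing \<open>i\<close>, of \<open>(k + 1) powr (- 1 - p) / \<mu>\<close> from every shell
  above, and of a geometrically decaying term. The tail of the second kind is at most \<open>(1 + 1 / p) / \<mu>\<close> times the
  desired weight, and \<open>\<mu> = sqrt (1 + 1 / p)\<close> balances it against the first.\<close>

lemma kernel_Q_form_le:
  obtains C where "0 < C"
    "\<And>\<beta> \<eta> N c. 0 \<le> \<beta> \<Longrightarrow> \<beta> \<le> 1/2 \<Longrightarrow> 0 < \<eta> \<Longrightarrow> \<eta> \<le> 1 \<Longrightarrow>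
       \<bar>\<Sum>i<N. \<Sum>j<N. c i * c j * kernel_Q \<eta> (node_star \<beta> i) (node_star \<beta> j)\<bar>
         \<le> C * sqrt (1 + 1 / (1 - 2 * \<beta> + \<eta>)) * (\<Sum>i<N. lg (real i) powr (- \<eta>) * (c i)\<^sup>2)"
proof -
  obtain C1 where C1: "0 < C1" and shell_bound:
    "\<And>\<beta> \<eta> N k d b R \<theta>. 0 \<le> \<beta> \<Longrightarrow> \<beta> \<le> 1/2 \<Longrightarrow> 0 < \<eta> \<Longrightarrow> \<eta> \<le> 1 \<Longrightarrow> 0 < \<theta> \<Longrightarrow>
       (\<And>i. i < N \<Longrightarrow> shell i \<noteq> k \<Longrightarrow> d i = 0) \<Longrightarrow> (\<And>i. i < N \<Longrightarrow> \<not> shell i \<le> k \<Longrightarrow> b i = 0) \<Longrightarrow>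
       (\<And>i. i < N \<Longrightarrow> (\<Sum>j<N. exp (- nodes.T \<beta> k * (node_star \<beta> i - node_star \<beta> j)\<^sup>2)) \<le> R i) \<Longrightarrow>
       \<bar>\<Sum>i<N. \<Sum>j<N. d i * b j * kernel_Q \<eta> (node_star \<beta> i) (node_star \<beta> j)\<bar> \<le>
         C1 * (real k + 1) powr (- (1 + \<eta>)) * (\<theta> * (\<Sum>i<N. R i * (d i)\<^sup>2) + (\<Sum>i<N. R i * (b i)\<^sup>2) / \<theta>)"
    using kernel_Q_shell_le by blast
  obtain C2 where C2: "0 < C2" and row:
    "\<And>\<beta> i k N. 0 \<le> \<beta> \<Longrightarrow> \<beta> \<le> 1/2 \<Longrightarrow> shell i \<le> k \<Longrightarrow> i < N \<Longrightarrow>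
       (\<Sum>j<N. exp (- nodes.T \<beta> k * (node_star \<beta> i - node_star \<beta> j)\<^sup>2))
         \<le> C2 * (1 + (real k + 1) powr (2 * \<beta>) * 2 powr (- (real k - real (shell i)) / 2))"
    using gauss_row_sum by blast
  define C where "C = C1 * (C2 * 22) * 2"
  show ?thesis
  proof (rule that[of C])
    show "0 < C" using C1 C2 by (simp add: C_def)
    fix \<beta> \<eta> :: real and N :: nat and c :: "nat \<Rightarrow> real"
    assume h: "0 \<le> \<beta>" "\<beta> \<le> 1/2" and \<eta>: "0 < \<eta>" "\<eta> \<le> 1"
    interpret nodes \<beta> by unfold_locales (use h in auto)
    define p where "p = 1 - \<gamma> + \<eta>"
    have p: "0 < p" "\<eta> \<le> p" using \<gamma> \<eta> by (auto simp: p_def)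
    define \<mu> where "\<mu> = sqrt (1 + 1 / p)"
    have mu2: "\<mu> * \<mu> = 1 + 1 / p" using p by (simp add: \<mu>_def)
    have mu1: "1 \<le> \<mu>" unfolding \<mu>_def using p by simp
    define d b where "d k i = (if shell i = k then c i else 0)"
      and "b k i = (if shell i = k then c i else if shell i < k then 2 * c i else 0)" for k i
    define Q where "Q i j = kernel_Q \<eta> (x i) (x j)" for i j
    have Qsym: "Q i j = Q j i" for i j unfolding Q_def by (rule kernel_Q_commute)
    define S where "S k = (\<Sum>i<N. \<Sum>j<N. d k i * b k j * Q i j)" for k
    have total: "(\<Sum>k<N. S k) = (\<Sum>i<N. \<Sum>j<N. c i * c j * Q i j)"
    proof -
      \<comment> \<open>The multiplicity with which the pair \<open>(i, j)\<close> is counted; adding the one of \<open>(j, i)\<close> always gives 2.\<close>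
      define m where "m i j = (if shell j = shell i then 1 else if shell j < shell i then 2 else (0::real))" for i j
      have "(\<Sum>k<N. S k) = (\<Sum>i<N. \<Sum>k<N. \<Sum>j<N. d k i * b k j * Q i j)"
        unfolding S_def by (rule sum.swap)
      also have "\<dots> = (\<Sum>i<N. \<Sum>j<N. \<Sum>k<N. d k i * b k j * Q i j)"
        by (rule sum.cong[OF refl]) (rule sum.swap)
      also have "\<dots> = (\<Sum>i<N. \<Sum>j<N. m i j * (c i * c j * Q i j))"
      proof (intro sum.cong refl)
        fix i j assume "i \<in> {..<N}"
        then have sN: "shell i < N" using shell_le[of i] by simp
        have "(\<Sum>k<N. d k i * b k j * Q i j) = (\<Sum>k<N. if k = shell i then c i * b (shell i) j * Q i j else 0)"
          by (intro sum.cong refl) (auto simp: d_def)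
        also have "\<dots> = c i * b (shell i) j * Q i j" using sN by simp
        also have "\<dots> = m i j * (c i * c j * Q i j)" by (auto simp: b_def m_def)
        finally show "(\<Sum>k<N. d k i * b k j * Q i j) = m i j * (c i * c j * Q i j)" .
      qed
      finally have e1: "(\<Sum>k<N. S k) = (\<Sum>i<N. \<Sum>j<N. m i j * (c i * c j * Q i j))" .
      also have "\<dots> = (\<Sum>i<N. \<Sum>j<N. m j i * (c i * c j * Q i j))"
        by (subst sum.swap) (intro sum.cong refl, simp add: Qsym mult_ac)
      finally have e2: "(\<Sum>k<N. S k) = (\<Sum>i<N. \<Sum>j<N. m j i * (c i * c j * Q i j))" .
      have "2 * (\<Sum>k<N. S k) = (\<Sum>i<N. \<Sum>j<N. (m i j + m j i) * (c i * c j * Q i j))"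
        using e1 e2 by (simp add: ring_distribs sum.distrib)
      also have "\<dots> = (\<Sum>i<N. \<Sum>j<N. 2 * (c i * c j * Q i j))"
        by (intro sum.cong refl) (auto simp: m_def)
      also have "\<dots> = 2 * (\<Sum>i<N. \<Sum>j<N. c i * c j * Q i j)" by (simp add: sum_distrib_left)
      finally show ?thesis by simp
    qed
    \<comment> \<open>The coefficient of \<open>(c i)\<^sup>2\<close> in the bound for the \<open>k\<close>-th pairing, up to the constant \<open>C1\<close>.\<close>
    define V where "V k i = (if shell i = k then 2 * C2 * \<mu> * (real k + 1) powr (- \<eta>) else 0) +
       (if shell i \<le> k then 4 * C2 / \<mu> * ((real k + 1) powr (- 1 - p) + (real k + 1) powr (- \<eta>) * 2 powr (- (real k - real (shell i)) / 2)) else 0)" for k i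
    have Sk: "\<bar>S k\<bar> \<le> C1 * (\<Sum>i<N. V k i * (c i)\<^sup>2)" for k
    proof -
      define \<theta> where "\<theta> = \<mu> * (real k + 1) powr (1 - \<gamma>)"
      have \<theta>: "0 < \<theta>" using mu1 by (simp add: \<theta>_def)
      define g where "g i = (real k + 1) powr \<gamma> * 2 powr (- (real k - real (shell i)) / 2)" for i
      \<comment> \<open>Above the \<open>k\<close>-th shell both vectors vanish, so the exact row sum may be used there as its own bound.\<close>
      define R where "R i = (if shell i \<le> k then C2 * (1 + g i) else (\<Sum>j<N. exp (- T k * (x i - x j)\<^sup>2)))" for i
      have R: "(\<Sum>j<N. exp (- T k * (x i - x j)\<^sup>2)) \<le> R i" if "i < N" for i
        using row[OF h _ that, of k] by (auto simp: R_def g_def \<gamma>_def)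
      define K where "K = (real k + 1) powr (- (1 + \<eta>))"
      have K0: "0 \<le> K" by (simp add: K_def)
      have "\<bar>S k\<bar> \<le> C1 * K * (\<theta> * (\<Sum>i<N. R i * (d k i)\<^sup>2) + (\<Sum>i<N. R i * (b k i)\<^sup>2) / \<theta>)"
        unfolding S_def Q_def K_def by (rule shell_bound[OF h \<eta> \<theta> _ _ R]) (auto simp: d_def b_def)
      also have "\<dots> = C1 * (\<Sum>i<N. K * \<theta> * (R i * (d k i)\<^sup>2) + K / \<theta> * (R i * (b k i)\<^sup>2))"
        by (simp add: sum.distrib sum_distrib_left sum_divide_distrib ring_distribs mult_ac)
      also have "\<dots> \<le> C1 * (\<Sum>i<N. V k i * (c i)\<^sup>2)"
      proof (intro mult_left_mono sum_mono)
        fix i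
        have g1: "shell i = k \<Longrightarrow> g i = (real k + 1) powr \<gamma>" by (simp add: g_def)
        have k1: "K * \<theta> * (real k + 1) powr \<gamma> = \<mu> * (real k + 1) powr (- \<eta>)"
        proof -
          have "K * \<theta> * (real k + 1) powr \<gamma> = \<mu> * (K * (real k + 1) powr (1 - \<gamma>) * (real k + 1) powr \<gamma>)" by (simp add: \<theta>_def)
          also have "K * (real k + 1) powr (1 - \<gamma>) * (real k + 1) powr \<gamma> = (real k + 1) powr (- (1 + \<eta>) + (1 - \<gamma>) + \<gamma>)"
            by (simp only: K_def powr_add)
          finally show ?thesis by simp
        qed
        have first: "K * \<theta> * (R i * (d k i)\<^sup>2) \<le> (if shell i = k then 2 * C2 * \<mu> * (real k + 1) powr (- \<eta>) else 0) * (c i)\<^sup>2"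
        proof (cases "shell i = k")
          case True
          have "R i \<le> C2 * (2 * (real k + 1) powr \<gamma>)"
            using True C2 k_powr(1)[of k] by (simp add: R_def g1)
          then have "K * \<theta> * R i \<le> K * \<theta> * (C2 * (2 * (real k + 1) powr \<gamma>))"
            using K0 \<theta> by (intro mult_left_mono) auto
          also have "\<dots> = 2 * C2 * (K * \<theta> * (real k + 1) powr \<gamma>)" by simp
          also have "\<dots> = 2 * C2 * \<mu> * (real k + 1) powr (- \<eta>)" unfolding k1 by simp
          finally have "K * \<theta> * R i * (c i)\<^sup>2 \<le> 2 * C2 * \<mu> * (real k + 1) powr (- \<eta>) * (c i)\<^sup>2" by (rule mult_right_mono) simp
          then show ?thesis using True by (simp add: d_def mult.assoc)
        qed (simp add: d_def)
        have k2: "K / \<theta> = (real k + 1) powr (- 1 - p) / \<mu>"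
        proof -
          have "K / (real k + 1) powr (1 - \<gamma>) = (real k + 1) powr (- (1 + \<eta>) - (1 - \<gamma>))" by (simp only: K_def powr_diff)
          also have "- (1 + \<eta>) - (1 - \<gamma>) = - 1 - p" by (simp add: p_def)
          finally have pw: "K / (real k + 1) powr (1 - \<gamma>) = (real k + 1) powr (- 1 - p)" .
          have "K / \<theta> = K / (real k + 1) powr (1 - \<gamma>) / \<mu>"
            unfolding \<theta>_def divide_divide_eq_left by (simp only: mult.commute[of \<mu>])
          then show ?thesis unfolding pw .
        qed
        have second: "K / \<theta> * (R i * (b k i)\<^sup>2) \<le> (if shell i \<le> k then 4 * C2 / \<mu> * ((real k + 1) powr (- 1 - p) + (real k + 1) powr (- \<eta>) * 2 powr (- (real k - real (shell i)) / 2)) else 0) * (c i)\<^sup>2"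
        proof (cases "shell i \<le> k")
          case True
          have "(b k i)\<^sup>2 \<le> 4 * (c i)\<^sup>2" using True by (auto simp: b_def power_mult_distrib)
          then have "K / \<theta> * (R i * (b k i)\<^sup>2) \<le> K / \<theta> * (R i * (4 * (c i)\<^sup>2))"
          proof (intro mult_left_mono)
            show "0 \<le> R i" using True C2 by (simp add: R_def g_def)
            show "0 \<le> K / \<theta>" using K0 \<theta> by simp
          qed
          also have "\<dots> = 4 * C2 / \<mu> * ((real k + 1) powr (- 1 - p) * (1 + g i)) * (c i)\<^sup>2"
            unfolding k2 using True by (simp add: R_def mult_ac)
          also have "\<dots> \<le> 4 * C2 / \<mu> * ((real k + 1) powr (- 1 - p) + (real k + 1) powr (- \<eta>) * 2 powr (- (real k - real (shell i)) / 2)) * (c i)\<^sup>2"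
          proof -
            have "(real k + 1) powr (- 1 - p) * (real k + 1) powr \<gamma> = (real k + 1) powr (- 1 - p + \<gamma>)" by (simp only: powr_add)
            also have "\<dots> \<le> (real k + 1) powr (- \<eta>)" using \<gamma> by (intro powr_mono) (auto simp: p_def)
            finally have "(real k + 1) powr (- 1 - p) * g i \<le> (real k + 1) powr (- \<eta>) * 2 powr (- (real k - real (shell i)) / 2)"
              unfolding g_def mult.assoc[symmetric] by (intro mult_right_mono) auto
            then have "(real k + 1) powr (- 1 - p) * (1 + g i) \<le> (real k + 1) powr (- 1 - p) + (real k + 1) powr (- \<eta>) * 2 powr (- (real k - real (shell i)) / 2)"
              by (simp add: distrib_left)
            then show ?thesis using C2 mu1 by (intro mult_right_mono mult_left_mono) auto
          qed
          finally show ?thesis using True by simp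
        qed (auto simp: b_def)
        show "K * \<theta> * (R i * (d k i)\<^sup>2) + K / \<theta> * (R i * (b k i)\<^sup>2) \<le> V k i * (c i)\<^sup>2"
          unfolding V_def distrib_right by (rule add_mono[OF first second])
      qed (use C1 in auto)
      finally show ?thesis .
    qed
    have Vsum: "(\<Sum>k<N. V k i) \<le> C2 * 22 * \<mu> * (2 * lg (real i) powr (- \<eta>))" for i
    proof -
      define s where "s = shell i"
      define L where "L = (real s + 1) powr (- \<eta>)"
      have L0: "0 \<le> L" by (simp add: L_def)
      have "(\<Sum>k<N. V k i) = (\<Sum>k<N. if shell i = k then 2 * C2 * \<mu> * (real k + 1) powr (- \<eta>) else 0) +
         (\<Sum>k<N. if shell i \<le> k then 4 * C2 / \<mu> * ((real k + 1) powr (- 1 - p) + (real k + 1) powr (- \<eta>) * 2 powr (- (real k - real (shell i)) / 2)) else 0)"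
        unfolding V_def sum.distrib ..
      also have "(\<Sum>k<N. if shell i = k then 2 * C2 * \<mu> * (real k + 1) powr (- \<eta>) else 0) \<le> 2 * C2 * \<mu> * L"
        using C2 mu1 L0 by (auto simp: sum.delta' L_def s_def)
      also have "(\<Sum>k<N. if shell i \<le> k then 4 * C2 / \<mu> * ((real k + 1) powr (- 1 - p) + (real k + 1) powr (- \<eta>) * 2 powr (- (real k - real (shell i)) / 2)) else 0)
         = (\<Sum>k\<in>{s..<N}. 4 * C2 / \<mu> * ((real k + 1) powr (- 1 - p) + (real k + 1) powr (- \<eta>) * 2 powr (- (real k - real s) / 2)))"
        unfolding s_def by (rule sum.mono_neutral_cong_right) auto
      also have "\<dots> = 4 * C2 / \<mu> * ((\<Sum>k\<in>{s..<N}. (real k + 1) powr (- 1 - p)) + (\<Sum>k\<in>{s..<N}. (real k + 1) powr (- \<eta>) * 2 powr (- (real k - real s) / 2)))"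
        unfolding sum.distrib[symmetric] by (rule sum_distrib_left[symmetric])
      also have "\<dots> \<le> 4 * C2 / \<mu> * (L * (\<mu> * \<mu>) + L * 4)"
      proof (intro mult_left_mono add_mono)
        have "(\<Sum>k\<in>{s..<N}. (real k + 1) powr (- 1 - p)) \<le> (real s + 1) powr (- p) * (1 + 1 / p)" by (rule sum_powr_tail_le[OF p(1)])
        also have "\<dots> \<le> L * (1 + 1 / p)" unfolding L_def using p by (intro mult_right_mono powr_mono) auto
        finally show "(\<Sum>k\<in>{s..<N}. (real k + 1) powr (- 1 - p)) \<le> L * (\<mu> * \<mu>)" by (simp add: mu2)
        have "(\<Sum>k\<in>{s..<N}. (real k + 1) powr (- \<eta>) * 2 powr (- (real k - real s) / 2)) \<le> (\<Sum>k\<in>{s..<N}. L * 2 powr (- (real k - real s) / 2))"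
          unfolding L_def using \<eta> by (intro sum_mono mult_right_mono powr_mono2') auto
        also have "\<dots> = L * (\<Sum>k\<in>{s..<N}. 2 powr (- (real k - real s) / 2))" by (simp add: sum_distrib_left)
        also have "\<dots> \<le> L * 4" using L0 by (intro mult_left_mono sum_half_powers_le) auto
        finally show "(\<Sum>k\<in>{s..<N}. (real k + 1) powr (- \<eta>) * 2 powr (- (real k - real s) / 2)) \<le> L * 4" .
      qed (use C2 mu1 in auto)
      also have "\<dots> \<le> 4 * C2 / \<mu> * (L * (5 * (\<mu> * \<mu>)))"
      proof (intro mult_left_mono)
        have "1 * 1 \<le> \<mu> * \<mu>" using mu1 by (intro mult_mono) auto
        then have "L * (\<mu> * \<mu> + 4) \<le> L * (5 * (\<mu> * \<mu>))" using L0 by (intro mult_left_mono) auto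
        then show "L * (\<mu> * \<mu>) + L * 4 \<le> L * (5 * (\<mu> * \<mu>))" by (simp add: distrib_left)
      qed (use C2 mu1 in auto)
      also have "\<dots> = 20 * C2 * \<mu> * L" using mu1 by simp
      finally have "(\<Sum>k<N. V k i) \<le> C2 * 22 * \<mu> * L" by (simp add: algebra_simps)
      also have "L \<le> 2 * lg (real i) powr (- \<eta>)"
      proof -
        have "L \<le> (lg (real i) / 2) powr (- \<eta>)"
          unfolding L_def s_def using lg_shell(1)[of i] \<eta> lg_ge_1[of "real i"] by (intro powr_mono2') auto
        also have "\<dots> = 2 powr \<eta> * lg (real i) powr (- \<eta>)"
          using lg_ge_1[of "real i"] by (simp add: powr_divide powr_minus_divide)
        also have "\<dots> \<le> 2 powr 1 * lg (real i) powr (- \<eta>)" using \<eta> by (intro mult_right_mono powr_mono) auto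
        finally show ?thesis by simp
      qed
      then have "C2 * 22 * \<mu> * L \<le> C2 * 22 * \<mu> * (2 * lg (real i) powr (- \<eta>))"
        using C2 mu1 by (intro mult_left_mono) auto
      finally show ?thesis by simp
    qed
    have "\<bar>\<Sum>i<N. \<Sum>j<N. c i * c j * Q i j\<bar> \<le> (\<Sum>k<N. \<bar>S k\<bar>)" unfolding total[symmetric] by (rule sum_abs)
    also have "\<dots> \<le> (\<Sum>k<N. C1 * (\<Sum>i<N. V k i * (c i)\<^sup>2))" by (intro sum_mono Sk)
    also have "\<dots> = C1 * (\<Sum>i<N. (\<Sum>k<N. V k i) * (c i)\<^sup>2)"
      unfolding sum_distrib_left[symmetric] sum_distrib_right by (subst sum.swap) simp
    also have "\<dots> \<le> C1 * (\<Sum>i<N. (C2 * 22 * \<mu> * (2 * lg (real i) powr (- \<eta>))) * (c i)\<^sup>2)"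
      using C1 by (intro mult_left_mono sum_mono mult_right_mono Vsum) auto
    also have "\<dots> = C * \<mu> * (\<Sum>i<N. lg (real i) powr (- \<eta>) * (c i)\<^sup>2)"
      by (simp add: sum_distrib_left C_def mult_ac)
    finally show "\<bar>\<Sum>i<N. \<Sum>j<N. c i * c j * kernel_Q \<eta> (x i) (x j)\<bar>
         \<le> C * sqrt (1 + 1 / (1 - 2 * \<beta> + \<eta>)) * (\<Sum>i<N. lg (real i) powr (- \<eta>) * (c i)\<^sup>2)"
      by (simp add: Q_def \<mu>_def p_def \<gamma>_def)
  qed
qed

section \<open>From finite sections to operators\<close>

text \<open>Polarisation bounds the bilinear form of \<open>y\<close>, the image of \<open>c\<close>, and \<open>B c\<close>; this form is \<open>B\<close> times the square norm of \<open>y\<close>.\<close>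

lemma finite_form_polarization:
  fixes A :: "nat \<Rightarrow> nat \<Rightarrow> real"
  assumes sym: "\<And>i j. A i j = A j i" and B: "0 < B"
    and form: "\<And>c. \<bar>\<Sum>i<N. \<Sum>j<N. A i j * (c i * c j)\<bar> \<le> B * (\<Sum>i<N. (c i)\<^sup>2)"
  shows "(\<Sum>i<N. (\<Sum>j<N. A i j * c j)\<^sup>2) \<le> B\<^sup>2 * (\<Sum>j<N. (c j)\<^sup>2)"
proof -
  define q where "q c = (\<Sum>i<N. \<Sum>j<N. A i j * (c i * c j))" for c
  define y where "y i = (\<Sum>j<N. A i j * c j)" for i
  have bil: "(\<Sum>i<N. \<Sum>j<N. A i j * (d i * e j)) = (q (\<lambda>i. d i + e i) - q (\<lambda>i. d i - e i)) / 4" for d e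
  proof -
    have "q (\<lambda>i. d i + e i) - q (\<lambda>i. d i - e i) = (\<Sum>i<N. \<Sum>j<N. 2 * (A i j * (d i * e j)) + 2 * (A i j * (d j * e i)))"
      unfolding q_def sum_subtractf[symmetric] by (intro sum.cong refl) (simp add: algebra_simps)
    also have "\<dots> = 2 * (\<Sum>i<N. \<Sum>j<N. A i j * (d i * e j)) + 2 * (\<Sum>i<N. \<Sum>j<N. A i j * (d j * e i))"
      by (simp add: sum.distrib sum_distrib_left)
    also have "(\<Sum>i<N. \<Sum>j<N. A i j * (d j * e i)) = (\<Sum>i<N. \<Sum>j<N. A i j * (d i * e j))"
      by (subst sum.swap) (simp add: sym)
    finally show ?thesis by simp
  qed
  have le: "(\<Sum>i<N. \<Sum>j<N. A i j * (d i * e j)) \<le> B * ((\<Sum>i<N. (d i)\<^sup>2) + (\<Sum>i<N. (e i)\<^sup>2)) / 2" for d e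
  proof -
    define U where "U = B * ((\<Sum>i<N. (d i)\<^sup>2) + (\<Sum>i<N. (e i)\<^sup>2))"
    have "\<bar>q (\<lambda>i. d i + e i)\<bar> \<le> B * (\<Sum>i<N. (d i + e i)\<^sup>2)" "\<bar>q (\<lambda>i. d i - e i)\<bar> \<le> B * (\<Sum>i<N. (d i - e i)\<^sup>2)"
      unfolding q_def by (rule form)+
    then have "q (\<lambda>i. d i + e i) \<le> B * (\<Sum>i<N. (d i + e i)\<^sup>2)" "- q (\<lambda>i. d i - e i) \<le> B * (\<Sum>i<N. (d i - e i)\<^sup>2)"
      by (simp_all only: abs_le_iff)
    moreover have "B * (\<Sum>i<N. (d i + e i)\<^sup>2) + B * (\<Sum>i<N. (d i - e i)\<^sup>2) = 2 * U"
      unfolding U_def distrib_left[symmetric] sum.distrib[symmetric] sum_distrib_left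
      by (intro sum.cong refl) (simp add: power2_eq_square algebra_simps)
    ultimately have "q (\<lambda>i. d i + e i) - q (\<lambda>i. d i - e i) \<le> 2 * U" by linarith
    then show ?thesis unfolding bil U_def[symmetric] by simp
  qed
  have "B * (\<Sum>i<N. (y i)\<^sup>2) = (\<Sum>i<N. \<Sum>j<N. A i j * (y i * (B * c j)))"
    unfolding sum_distrib_left power2_eq_square by (intro sum.cong refl) (simp add: y_def sum_distrib_left sum_distrib_right mult_ac)
  also have "\<dots> \<le> B * ((\<Sum>i<N. (y i)\<^sup>2) + (\<Sum>i<N. (B * c i)\<^sup>2)) / 2" by (rule le)
  also have "(\<Sum>i<N. (B * c i)\<^sup>2) = B\<^sup>2 * (\<Sum>i<N. (c i)\<^sup>2)" by (simp add: power_mult_distrib sum_distrib_left)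
  finally have "B * (\<Sum>i<N. (y i)\<^sup>2) \<le> B * (((\<Sum>i<N. (y i)\<^sup>2) + B\<^sup>2 * (\<Sum>i<N. (c i)\<^sup>2)) / 2)" by simp
  then have "(\<Sum>i<N. (y i)\<^sup>2) \<le> ((\<Sum>i<N. (y i)\<^sup>2) + B\<^sup>2 * (\<Sum>i<N. (c i)\<^sup>2)) / 2" using B by (simp only: mult_le_cancel_left_pos)
  then show ?thesis by (simp add: y_def)
qed

lemma norm_ell2_eq: "norm f = sqrt (\<Sum>n. (ell2_nth f n)\<^sup>2)"
  by (simp add: norm_ell2_def inner_ell2_def power2_eq_square)

text \<open>A uniform bound on the forms of the finite sections bounds the norms of the rectangular sections. Applied to unit
  vectors this shows that the rows are square summable, so the row series converge; letting the number of columns tend to infinity first and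
  the number of rows afterwards bounds the image.\<close>

lemma symmetric_matrix_operator:
  fixes A :: "nat \<Rightarrow> nat \<Rightarrow> real"
  assumes sym: "\<And>i j. A i j = A j i" and B: "0 < B"
    and form: "\<And>N c. \<bar>\<Sum>i<N. \<Sum>j<N. A i j * (c i * c j)\<bar> \<le> B * (\<Sum>i<N. (c i)\<^sup>2)"
  obtains F :: "ell2 \<Rightarrow>\<^sub>L ell2" where "has_matrix F A" "norm F \<le> B"
proof -
  have rect: "(\<Sum>i<M. (\<Sum>j<N. A i j * c j)\<^sup>2) \<le> B\<^sup>2 * (\<Sum>j<N. (c j)\<^sup>2)" for M N c
  proof -
    define K where "K = max M N"
    define c' where "c' j = (if j < N then c j else 0)" for j
    have s1: "(\<Sum>j<K. A i j * c' j) = (\<Sum>j<N. A i j * c j)" for i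
      by (rule sum.mono_neutral_cong_right) (auto simp: c'_def K_def)
    have s2: "(\<Sum>j<K. (c' j)\<^sup>2) = (\<Sum>j<N. (c j)\<^sup>2)"
      by (rule sum.mono_neutral_cong_right) (auto simp: c'_def K_def)
    have "(\<Sum>i<M. (\<Sum>j<N. A i j * c j)\<^sup>2) \<le> (\<Sum>i<K. (\<Sum>j<N. A i j * c j)\<^sup>2)"
      by (rule sum_mono2) (auto simp: K_def)
    also have "\<dots> \<le> B\<^sup>2 * (\<Sum>j<K. (c' j)\<^sup>2)"
      using finite_form_polarization[where N = K and c = c', OF sym B form] by (simp add: s1)
    finally show ?thesis by (simp add: s2)
  qed
  have row_sq: "summable (\<lambda>j. (A i j)\<^sup>2)" for i
  proof (rule summableI_nonneg_bounded[of _ "B\<^sup>2"])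
    fix M
    have "(\<Sum>j<M. (\<Sum>l<Suc i. A j l * (if l = i then 1 else 0))\<^sup>2) \<le> B\<^sup>2 * (\<Sum>l<Suc i. (if l = i then 1 else 0)\<^sup>2)"
      by (rule rect)
    moreover have "(\<Sum>l<Suc i. A j l * (if l = i then 1 else 0)) = A i j" for j
      by (simp add: sym[of j i])
    moreover have "(\<Sum>l<Suc i. (if l = i then 1 else 0)\<^sup>2) = (1::real)" by simp
    ultimately show "(\<Sum>j<M. (A i j)\<^sup>2) \<le> B\<^sup>2" by simp
  qed simp
  have summ: "summable (\<lambda>j. A i j * ell2_nth c j)" for i c
    by (intro summable_mult_of_squares row_sq summable_ell2_square)
  define y where "y c i = (\<Sum>j. A i j * ell2_nth c j)" for c i
  have ybound: "(\<Sum>i<M. (y c i)\<^sup>2) \<le> B\<^sup>2 * (\<Sum>j. (ell2_nth c j)\<^sup>2)" for c M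
  proof (rule LIMSEQ_le_const2)
    show "(\<lambda>N. \<Sum>i<M. (\<Sum>j<N. A i j * ell2_nth c j)\<^sup>2) \<longlonglongrightarrow> (\<Sum>i<M. (y c i)\<^sup>2)"
      unfolding y_def by (intro tendsto_sum tendsto_power summable_LIMSEQ summ)
    have "(\<Sum>i<M. (\<Sum>j<N. A i j * ell2_nth c j)\<^sup>2) \<le> B\<^sup>2 * (\<Sum>j. (ell2_nth c j)\<^sup>2)" for N
    proof -
      have "B\<^sup>2 * (\<Sum>j<N. (ell2_nth c j)\<^sup>2) \<le> B\<^sup>2 * (\<Sum>j. (ell2_nth c j)\<^sup>2)"
        by (intro mult_left_mono sum_le_suminf summable_ell2_square) auto
      then show ?thesis using rect[where M = M and N = N and c = "ell2_nth c"] by linarith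
    qed
    then show "\<exists>N. \<forall>n\<ge>N. (\<Sum>i<M. (\<Sum>j<n. A i j * ell2_nth c j)\<^sup>2) \<le> B\<^sup>2 * (\<Sum>j. (ell2_nth c j)\<^sup>2)" by blast
  qed
  have ysum: "summable (\<lambda>i. (y c i)\<^sup>2)" for c
    by (rule summableI_nonneg_bounded[OF _ ybound]) simp
  define f where "f c = Abs_ell2 (y c)" for c
  have nth: "ell2_nth (f c) i = y c i" for c i
    unfolding f_def using ysum by (subst Abs_ell2_inverse) auto
  have norm_f: "norm (f c) \<le> norm c * B" for c
  proof -
    have "(\<Sum>i. (y c i)\<^sup>2) \<le> B\<^sup>2 * (\<Sum>j. (ell2_nth c j)\<^sup>2)" by (rule suminf_le_const[OF ysum ybound])
    then have "sqrt (\<Sum>i. (y c i)\<^sup>2) \<le> sqrt (B\<^sup>2 * (\<Sum>j. (ell2_nth c j)\<^sup>2))" by simp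
    then show ?thesis using B by (simp add: norm_ell2_eq nth real_sqrt_mult mult.commute)
  qed
  have bl: "bounded_linear f"
  proof (rule bounded_linear_intro[where K = B])
    show "f (c + d) = f c + f d" for c d
      by (rule ell2_eqI) (simp add: nth y_def plus_ell2.rep_eq distrib_left suminf_add summ)
    show "f (r *\<^sub>R c) = r *\<^sub>R f c" for r c
    proof (rule ell2_eqI)
      fix n
      have "(\<Sum>j. A n j * (r * ell2_nth c j)) = r * (\<Sum>j. A n j * ell2_nth c j)"
        by (subst suminf_mult[OF summ, symmetric]) (simp add: mult_ac)
      then show "ell2_nth (f (r *\<^sub>R c)) n = ell2_nth (r *\<^sub>R f c) n"
        by (simp add: nth y_def scaleR_ell2.rep_eq)
    qed
    show "norm (f c) \<le> norm c * B" for c by (rule norm_f)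
  qed
  show ?thesis
  proof (rule that[of "Blinfun f"])
    show "has_matrix (Blinfun f) A"
      unfolding has_matrix_def bounded_linear_Blinfun_apply[OF bl] nth y_def using summable_sums[OF summ] by blast
    show "norm (Blinfun f) \<le> B"
      by (rule norm_blinfun_bound) (use B norm_f in \<open>auto simp: bounded_linear_Blinfun_apply[OF bl] mult.commute\<close>)
  qed
qed

lemma has_matrix_add_identity:
  assumes "has_matrix F A" "\<And>i j. M i j = A i j + (if i = j then 1 else 0)"
  shows "has_matrix (F + id_blinfun) M"
  unfolding has_matrix_def
proof (intro allI)
  fix c i
  have "(\<lambda>j. if j = i then ell2_nth c j else 0) sums ell2_nth c i" by (rule sums_single)
  then have "(\<lambda>j. A i j * ell2_nth c j + (if j = i then ell2_nth c j else 0)) sums (ell2_nth (blinfun_apply F c) i + ell2_nth c i)"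
    using assms(1) unfolding has_matrix_def by (intro sums_add) auto
  moreover have "A i j * ell2_nth c j + (if j = i then ell2_nth c j else 0) = M i j * ell2_nth c j" for j
    by (simp add: assms(2) distrib_right)
  ultimately show "(\<lambda>j. M i j * ell2_nth c j) sums ell2_nth (blinfun_apply (F + id_blinfun) c) i"
    by (simp add: blinfun.add_left plus_ell2.rep_eq)
qed

section \<open>The norm estimate\<close>

theorem theorem2p5:
  "\<exists>\<eta>\<^sub>0 :: real. 0 < \<eta>\<^sub>0 \<and> \<eta>\<^sub>0 < 1 \<and>
     (\<exists>(C\<^sub>\<beta> :: real \<Rightarrow> real) (C :: real). (\<forall>\<beta>. 0 < C\<^sub>\<beta> \<beta>) \<and> 0 < C \<and>
       (\<forall>\<beta> \<eta>. 0 \<le> \<beta> \<and> \<beta> \<le> 1/2 \<and> 0 < \<eta> \<and> \<eta> \<le> \<eta>\<^sub>0 \<longrightarrow>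
         (\<exists>G :: ell2 \<Rightarrow>\<^sub>L ell2. has_matrix G (gram \<beta> \<eta>) \<and>
           norm (G - id_blinfun) \<le> (if \<beta> < 1/2 then C\<^sub>\<beta> \<beta> * \<eta> else C * sqrt \<eta>))))"
proof -
  obtain c \<eta>0 where c: "0 < c" and \<eta>0: "0 < \<eta>0" "\<eta>0 < 1" and diag:
    "\<And>\<beta> \<eta> i. 0 \<le> \<beta> \<Longrightarrow> \<beta> \<le> 1/2 \<Longrightarrow> 0 < \<eta> \<Longrightarrow> \<eta> \<le> \<eta>0 \<Longrightarrow>
       c / \<eta> * lg (real i) powr (- \<eta>) \<le> kernel_K \<eta> (node_star \<beta> i) (node_star \<beta> i)"
    using kernel_K_diag_ge by blast
  obtain CP where CP: "0 < CP" and P: "\<And>\<beta> \<eta> N c. 0 \<le> \<beta> \<Longrightarrow> \<beta> \<le> 1/2 \<Longrightarrow> 0 < \<eta> \<Longrightarrow> \<eta> \<le> 1 \<Longrightarrow>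
       (\<Sum>i<N. \<Sum>j<N. (if i = j then 0 else kernel_P \<eta> (node_star \<beta> i) (node_star \<beta> j)) * (\<bar>c i\<bar> * \<bar>c j\<bar>))
         \<le> CP * (\<Sum>i<N. lg (real i) powr (- \<eta>) * (c i)\<^sup>2)"
    using kernel_P_form_le by blast
  obtain CQ where CQ: "0 < CQ" and Q: "\<And>\<beta> \<eta> N c. 0 \<le> \<beta> \<Longrightarrow> \<beta> \<le> 1/2 \<Longrightarrow> 0 < \<eta> \<Longrightarrow> \<eta> \<le> 1 \<Longrightarrow>
       \<bar>\<Sum>i<N. \<Sum>j<N. c i * c j * kernel_Q \<eta> (node_star \<beta> i) (node_star \<beta> j)\<bar>
         \<le> CQ * sqrt (1 + 1 / (1 - 2 * \<beta> + \<eta>)) * (\<Sum>i<N. lg (real i) powr (- \<eta>) * (c i)\<^sup>2)"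
    using kernel_Q_form_le by blast
  define D where "D = (CP + 2 * CQ) / c"
  have D: "0 < D" using CP CQ c by (simp add: D_def)
  have main: "\<exists>G :: ell2 \<Rightarrow>\<^sub>L ell2. has_matrix G (gram \<beta> \<eta>) \<and> norm (G - id_blinfun) \<le> D * sqrt (1 + 1 / (1 - 2 * \<beta> + \<eta>)) * \<eta>"
    if \<beta>: "0 \<le> \<beta>" "\<beta> \<le> 1/2" and \<eta>: "0 < \<eta>" "\<eta> \<le> \<eta>0" for \<beta> \<eta>
  proof -
    have \<eta>1: "\<eta> \<le> 1" using \<eta> \<eta>0 by simp
    define \<mu> where "\<mu> = sqrt (1 + 1 / (1 - 2 * \<beta> + \<eta>))"
    have \<mu>: "1 \<le> \<mu>" unfolding \<mu>_def using \<beta> \<eta> by simp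
    define K where "K i j = kernel_K \<eta> (node_star \<beta> i) (node_star \<beta> j)" for i j
    define p where "p i j = kernel_P \<eta> (node_star \<beta> i) (node_star \<beta> j)" for i j
    define q where "q i j = kernel_Q \<eta> (node_star \<beta> i) (node_star \<beta> j)" for i j
    have Kpq: "K i j = p i j + q i j" for i j
      unfolding K_def p_def q_def by (rule kernel_K_split[OF \<eta>(1) node_star_nonneg node_star_nonneg])
    have p0: "0 \<le> p i j" for i j unfolding p_def by (rule kernel_P_nonneg[OF \<eta>(1) node_star_nonneg node_star_nonneg])
    have Ksym: "K i j = K j i" for i j
      unfolding K_def kernel_K_def by (simp add: mult.assoc mult.commute[of "hermite_fun _ (node_star \<beta> i)"])
    define w where "w i = lg (real i) powr (- \<eta>)" for i :: nat
    have w0: "0 < w i" for i unfolding w_def using lg_ge_1[of "real i"] by simp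
    have Kd: "c / \<eta> * w i \<le> K i i" for i unfolding w_def K_def by (rule diag[OF \<beta> \<eta>])
    have K0: "0 < K i i" for i using Kd[of i] w0[of i] c \<eta> by (smt (verit) mult_pos_pos divide_pos_pos)
    have gram: "gram \<beta> \<eta> i j = K i j / (sqrt (K i i) * sqrt (K j j))" for i j
      by (simp add: gram_def K_def Let_def real_sqrt_mult)
    define A where "A i j = (if i = j then 0 else gram \<beta> \<eta> i j)" for i j
    have Asym: "A i j = A j i" for i j by (simp add: A_def gram Ksym[of i j] mult.commute)
    have gA: "gram \<beta> \<eta> i j = A i j + (if i = j then 1 else 0)" for i j
      using K0[of i] by (auto simp: A_def gram)
    have form: "\<bar>\<Sum>i<N. \<Sum>j<N. A i j * (v i * v j)\<bar> \<le> (D * \<mu> * \<eta>) * (\<Sum>i<N. (v i)\<^sup>2)" for N v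
    proof -
      define e where "e i = v i / sqrt (K i i)" for i
      define W where "W = (\<Sum>i<N. w i * (e i)\<^sup>2)"
      have W0: "0 \<le> W" unfolding W_def using w0 by (intro sum_nonneg mult_nonneg_nonneg) (auto intro: less_imp_le)
      have WW: "W \<le> \<eta> / c * (\<Sum>i<N. (v i)\<^sup>2)"
        unfolding W_def sum_distrib_left
      proof (rule sum_mono)
        fix i
        have "w i \<le> \<eta> / c * K i i" using Kd[of i] c \<eta> by (simp add: field_simps)
        then have "w i * (e i)\<^sup>2 \<le> \<eta> / c * K i i * (e i)\<^sup>2" by (rule mult_right_mono) simp
        also have "\<dots> = \<eta> / c * (v i)\<^sup>2" using K0[of i] by (simp add: e_def power_divide)
        finally show "w i * (e i)\<^sup>2 \<le> \<eta> / c * (v i)\<^sup>2" .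
      qed
      \<comment> \<open>The diagonal of the cosine part is added and subtracted, since its form is estimated as a whole.\<close>
      have Aeq: "A i j * (v i * v j) = (if i = j then 0 else p i j) * (e i * e j) + (e i * e j * q i j - (if j = i then q i i * (e i)\<^sup>2 else 0))" for i j
        by (auto simp: A_def gram e_def Kpq[of i j] power2_eq_square add_divide_distrib algebra_simps)
      have eq: "(\<Sum>i<N. \<Sum>j<N. A i j * (v i * v j)) = (\<Sum>i<N. \<Sum>j<N. (if i = j then 0 else p i j) * (e i * e j))
          + ((\<Sum>i<N. \<Sum>j<N. e i * e j * q i j) - (\<Sum>i<N. q i i * (e i)\<^sup>2))"
        unfolding Aeq sum.distrib sum_subtractf by simp
      have 1: "\<bar>\<Sum>i<N. \<Sum>j<N. (if i = j then 0 else p i j) * (e i * e j)\<bar> \<le> CP * W"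
      proof -
        have "\<bar>\<Sum>i<N. \<Sum>j<N. (if i = j then 0 else p i j) * (e i * e j)\<bar> \<le> (\<Sum>i<N. \<Sum>j<N. \<bar>(if i = j then 0 else p i j) * (e i * e j)\<bar>)"
          by (rule order_trans[OF sum_abs sum_mono[OF sum_abs]])
        also have "\<dots> = (\<Sum>i<N. \<Sum>j<N. (if i = j then 0 else p i j) * (\<bar>e i\<bar> * \<bar>e j\<bar>))"
          by (intro sum.cong refl) (use p0 in \<open>auto simp: abs_mult\<close>)
        also have "\<dots> \<le> CP * W" unfolding p_def W_def w_def by (rule P[OF \<beta> \<eta>(1) \<eta>1])
        finally show ?thesis .
      qed
      have 2: "\<bar>\<Sum>i<N. \<Sum>j<N. e i * e j * q i j\<bar> \<le> CQ * \<mu> * W"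
        unfolding q_def W_def w_def \<mu>_def by (rule Q[OF \<beta> \<eta>(1) \<eta>1])
      \<comment> \<open>The diagonal entry is the value of the cosine form at a unit vector.\<close>
      have qd: "\<bar>q i i\<bar> \<le> CQ * \<mu> * w i" for i
      proof -
        define b where "b j = (if j = i then 1 else 0 :: real)" for j
        have "(\<Sum>k<Suc i. \<Sum>j<Suc i. b k * b j * q k j) = (\<Sum>k<Suc i. if k = i then q i i else 0)"
        proof (rule sum.cong[OF refl])
          fix k
          have "(\<Sum>j<Suc i. b k * b j * q k j) = (\<Sum>j<Suc i. if j = i then b k * q k i else 0)"
            by (rule sum.cong[OF refl]) (auto simp: b_def)
          also have "\<dots> = b k * q k i" by simp
          finally show "(\<Sum>j<Suc i. b k * b j * q k j) = (if k = i then q i i else 0)" by (simp add: b_def)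
        qed
        also have "\<dots> = q i i" by simp
        finally have l: "(\<Sum>k<Suc i. \<Sum>j<Suc i. b k * b j * q k j) = q i i" .
        have "(\<Sum>k<Suc i. w k * (b k)\<^sup>2) = (\<Sum>k<Suc i. if k = i then w i else 0)"
          by (rule sum.cong[OF refl]) (auto simp: b_def)
        also have "\<dots> = w i" by simp
        finally have r: "(\<Sum>k<Suc i. w k * (b k)\<^sup>2) = w i" .
        have "\<bar>\<Sum>k<Suc i. \<Sum>j<Suc i. b k * b j * q k j\<bar> \<le> CQ * \<mu> * (\<Sum>k<Suc i. w k * (b k)\<^sup>2)"
          unfolding q_def w_def \<mu>_def by (rule Q[OF \<beta> \<eta>(1) \<eta>1])
        then show ?thesis unfolding l r .
      qed
      have 3: "\<bar>\<Sum>i<N. q i i * (e i)\<^sup>2\<bar> \<le> CQ * \<mu> * W"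
      proof -
        have "\<bar>\<Sum>i<N. q i i * (e i)\<^sup>2\<bar> \<le> (\<Sum>i<N. \<bar>q i i * (e i)\<^sup>2\<bar>)" by (rule sum_abs)
        also have "\<dots> \<le> (\<Sum>i<N. CQ * \<mu> * w i * (e i)\<^sup>2)"
          by (intro sum_mono) (auto simp: abs_mult intro!: mult_right_mono qd)
        also have "\<dots> = CQ * \<mu> * W" by (simp add: W_def sum_distrib_left mult.assoc)
        finally show ?thesis .
      qed
      have "CP * W \<le> CP * \<mu> * W" using CP \<mu> W0 by (intro mult_right_mono) auto
      then have "\<bar>\<Sum>i<N. \<Sum>j<N. A i j * (v i * v j)\<bar> \<le> CP * \<mu> * W + (CQ * \<mu> * W + CQ * \<mu> * W)"
        unfolding eq using 1 2 3 by linarith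
      also have "\<dots> = (CP + 2 * CQ) * \<mu> * W" by (simp add: algebra_simps)
      also have "\<dots> \<le> (CP + 2 * CQ) * \<mu> * (\<eta> / c * (\<Sum>i<N. (v i)\<^sup>2))"
        using CP CQ \<mu> by (intro mult_left_mono WW) auto
      also have "\<dots> = (D * \<mu> * \<eta>) * (\<Sum>i<N. (v i)\<^sup>2)" by (simp add: D_def)
      finally show ?thesis .
    qed
    have B: "0 < D * \<mu> * \<eta>" using D \<mu> \<eta> by simp
    obtain F where F: "has_matrix F A" "norm F \<le> D * \<mu> * \<eta>"
      by (rule symmetric_matrix_operator[OF Asym B form])
    show ?thesis
    proof (intro exI conjI)
      show "has_matrix (F + id_blinfun) (gram \<beta> \<eta>)" by (rule has_matrix_add_identity[OF F(1) gA])
      show "norm (F + id_blinfun - id_blinfun) \<le> D * sqrt (1 + 1 / (1 - 2 * \<beta> + \<eta>)) * \<eta>"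
        using F(2) by (simp add: \<mu>_def)
    qed
  qed
  define CB where "CB \<beta> = (if \<beta> < 1/2 then D * sqrt (1 + 1 / (1 - 2 * \<beta>)) else 1)" for \<beta> :: real
  have CB: "0 < CB \<beta>" for \<beta>
  proof (cases "\<beta> < 1/2")
    case True
    then have "0 < 1 + 1 / (1 - 2 * \<beta>)" by (intro add_pos_pos) auto
    then show ?thesis using D True by (simp add: CB_def)
  qed (simp add: CB_def)
  have "\<exists>G :: ell2 \<Rightarrow>\<^sub>L ell2. has_matrix G (gram \<beta> \<eta>) \<and> norm (G - id_blinfun) \<le> (if \<beta> < 1/2 then CB \<beta> * \<eta> else 2 * D * sqrt \<eta>)"
    if h: "0 \<le> \<beta> \<and> \<beta> \<le> 1/2 \<and> 0 < \<eta> \<and> \<eta> \<le> \<eta>0" for \<beta> \<eta>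
  proof -
    have b: "D * sqrt (1 + 1 / (1 - 2 * \<beta> + \<eta>)) * \<eta> \<le> (if \<beta> < 1/2 then CB \<beta> * \<eta> else 2 * D * sqrt \<eta>)"
    proof (cases "\<beta> < 1/2")
      case True
      have "1 / (1 - 2 * \<beta> + \<eta>) \<le> 1 / (1 - 2 * \<beta>)" using True h by (intro divide_left_mono mult_pos_pos) auto
      then have "D * sqrt (1 + 1 / (1 - 2 * \<beta> + \<eta>)) * \<eta> \<le> D * sqrt (1 + 1 / (1 - 2 * \<beta>)) * \<eta>"
        using D h by (intro mult_right_mono mult_left_mono) auto
      then show ?thesis using True by (simp add: CB_def)
    next
      case False
      then have \<beta>: "\<beta> = 1/2" using h by auto
      have "1 + 1 / \<eta> \<le> 4 / \<eta>" using h \<eta>0 by (simp add: field_simps)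
      then have "sqrt (1 + 1 / \<eta>) \<le> sqrt (4 / \<eta>)" by simp
      also have "\<dots> = 2 / sqrt \<eta>" by (simp add: real_sqrt_divide)
      finally have "D * sqrt (1 + 1 / \<eta>) * \<eta> \<le> D * (2 / sqrt \<eta>) * \<eta>" using D h by (intro mult_right_mono mult_left_mono) auto
      also have "\<dots> = 2 * D * (\<eta> / sqrt \<eta>)" by simp
      also have "\<eta> / sqrt \<eta> = sqrt \<eta>" using h by (simp add: real_div_sqrt)
      finally show ?thesis by (simp add: \<beta>)
    qed
    obtain G :: "ell2 \<Rightarrow>\<^sub>L ell2" where "has_matrix G (gram \<beta> \<eta>)" "norm (G - id_blinfun) \<le> D * sqrt (1 + 1 / (1 - 2 * \<beta> + \<eta>)) * \<eta>"
      using main[of \<beta> \<eta>] h by blast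
    then show ?thesis using b by (meson order_trans)
  qed
  then show ?thesis using \<eta>0 CB D
    by (intro exI[of _ \<eta>0] conjI exI[of _ CB] exI[of _ "2 * D"]) auto
qed

end
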